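(* Let $p\ge2$ and $K\ge1$ be integers. There is a nonzero polynomial $P$ in $K$ variables such that for all $\alpha_1,\dots,\alpha_K\in\mathbb{R}$ with $P(\alpha_1,\dots,\alpha_K)\ne0$ and every $E\in S_p\setminus S_{p-1}$ with $E>0$, where $S_p,S_{p-1}$ are formed with the phase set $\{0,\pm\alpha_1,\dots,\pm\alpha_K\}$, the following holds. Let $j_1,\dots,j_{p-1}\in\{1,\dots,K\}$ and signs $\epsilon_1,\dots,\epsilon_{p-1}\in\{1,-1\}$ be such that $2\sqrt E=\epsilon_1\alpha_{j_1}+\dots+\epsilon_{p-1}\alpha_{j_{p-1}}$. Then there is a constant $C>0$, depending only on $\alpha_1,\dots,\alpha_K$ and $E$, such that for all $$\gamma\in\Bigl(\frac1p,\frac1{p-1}\Bigr]$$ and all $\lambda_1,\dots,\lambda_K>0$, one can choose a function $\beta_0\in C^1$ with $$\beta_0'(x)=O(x^{-p\gamma}),\qquad \beta_0(x)=O(x^{-\gamma}),\qquad x\to\infty,$$ and functions $\xi_1,\dots,\xi_K\in C^1$ with $$\xi_k'(x)=O(x^{-p\gamma}),\qquad x\to\infty,$$ such that for the real-valued potential $V$ with $$V(x)=\sum_{k=1}^K\lambda_k\frac1{x^\gamma}\cos(\alpha_kx+\xi_k(x))+\beta_0(x),\qquad x\ge x_0,$$ the equation $-u''(x)+V(x)u(x)=Eu(x)$ has a real-valued solution $u$ with $$\frac1{\sqrt E}u'(x)+iu(x)=\mathcal{A}\,f(x)\,e^{i[\sqrt E\,x+\theta_\infty]}(1+o(1)),\qquad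 x\to\infty,$$ for some constants $\mathcal{A}>0$ and $\theta_\infty\in\mathbb{R}$, where $$f(x)=\begin{cases}x^{-C\lambda_{j_1}\cdots\lambda_{j_{p-1}}}, & \gamma=\frac1{p-1},\\[4pt] \exp\Bigl(-\frac{C}{1-(p-1)\gamma}\lambda_{j_1}\cdots\lambda_{j_{p-1}}x^{1-(p-1)\gamma}\Bigr), & \gamma\in\bigl(\frac1p,\frac1{p-1}\bigr).\end{cases}$$ In particular, for $\gamma\in(\frac1p,\frac1{p-1})$, or for $\gamma=\frac1{p-1}$ and all large enough values of the product $\lambda_{j_1}\cdots\lambda_{j_{p-1}}$, there is a boundary condition $\theta\in[0,\pi)$ such that $E$ is an eigenvalue of $H_\theta$.
   Context: For a finite set $A\subset\mathbb{R}$ and a positive integer $p$, $$S_p=\Bigl\{\tfrac{\eta^2}4\ \Bigm|\ \eta\in\bigcup_{k=1}^{p-1}(\underbrace{A+\dots+A}_{k\text{ times}})\Bigr\}$$ (with $S_1=\emptyset$); here $A=\{0,\pm\alpha_1,\dots,\pm\alpha_K\}$. $V$ is a real-valued potential on $(0,\infty)$ given by the displayed formula for $x\ge x_0$ (some $x_0>0$) and real-valued and integrable on $(0,x_0)$. For such $V$, the endpoint $0$ is regular and $-\frac{d^2}{dx^2}+V$ is limit point at $+\infty$. $H_\theta$ ($\theta\in[0,\pi)$) is the self-adjoint operator on $L^2(0,\infty)$ with domain $\{u\in L^2(0,\infty)\mid u,u'\in\mathrm{AC}_{\mathrm{loc}},\ -u''+Vu\in L^2,\ u'(0)\sin\theta=u(0)\cos\theta\}$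 acting as $H_\theta u=-u''+Vu$. *)

theory Defs
  imports "HOL-Analysis.Analysis" "HOL-Library.Landau_Symbols" "HOL-Library.Poly_Mapping"
begin

section \<open>Polynomials in several variables\<close>

text \<open>
  A real polynomial in the variables $X_i$ ($i$ a natural number) is a finitely supported map from
  exponent vectors to coefficients.
\<close>

type_synonym real_mpoly = "(nat \<Rightarrow>\<^sub>0 nat) \<Rightarrow>\<^sub>0 real"

definition mpoly_vars :: "real_mpoly \<Rightarrow> nat set" where
  "mpoly_vars P = (\<Union>m\<in>Poly_Mapping.keys P. Poly_Mapping.keys m)"

definition mpoly_eval :: "real_mpoly \<Rightarrow> (nat \<Rightarrow> real) \<Rightarrow> real" where
  "mpoly_eval P a =
     (\<Sum>m\<in>Poly_Mapping.keys P.
        Poly_Mapping.lookup P m * (\<Prod>i\<in>Poly_Mapping.keys m. a i ^ Poly_Mapping.lookup m i))"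

section \<open>The resonance sets\<close>

definition phase_set :: "nat \<Rightarrow> (nat \<Rightarrow> real) \<Rightarrow> real set" where
  "phase_set K \<alpha> = {0} \<union> (\<Union>k\<in>{1..K}. {\<alpha> k, - \<alpha> k})"

definition sumset :: "nat \<Rightarrow> real set \<Rightarrow> real set" where
  "sumset k A = {\<Sum>i<k. a i | a. \<forall>i<k. a i \<in> A}"

definition resonance_set :: "nat \<Rightarrow> real set \<Rightarrow> real set" where
  "resonance_set p A = {\<eta>\<^sup>2 / 4 | \<eta>. \<eta> \<in> (\<Union>k\<in>{1..p - 1}. sumset k A)}"

section \<open>Half-line Schroedinger operators with a regular endpoint at 0\<close>

text \<open>
  Absolute continuity in the epsilon-delta form. The members of a division are compact intervals
  with disjoint interiors; Inf and Sup are their left and right end points.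
\<close>

definition abs_continuous_on_interval :: "real \<Rightarrow> real \<Rightarrow> (real \<Rightarrow> 'a::real_normed_vector) \<Rightarrow> bool" where
  "abs_continuous_on_interval a b f \<longleftrightarrow>
     (\<forall>e>0. \<exists>d>0. \<forall>D T. D division_of T \<and> T \<subseteq> {a..b} \<and> (\<Sum>I\<in>D. Sup I - Inf I) < d \<longrightarrow>
        (\<Sum>I\<in>D. norm (f (Sup I) - f (Inf I))) < e)"

text \<open>
  The potentials considered are integrable near 0, so 0 is a regular endpoint: functions and their
  derivatives extend continuously to 0. Functions are therefore taken on the closed half-line,
  local absolute continuity refers to compact subintervals of the closed half-line, and the
  derivative at 0 is the right derivative.
\<close>

definition AC_loc :: "(real \<Rightarrow> 'a::real_normed_vector) \<Rightarrow> bool" where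
  "AC_loc f \<longleftrightarrow> (\<forall>b\<ge>0. abs_continuous_on_interval 0 b f)"

definition hderiv :: "(real \<Rightarrow> 'a::real_normed_vector) \<Rightarrow> real \<Rightarrow> 'a" where
  "hderiv u x = vector_derivative u (at x within {0..})"

definition AC1_loc :: "(real \<Rightarrow> 'a::real_normed_vector) \<Rightarrow> bool" where
  "AC1_loc u \<longleftrightarrow>
     (\<forall>x\<ge>0. u differentiable (at x within {0..})) \<and> AC_loc u \<and> AC_loc (hderiv u)"

text \<open>
  If the derivative of \<open>u\<close> is locally absolutely continuous, the second derivative exists almost
  everywhere; the expression below is only used up to null sets.
\<close>

definition schroedinger_expr ::
    "(real \<Rightarrow> real) \<Rightarrow> (real \<Rightarrow> 'a::real_normed_vector) \<Rightarrow> real \<Rightarrow> 'a" where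
  "schroedinger_expr V u x = - hderiv (hderiv u) x + V x *\<^sub>R u x"

definition schroedinger_solution :: "(real \<Rightarrow> real) \<Rightarrow> real \<Rightarrow> (real \<Rightarrow> real) \<Rightarrow> bool" where
  "schroedinger_solution V E u \<longleftrightarrow>
     AC1_loc u \<and> (AE x\<in>{0<..} in lebesgue. schroedinger_expr V u x = E * u x)"

definition L2_half_line :: "(real \<Rightarrow> complex) set" where
  "L2_half_line = {u. set_borel_measurable lebesgue {0<..} u \<and>
     set_integrable lebesgue {0<..} (\<lambda>x. (norm (u x))\<^sup>2)}"

text \<open>
  Elements of $L^2(0,\infty)$ are handled through representatives, identified when they agree
  almost everywhere on $(0,\infty)$.
\<close>

definition H_domain :: "(real \<Rightarrow> real) \<Rightarrow> real \<Rightarrow> (real \<Rightarrow> complex) set" where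
  "H_domain V \<theta> = {u \<in> L2_half_line. AC1_loc u \<and> schroedinger_expr V u \<in> L2_half_line \<and>
     hderiv u 0 * complex_of_real (sin \<theta>) = u 0 * complex_of_real (cos \<theta>)}"

definition H_eigenvalue :: "(real \<Rightarrow> real) \<Rightarrow> real \<Rightarrow> real \<Rightarrow> bool" where
  "H_eigenvalue V \<theta> E \<longleftrightarrow>
     (\<exists>u\<in>H_domain V \<theta>. \<not> (AE x\<in>{0<..} in lebesgue. u x = 0) \<and>
        (AE x\<in>{0<..} in lebesgue. schroedinger_expr V u x = complex_of_real E * u x))"

section \<open>The decay profile\<close>

text \<open>The argument \<open>L\<close> stands for the product of the coupling constants.\<close>

definition decay_profile :: "nat \<Rightarrow> real \<Rightarrow> real \<Rightarrow> real \<Rightarrow> real \<Rightarrow> real" where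
  "decay_profile p \<gamma> C L x =
     (if \<gamma> = 1 / (real p - 1) then x powr (- (C * L))
      else exp (- (C / (1 - (real p - 1) * \<gamma>) * L * x powr (1 - (real p - 1) * \<gamma>))))"

end

theory Submission
  imports Defs "HOL-Library.Multiset" "HOL-Real_Asymp.Real_Asymp"
begin

text \<open>
  Put \<open>N = p - 1\<close> and \<open>\<kappa> = sqrt E\<close>. The phases \<open>\<xi>\<^sub>k\<close> are taken to be \<open>0\<close> and the correction is a finite
  sum \<open>\<beta>\<^sub>0(x) = (\<Sum>l=1..N. c\<^sub>l x\<^sup>-\<^sup>l\<^sup>\<gamma>)\<close> with real constants \<open>c\<^sub>l\<close>. The proof is perturbation theory around the
  free solutions \<open>sin (\<kappa> x + \<theta>)\<close>.

  \<^item> A formal solution. In the ansatz \<open>\<Sum>m\<le>N. x\<^sup>-\<^sup>m\<^sup>\<gamma> s\<^sub>m(x)\<close> with trigonometric sums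
    \<open>s\<^sub>m(x) = (\<Sum>\<omega>. r\<^sub>m(\<omega>) sin (\<omega> x + \<theta>))\<close> and \<open>s\<^sub>0(x) = sin (\<kappa> x + \<theta>)\<close>, the equation can be solved order
    by order by dividing by \<open>\<kappa>\<^sup>2 - \<omega>\<^sup>2\<close>, except at \<open>\<omega> = \<plusminus>\<kappa>\<close>. Since the potential is even in \<open>x\<close>, all
    coefficients \<open>r\<^sub>m(\<omega>)\<close> are real and independent of \<open>\<theta>\<close>. The obstruction at \<open>\<omega> = \<kappa>\<close> is cancelled at every
    order by the choice of \<open>c\<^sub>l\<close>. The frequency \<open>-\<kappa>\<close> is reached from \<open>\<kappa>\<close> only by adding phases of total
    \<open>2\<kappa>\<close>, so \<open>E \<notin> S\<^bsub>p-1\<^esub>\<close> excludes it below order \<open>N\<close>. At order \<open>N\<close> one term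
    \<open>\<rho> x\<^sup>-\<^sup>N\<^sup>\<gamma> sin (\<theta> - \<kappa> x)\<close> survives (lemma \<open>order_balance\<close>).

  \<^item> Decay. For \<open>\<theta> = \<plusminus>\<pi>/4\<close> the surviving term is a multiple of \<open>s\<^sub>0'\<close>. It is therefore cancelled by an
    amplitude \<open>exp (g h(x))\<close> with \<open>h'(x) = x\<^sup>-\<^sup>N\<^sup>\<gamma>\<close>, where \<open>g = \<plusminus>\<rho>/(2\<kappa>)\<close>; one of the two signs of
    \<open>\<theta>\<close> gives decay, the other one growth. What remains is \<open>O(x\<^sup>-\<^sup>p\<^sup>\<gamma>)\<close> relative to the amplitude, hence
    integrable (lemma \<open>residual_bigo\<close>). Variation of constants with the two approximate solutions then gives a
    true solution with the asymptotics of the decaying one (lemmas \<open>perturbed_decaying_solution\<close> and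
    \<open>decaying_resonant_solution\<close>).

  \<^item> The strength \<open>\<rho>\<close>. Unfolding the recursion writes \<open>\<rho>\<close> as a sum over all words of \<open>N\<close> signed phases with
    total \<open>2\<kappa>\<close>. A word contributes the product of its weights \<open>\<lambda>\<^sub>k/2\<close> divided by the product of
    \<open>S (2\<kappa> - S)\<close> over its proper partial sums \<open>S\<close> (lemma \<open>reflection_eq\<close>). For generic phases all these words
    are rearrangements of one another, so the weights factor out as \<open>\<lambda>\<^bsub>j\<^sub>1\<^esub> \<dots> \<lambda>\<^bsub>j\<^sub>N\<^esub> / 2\<^sup>N\<close>. The
    remaining sum is a rational function of the phases alone. It does not vanish identically, because it is
    positive at phases for which all the letters of the words have the value \<open>1\<close> (lemmas \<open>coupling_numerator_nonzero\<close>
    and \<open>generic_phases\<close>).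

  \<^item> The half-line. Near \<open>0\<close> the potential is only integrable; the solution is continued to \<open>0\<close> by a fixed
    point argument for the integrated equation (lemma \<open>backward_cauchy_problem\<close>). If the amplitude is square
    integrable, the value and the slope at \<open>0\<close> determine the boundary condition
    (lemma \<open>square_integrable_solution_gives_eigenvalue\<close>).
\<close>

section \<open>Polynomial functions of several variables\<close>

abbreviation lookup where "lookup \<equiv> Poly_Mapping.lookup"
abbreviation keys where "keys \<equiv> Poly_Mapping.keys"

definition monom_eval :: "(nat \<Rightarrow>\<^sub>0 nat) \<Rightarrow> (nat \<Rightarrow> real) \<Rightarrow> real" where
  "monom_eval m a = (\<Prod>i\<in>keys m. a i ^ lookup m i)"

lemma monom_eval_superset:
  assumes "finite S" "keys m \<subseteq> S"
  shows "monom_eval m a = (\<Prod>i\<in>S. a i ^ lookup m i)"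
  unfolding monom_eval_def
  by (rule prod.mono_neutral_left) (use assms in \<open>auto simp: in_keys_iff\<close>)

lemma monom_eval_add: "monom_eval (m + n) a = monom_eval m a * monom_eval n a"
proof -
  let ?S = "keys m \<union> keys n"
  have "monom_eval (m + n) a = (\<Prod>i\<in>?S. a i ^ lookup (m + n) i)"
    by (rule monom_eval_superset) (use keys_add[of m n] in auto)
  also have "\<dots> = monom_eval m a * monom_eval n a"
    by (simp add: monom_eval_superset[of ?S] lookup_add power_add prod.distrib)
  finally show ?thesis .
qed

lemma mpoly_eval_superset:
  assumes "finite S" "keys P \<subseteq> S"
  shows "mpoly_eval P a = (\<Sum>m\<in>S. lookup P m * monom_eval m a)"
  unfolding mpoly_eval_def monom_eval_def[symmetric]
  by (rule sum.mono_neutral_left) (use assms in \<open>auto simp: in_keys_iff\<close>)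

lemma mpoly_eval_0 [simp]: "mpoly_eval 0 a = 0"
  by (simp add: mpoly_eval_def)

lemma mpoly_eval_add: "mpoly_eval (P + Q) a = mpoly_eval P a + mpoly_eval Q a"
proof -
  let ?S = "keys P \<union> keys Q"
  have "mpoly_eval (P + Q) a = (\<Sum>m\<in>?S. lookup (P + Q) m * monom_eval m a)"
    by (rule mpoly_eval_superset) (use keys_add[of P Q] in auto)
  also have "\<dots> = mpoly_eval P a + mpoly_eval Q a"
    by (simp add: mpoly_eval_superset[of ?S] lookup_add ring_distribs sum.distrib)
  finally show ?thesis .
qed

lemma mpoly_eval_sum: "mpoly_eval (\<Sum>i\<in>I. P i) a = (\<Sum>i\<in>I. mpoly_eval (P i) a)"
  by (induction I rule: infinite_finite_induct) (auto simp: mpoly_eval_add)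

lemma mpoly_eval_single: "mpoly_eval (Poly_Mapping.single m c) a = c * monom_eval m a"
  by (subst mpoly_eval_superset[of "{m}"]) auto

lemma mpoly_sum_of_monomials:
  fixes P :: real_mpoly
  shows "P = (\<Sum>m\<in>keys P. Poly_Mapping.single m (lookup P m))"
proof (rule poly_mapping_eqI)
  fix k
  have "lookup (\<Sum>m\<in>keys P. Poly_Mapping.single m (lookup P m)) k
      = (\<Sum>m\<in>keys P. if k = m then lookup P m else 0)"
    unfolding lookup_sum by (rule sum.cong) (auto simp: lookup_single when_def)
  also have "\<dots> = lookup P k"
    by (auto simp: in_keys_iff)
  finally show "lookup P k = lookup
      (\<Sum>m\<in>keys P. Poly_Mapping.single m (lookup P m)) k" by simp
qed

lemma mpoly_eval_mult: "mpoly_eval (P * Q) a = mpoly_eval P a * mpoly_eval Q a"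
proof -
  have "P * Q = (\<Sum>m\<in>keys P. \<Sum>n\<in>keys Q.
      Poly_Mapping.single (m + n) (lookup P m * lookup Q n))"
    by (subst mpoly_sum_of_monomials[of P], subst mpoly_sum_of_monomials[of Q])
      (simp add: sum_product mult_single)
  then have "mpoly_eval (P * Q) a = (\<Sum>m\<in>keys P. \<Sum>n\<in>keys Q.
      (lookup P m * monom_eval m a) * (lookup Q n * monom_eval n a))"
    by (simp add: mpoly_eval_sum mpoly_eval_single monom_eval_add mult_ac)
  then show ?thesis
    by (simp add: mpoly_eval_def monom_eval_def[symmetric] sum_product)
qed

definition poly_fun :: "nat \<Rightarrow> ((nat \<Rightarrow> real) \<Rightarrow> real) \<Rightarrow> bool" where
  "poly_fun K g \<longleftrightarrow> (\<exists>P. mpoly_vars P \<subseteq> {1..K} \<and> mpoly_eval P = g)"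

lemma poly_fun_const: "poly_fun K (\<lambda>_. c)"
  unfolding poly_fun_def
  by (rule exI[of _ "Poly_Mapping.single 0 c"]) (auto simp: mpoly_vars_def fun_eq_iff mpoly_eval_single monom_eval_def)

lemma poly_fun_var:
  assumes "k \<in> {1..K}"
  shows "poly_fun K (\<lambda>a. a k)"
  unfolding poly_fun_def
  by (rule exI[of _ "Poly_Mapping.single (Poly_Mapping.single k 1) 1"])
    (use assms in \<open>auto simp: mpoly_vars_def fun_eq_iff mpoly_eval_single monom_eval_def\<close>)

lemma mpoly_vars_add: "mpoly_vars (P + Q) \<subseteq> mpoly_vars P \<union> mpoly_vars Q"
  unfolding mpoly_vars_def using keys_add[of P Q] by blast

lemma mpoly_vars_mult: "mpoly_vars (P * Q) \<subseteq> mpoly_vars P \<union> mpoly_vars Q"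
proof
  fix x assume "x \<in> mpoly_vars (P * Q)"
  then obtain m where m: "m \<in> keys (P * Q)" "x \<in> keys m"
    by (auto simp: mpoly_vars_def)
  with keys_mult[of P Q] obtain a b where ab: "a \<in> keys P" "b \<in> keys Q"
    "m = a + b" by blast
  with m(2) keys_add[of a b] have "x \<in> keys a \<union> keys b" by blast
  with ab show "x \<in> mpoly_vars P \<union> mpoly_vars Q" by (auto simp: mpoly_vars_def)
qed

lemma poly_fun_add:
  assumes "poly_fun K f" "poly_fun K g"
  shows "poly_fun K (\<lambda>a. f a + g a)"
proof -
  from assms obtain P Q where "mpoly_vars P \<subseteq> {1..K}" "mpoly_eval P = f"
    "mpoly_vars Q \<subseteq> {1..K}" "mpoly_eval Q = g" by (auto simp: poly_fun_def)
  then show ?thesis unfolding poly_fun_def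
    by (intro exI[of _ "P + Q"]) (use mpoly_vars_add[of P Q] in \<open>auto simp: mpoly_eval_add fun_eq_iff\<close>)
qed

lemma poly_fun_mult:
  assumes "poly_fun K f" "poly_fun K g"
  shows "poly_fun K (\<lambda>a. f a * g a)"
proof -
  from assms obtain P Q where "mpoly_vars P \<subseteq> {1..K}" "mpoly_eval P = f"
    "mpoly_vars Q \<subseteq> {1..K}" "mpoly_eval Q = g" by (auto simp: poly_fun_def)
  then show ?thesis unfolding poly_fun_def
    by (intro exI[of _ "P * Q"]) (use mpoly_vars_mult[of P Q] in \<open>auto simp: mpoly_eval_mult fun_eq_iff\<close>)
qed

lemma poly_fun_diff:
  assumes "poly_fun K f" "poly_fun K g"
  shows "poly_fun K (\<lambda>a. f a - g a)"
  using poly_fun_add[OF assms(1) poly_fun_mult[OF poly_fun_const[of K "-1"] assms(2)]]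
  by simp

lemma poly_fun_sum:
  assumes "\<And>i. i \<in> I \<Longrightarrow> poly_fun K (f i)"
  shows "poly_fun K (\<lambda>a. \<Sum>i\<in>I. f i a)"
  using assms by (induction I rule: infinite_finite_induct)
    (auto intro: poly_fun_add poly_fun_const)

lemma poly_fun_prod:
  assumes "\<And>i. i \<in> I \<Longrightarrow> poly_fun K (f i)"
  shows "poly_fun K (\<lambda>a. \<Prod>i\<in>I. f i a)"
  using assms by (induction I rule: infinite_finite_induct)
    (auto intro: poly_fun_mult poly_fun_const)

text \<open>
  Real polynomials form an integral domain, so the product of finitely many nonzero ones is a nonzero polynomial
  whose zero set contains all their zero sets.
\<close>

lemma common_nonvanishing_polynomial:
  assumes "finite I" and "\<And>i. i \<in> I \<Longrightarrow> poly_fun K (g i)"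
    and "\<And>i. i \<in> I \<Longrightarrow> \<exists>a. g i a \<noteq> 0"
  shows "\<exists>P. P \<noteq> 0 \<and> mpoly_vars P \<subseteq> {1..K} \<and> (\<forall>a. mpoly_eval P a \<noteq> 0 \<longrightarrow> (\<forall>i\<in>I. g i a \<noteq> 0))"
  using assms
proof (induction I rule: finite_induct)
  case empty
  show ?case by (rule exI[of _ 1]) (auto simp: mpoly_vars_def)
next
  case (insert i I)
  then obtain P where P: "P \<noteq> 0" "mpoly_vars P \<subseteq> {1..K}"
    "\<And>a. mpoly_eval P a \<noteq> 0 \<Longrightarrow> \<forall>i\<in>I. g i a \<noteq> 0" by auto
  from insert.prems(1)[of i] obtain Q where Q: "mpoly_vars Q \<subseteq> {1..K}" "mpoly_eval Q = g i"
    by (auto simp: poly_fun_def)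
  have "Q \<noteq> 0"
    using insert.prems(2)[of i] Q(2) mpoly_eval_0 by fastforce
  with P(1) have "P * Q \<noteq> 0" by simp
  moreover have "mpoly_vars (P * Q) \<subseteq> {1..K}" using P(2) Q(1) mpoly_vars_mult[of P Q] by blast
  ultimately show ?case using P(3) Q(2) by (intro exI[of _ "P * Q"]) (auto simp: mpoly_eval_mult)
qed

section \<open>Words in the signed phases\<close>

text \<open>
  The letter \<open>z\<close> stands for the signed phase \<open>sgn z \<alpha>\<^bsub>|z|\<^esub>\<close>; with integers as letters, reversing a phase is
  just \<open>uminus\<close>.
\<close>

definition letters :: "nat \<Rightarrow> int set" where
  "letters K = {z. 1 \<le> \<bar>z\<bar> \<and> \<bar>z\<bar> \<le> int K}"

definition phase :: "(nat \<Rightarrow> real) \<Rightarrow> int \<Rightarrow> real" where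
  "phase \<alpha> z = real_of_int (sgn z) * \<alpha> (nat \<bar>z\<bar>)"

definition total_phase :: "(nat \<Rightarrow> real) \<Rightarrow> int list \<Rightarrow> real" where
  "total_phase \<alpha> w = sum_list (map (phase \<alpha>) w)"

definition words :: "nat \<Rightarrow> nat \<Rightarrow> int list set" where
  "words K n = {w. set w \<subseteq> letters K \<and> length w = n}"

text \<open>
  Cancellation-free words are determined up to order by their total phase as a linear form in the \<open>\<alpha>\<^sub>k\<close>.
\<close>

definition cancellation_free :: "int list \<Rightarrow> bool" where
  "cancellation_free w \<longleftrightarrow> (\<forall>z\<in>set w. - z \<notin> set w)"

text \<open>
  The product of the small divisors met on the way from the frequency \<open>-\<kappa> + s\<close> to \<open>\<kappa>\<close>, where \<open>t = 2\<kappa>\<close>: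
  at the frequency \<open>\<omega> = -\<kappa> + s\<close> the divisor is \<open>\<kappa>\<^sup>2 - \<omega>\<^sup>2 = s (2\<kappa> - s)\<close>. The end point \<open>\<kappa>\<close> itself contributes
  no divisor.
\<close>

fun path_denom :: "(nat \<Rightarrow> real) \<Rightarrow> real \<Rightarrow> real \<Rightarrow> int list \<Rightarrow> real" where
  "path_denom \<alpha> t s [] = 1"
| "path_denom \<alpha> t s (z # w) = s * (t - s) * path_denom \<alpha> t (s + phase \<alpha> z) w"

definition word_denom :: "(nat \<Rightarrow> real) \<Rightarrow> int list \<Rightarrow> real" where
  "word_denom \<alpha> w = path_denom \<alpha> (total_phase \<alpha> w) (phase \<alpha> (hd w)) (tl w)"

text \<open>
  The sum of the reciprocals of \<open>word_denom\<close> over the rearrangements of one word, multiplied by their common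
  denominator. This is a polynomial in the phases.
\<close>

definition coupling_numerator :: "int list \<Rightarrow> (nat \<Rightarrow> real) \<Rightarrow> real" where
  "coupling_numerator w\<^sub>0 \<alpha> =
     (\<Sum>w | mset w = mset w\<^sub>0. \<Prod>w' \<in> {w'. mset w' = mset w\<^sub>0} - {w}. word_denom \<alpha> w')"

lemma finite_letters [simp]: "finite (letters K)"
  by (rule finite_subset[of _ "{- int K..int K}"]) (auto simp: letters_def)

lemma finite_words [simp]: "finite (words K n)"
  unfolding words_def using finite_lists_length_eq[OF finite_letters] .

lemma words_0 [simp]: "words K 0 = {[]}"
  by (auto simp: words_def)

lemma sum_words_Suc:
  "(\<Sum>w\<in>words K (Suc n). f w) = (\<Sum>z\<in>letters K. \<Sum>w\<in>words K n. f (z # w))"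
proof -
  have eq: "words K (Suc n) = (\<lambda>(z, w). z # w) ` (letters K \<times> words K n)"
    by (auto simp: words_def length_Suc_conv image_iff)
  have "inj_on (\<lambda>(z, w). z # w) (letters K \<times> words K n)"
    by (auto simp: inj_on_def)
  then have "(\<Sum>w\<in>words K (Suc n). f w) = (\<Sum>(z, w)\<in>letters K \<times> words K n. f (z # w))"
    unfolding eq by (subst sum.reindex) (auto intro!: sum.cong)
  then show ?thesis by (simp add: sum.cartesian_product)
qed

lemma finite_rearrangements [simp]: "finite {w. mset w = mset (w\<^sub>0 :: int list)}"
  by (rule finite_subset[OF _ finite_lists_length_eq[of "set w\<^sub>0" "length w\<^sub>0"]])
    (auto dest: mset_eq_setD mset_eq_length)

lemma total_phase_simps [simp]:
  "total_phase \<alpha> [] = 0" "total_phase \<alpha> (z # w) = phase \<alpha> z + total_phase \<alpha> w"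
  by (auto simp: total_phase_def)

lemma total_phase_mset: "mset w = mset w' \<Longrightarrow> total_phase \<alpha> w = total_phase \<alpha> w'"
proof -
  assume "mset w = mset w'"
  then have "mset (map (phase \<alpha>) w) = mset (map (phase \<alpha>) w')" by simp
  then show ?thesis unfolding total_phase_def by (metis sum_mset_sum_list)
qed

lemma total_phase_in_sumset:
  assumes "set w \<subseteq> letters K"
  shows "total_phase \<alpha> w \<in> sumset (length w) (phase_set K \<alpha>)"
proof -
  have "phase \<alpha> (w ! i) \<in> phase_set K \<alpha>" if "i < length w" for i
  proof -
    have "w ! i \<in> letters K" using assms that by (auto simp: subset_eq)
    then have "nat \<bar>w ! i\<bar> \<in> {1..K}" by (auto simp: letters_def)
    moreover have "phase \<alpha> (w ! i) \<in> {\<alpha> (nat \<bar>w ! i\<bar>), - \<alpha> (nat \<bar>w ! i\<bar>), 0}"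
      by (auto simp: phase_def sgn_if)
    ultimately show ?thesis unfolding phase_set_def by blast
  qed
  moreover have "total_phase \<alpha> w = (\<Sum>i<length w. phase \<alpha> (w ! i))"
    by (simp add: total_phase_def sum_list_sum_nth atLeast0LessThan)
  ultimately show ?thesis unfolding sumset_def by auto
qed

lemma poly_fun_phase:
  "z \<in> letters K \<Longrightarrow> poly_fun K (\<lambda>\<alpha>. phase \<alpha> z)"
  unfolding phase_def
  by (intro poly_fun_mult poly_fun_const poly_fun_var)
    (auto simp: letters_def)

lemma poly_fun_total_phase:
  "set w \<subseteq> letters K \<Longrightarrow> poly_fun K (\<lambda>\<alpha>. total_phase \<alpha> w)"
  by (induction w)
    (auto intro: poly_fun_const poly_fun_add poly_fun_phase)

lemma poly_fun_path_denom:
  assumes "set w \<subseteq> letters K" "poly_fun K t" "poly_fun K s"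
  shows "poly_fun K (\<lambda>\<alpha>. path_denom \<alpha> (t \<alpha>) (s \<alpha>) w)"
  using assms
proof (induction w arbitrary: s)
  case (Cons z w)
  have "poly_fun K (\<lambda>\<alpha>. path_denom \<alpha> (t \<alpha>) (s \<alpha> + phase \<alpha> z) w)"
    by (rule Cons.IH) (use Cons.prems in \<open>auto intro!: poly_fun_add poly_fun_phase\<close>)
  with Cons.prems show ?case
    by (auto intro!: poly_fun_mult poly_fun_diff)
qed (auto intro: poly_fun_const)

lemma poly_fun_coupling_numerator:
  assumes "set w\<^sub>0 \<subseteq> letters K" "w\<^sub>0 \<noteq> []"
  shows "poly_fun K (coupling_numerator w\<^sub>0)"
proof -
  have "poly_fun K (\<lambda>\<alpha>. word_denom \<alpha> w)" if "mset w = mset w\<^sub>0" for w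
  proof -
    have "set w \<subseteq> letters K" using assms that mset_eq_setD by blast
    moreover have "w \<noteq> []" using assms that by auto
    ultimately show ?thesis unfolding word_denom_def
      by (intro poly_fun_path_denom poly_fun_total_phase
          poly_fun_phase) (auto dest: list.set_sel(2))
  qed
  then show ?thesis unfolding coupling_numerator_def
    by (intro poly_fun_sum poly_fun_prod) auto
qed

lemma path_denom_pos:
  assumes "\<And>z. z \<in> set w \<Longrightarrow> phase \<alpha> z = 1" "s > 0" "t = s + real (length w)"
  shows "path_denom \<alpha> t s w > 0"
  using assms
proof (induction w arbitrary: s)
  case (Cons z w)
  have "path_denom \<alpha> t (s + 1) w > 0" by (rule Cons.IH) (use Cons.prems in auto)
  with Cons.prems show ?case by simp
qed simp

text \<open>
  In a cancellation-free word every letter can be given the phase \<open>1\<close>. The partial sums \<open>S\<close> of all its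
  rearrangements are then \<open>1, \<dots>, N - 1\<close> and the total is \<open>N\<close>, so every factor \<open>S (N - S)\<close> is positive and
  nothing can cancel in the sum.
\<close>

lemma coupling_numerator_nonzero:
  assumes "cancellation_free w\<^sub>0" "w\<^sub>0 \<noteq> []" "set w\<^sub>0 \<subseteq> letters K"
  shows "\<exists>\<alpha>. coupling_numerator w\<^sub>0 \<alpha> \<noteq> 0"
proof -
  \<comment> \<open>The phases that make every letter of \<open>w\<^sub>0\<close> equal to \<open>1\<close>.\<close>
  define \<alpha> :: "nat \<Rightarrow> real" where "\<alpha> j = (if int j \<in> set w\<^sub>0 then 1 else -1)" for j
  have ph: "phase \<alpha> z = 1" if "z \<in> set w\<^sub>0" for z
  proof (cases "z > 0")
    case True
    then show ?thesis using that by (auto simp: phase_def \<alpha>_def)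
  next
    case False
    then have "z < 0" using that assms(3) by (auto simp: letters_def subset_eq)
    moreover have "- z \<notin> set w\<^sub>0" using assms(1) that by (auto simp: cancellation_free_def)
    ultimately show ?thesis by (auto simp: phase_def \<alpha>_def)
  qed
  have tot: "total_phase \<alpha> w = real (length w)" if "set w \<subseteq> set w\<^sub>0" for w
    using that by (induction w) (auto simp: ph)
  have pos: "word_denom \<alpha> w > 0" if "mset w = mset w\<^sub>0" for w
  proof -
    have w: "set w = set w\<^sub>0" "w \<noteq> []" using that assms mset_eq_setD by auto
    then obtain z v where zv: "w = z # v" by (cases w) auto
    have "phase \<alpha> z = 1" by (rule ph) (use w zv in auto)
    then have "path_denom \<alpha> (total_phase \<alpha> w) (phase \<alpha> z) v > 0"
      by (intro path_denom_pos) (use w zv tot[of w] ph in auto)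
    then show ?thesis by (simp add: word_denom_def zv)
  qed
  have "coupling_numerator w\<^sub>0 \<alpha> > 0"
    unfolding coupling_numerator_def
    by (rule sum_pos) (auto intro!: prod_pos pos)
  then show ?thesis by (intro exI[of _ \<alpha>]) auto
qed

lemma total_phase_indicator:
  assumes "j \<ge> 1"
  shows "total_phase (\<lambda>i. if i = j then 1 else 0) w
    = real (count (mset w) (int j)) - real (count (mset w) (- int j))"
proof (induction w)
  case (Cons z w)
  have "nat \<bar>z\<bar> = j \<longleftrightarrow> z = int j \<or> z = - int j" by auto
  with Cons assms show ?case by (auto simp: phase_def sgn_if)
qed simp

text \<open>
  At the \<open>j\<close>-th unit vector the total is the number of letters \<open>j\<close> minus the number of letters \<open>-j\<close>. One of the
  two is \<open>0\<close> in a cancellation-free word, so equal linear forms have equal multiplicities.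
\<close>

lemma cancellation_free_words_separated:
  assumes "cancellation_free w" "cancellation_free w'" "set w \<subseteq> letters K" "set w' \<subseteq> letters K" "mset w \<noteq> mset w'"
  shows "\<exists>\<alpha>. total_phase \<alpha> w - total_phase \<alpha> w' \<noteq> 0"
proof (rule ccontr)
  assume "\<not> ?thesis"
  then have eq: "total_phase \<alpha> w = total_phase \<alpha> w'" for \<alpha> by auto
  have *: "count (mset v) z = 0 \<or> count (mset v) (- z) = 0" if "cancellation_free v" for v z
    using that by (auto simp: cancellation_free_def count_eq_zero_iff)
  have cnt: "count (mset w) (int j) = count (mset w') (int j) \<and>
      count (mset w) (- int j) = count (mset w') (- int j)" if "j \<ge> 1" for j
    using eq[of "\<lambda>i. if i = j then 1 else 0", unfolded total_phase_indicator[OF that]]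
      *[OF assms(1), of "int j"] *[OF assms(2), of "int j"] by linarith
  have "count (mset w) z = count (mset w') z" for z
  proof (cases "z = 0")
    case True
    then have "z \<notin> set w" "z \<notin> set w'" using assms by (auto simp: letters_def subset_eq)
    then show ?thesis by (metis count_eq_zero_iff set_mset_mset)
  next
    case False
    then have "z = int (nat \<bar>z\<bar>) \<or> z = - int (nat \<bar>z\<bar>)" "nat \<bar>z\<bar> \<ge> 1" by auto
    then show ?thesis using cnt[of "nat \<bar>z\<bar>"] by metis
  qed
  then have "mset w = mset w'" by (simp add: multiset_eq_iff)
  with assms show False by simp
qed

lemma generic_phases:
  assumes "N \<ge> 1"
  shows "\<exists>P. P \<noteq> 0 \<and> mpoly_vars P \<subseteq> {1..K} \<and> (\<forall>\<alpha>. mpoly_eval P \<alpha> \<noteq> 0 \<longrightarrow>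
    (\<forall>w\<in>words K N. cancellation_free w \<longrightarrow> coupling_numerator w \<alpha> \<noteq> 0 \<and>
      (\<forall>w'\<in>words K N. cancellation_free w' \<and> mset w \<noteq> mset w' \<longrightarrow> total_phase \<alpha> w \<noteq> total_phase \<alpha> w')))"
proof -
  let ?R = "{w \<in> words K N. cancellation_free w}"
  let ?S = "{(w, w') \<in> ?R \<times> ?R. mset w \<noteq> mset w'}"
  have fin: "finite ?R" "finite ?S"
    by (auto intro: finite_subset[of _ "words K N \<times> words K N"])
  define g :: "int list + int list \<times> int list \<Rightarrow> (nat \<Rightarrow> real) \<Rightarrow> real" where
    "g i = (case i of Inl w \<Rightarrow> coupling_numerator w
      | Inr (w, w') \<Rightarrow> (\<lambda>\<alpha>. total_phase \<alpha> w - total_phase \<alpha> w'))" for i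
  have "\<exists>P. P \<noteq> 0 \<and> mpoly_vars P \<subseteq> {1..K} \<and>
      (\<forall>a. mpoly_eval P a \<noteq> 0 \<longrightarrow> (\<forall>i\<in>?R <+> ?S. g i a \<noteq> 0))"
  proof (rule common_nonvanishing_polynomial)
    fix i assume i: "i \<in> ?R <+> ?S"
    show "poly_fun K (g i)"
      using i assms unfolding g_def words_def
      by (auto intro!: poly_fun_coupling_numerator poly_fun_diff
          poly_fun_total_phase)
    show "\<exists>a. g i a \<noteq> 0"
      using i assms unfolding g_def words_def
      by (elim PlusE) (auto dest: coupling_numerator_nonzero cancellation_free_words_separated)
  qed (use fin in auto)
  then obtain P where P: "P \<noteq> 0" "mpoly_vars P \<subseteq> {1..K}"
    "\<And>a. mpoly_eval P a \<noteq> 0 \<Longrightarrow> \<forall>i\<in>?R <+> ?S. g i a \<noteq> 0" by blast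
  have "coupling_numerator w \<alpha> \<noteq> 0" if "mpoly_eval P \<alpha> \<noteq> 0" "w \<in> words K N" "cancellation_free w" for \<alpha> w
    using P(3)[OF that(1)] that by (auto simp: g_def dest!: bspec[where x = "Inl w"])
  moreover have "total_phase \<alpha> w \<noteq> total_phase \<alpha> w'"
    if "mpoly_eval P \<alpha> \<noteq> 0" "w \<in> words K N" "cancellation_free w" "w' \<in> words K N" "cancellation_free w'"
      "mset w \<noteq> mset w'" for \<alpha> w w'
    using P(3)[OF that(1)] that by (auto simp: g_def dest!: bspec[where x = "Inr (w, w')"])
  ultimately show ?thesis using P(1,2) by blast
qed

text \<open>
  Deleting a pair of opposite letters does not change the total, so it would represent the same total by a
  shorter word.
\<close>

lemma cancellation_free_if_total_phase_not_in_sumset: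
  assumes "set w \<subseteq> letters K" "\<And>m. m < length w \<Longrightarrow> total_phase \<alpha> w \<notin> sumset m (phase_set K \<alpha>)"
  shows "cancellation_free w"
  unfolding cancellation_free_def
proof (intro ballI notI)
  fix z assume z: "z \<in> set w" "- z \<in> set w"
  from z(1) assms(1) have "z \<noteq> 0" by (auto simp: letters_def)
  define v where "v = remove1 (- z) (remove1 z w)"
  have remove: "mset ys = add_mset x (mset (remove1 x ys))" if "x \<in> set ys" for x :: int and ys
    using that by simp
  have "- z \<in> set (remove1 z w)" using z \<open>z \<noteq> 0\<close> by (simp add: in_set_remove1)
  then have m: "mset w = mset (z # (- z) # v)"
    using remove[OF z(1)] remove[of "- z" "remove1 z w"] unfolding v_def by (simp only: mset.simps)
  have "set v \<subseteq> letters K" using mset_eq_setD[OF m] assms(1) by auto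
  then have "total_phase \<alpha> v \<in> sumset (length v) (phase_set K \<alpha>)" by (rule total_phase_in_sumset)
  moreover have "total_phase \<alpha> w = total_phase \<alpha> v"
    using total_phase_mset[OF m] by (simp add: phase_def sgn_minus)
  moreover have "length v < length w" using mset_eq_length[OF m] by simp
  ultimately show False using assms(2) by auto
qed

definition coupling_sum :: "nat \<Rightarrow> (nat \<Rightarrow> real) \<Rightarrow> nat \<Rightarrow> real \<Rightarrow> real" where
  "coupling_sum K \<alpha> N t = (\<Sum>w | w \<in> words K N \<and> total_phase \<alpha> w = t. 1 / word_denom \<alpha> w)"

text \<open>
  A factor \<open>S (t - S)\<close> vanishes only if the letters read so far, or the letters still to be read, have total
  \<open>t\<close> by themselves; both are shorter than the whole word.
\<close>

lemma path_denom_nonzero: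
  assumes "set w \<subseteq> letters K" "s \<in> sumset n (phase_set K \<alpha>)" "s + total_phase \<alpha> w = t" "n > 0"
    and "\<And>m. m < n + length w \<Longrightarrow> t \<notin> sumset m (phase_set K \<alpha>)"
  shows "path_denom \<alpha> t s w \<noteq> 0"
  using assms
proof (induction w arbitrary: s n)
  case (Cons z w)
  have "t \<noteq> s" using Cons.prems by auto
  moreover have "s \<noteq> 0"
  proof
    assume "s = 0"
    then have "t \<in> sumset (length (z # w)) (phase_set K \<alpha>)"
      using Cons.prems total_phase_in_sumset[of "z # w" K \<alpha>] by auto
    with Cons.prems(4,5) show False by auto
  qed
  moreover have "path_denom \<alpha> t (s + phase \<alpha> z) w \<noteq> 0"
  proof (rule Cons.IH)
    have "phase \<alpha> z \<in> phase_set K \<alpha>"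
      using total_phase_in_sumset[of "[z]" K \<alpha>] Cons.prems(1) by (auto simp: sumset_def)
    with Cons.prems(2) obtain a where a: "s = (\<Sum>i<n. a i)" "\<forall>i<n. a i \<in> phase_set K \<alpha>"
      by (auto simp: sumset_def)
    show "s + phase \<alpha> z \<in> sumset (Suc n) (phase_set K \<alpha>)"
      unfolding sumset_def using a \<open>phase \<alpha> z \<in> phase_set K \<alpha>\<close>
      by (auto intro!: exI[of _ "a(n := phase \<alpha> z)"] simp: less_Suc_eq)
  qed (use Cons.prems in auto)
  ultimately show ?case by simp
qed simp

lemma resonant_words_are_rearrangements:
  assumes gen: "\<And>w w'. w \<in> words K N \<Longrightarrow> w' \<in> words K N \<Longrightarrow> cancellation_free w \<Longrightarrow> cancellation_free w' \<Longrightarrow>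
      mset w \<noteq> mset w' \<Longrightarrow> total_phase \<alpha> w \<noteq> total_phase \<alpha> w'"
    and nonres: "\<And>m. m < N \<Longrightarrow> t \<notin> sumset m (phase_set K \<alpha>)"
    and w0: "w\<^sub>0 \<in> words K N" "total_phase \<alpha> w\<^sub>0 = t"
  shows "{w \<in> words K N. total_phase \<alpha> w = t} = {w. mset w = mset w\<^sub>0}"
proof -
  have red: "cancellation_free w" if "w \<in> words K N" "total_phase \<alpha> w = t" for w
    using that nonres by (intro cancellation_free_if_total_phase_not_in_sumset[of _ K \<alpha>]) (auto simp: words_def)
  have "w \<in> words K N \<and> total_phase \<alpha> w = t" if "mset w = mset w\<^sub>0" for w
    using w0 total_phase_mset[OF that, of \<alpha>] mset_eq_setD[OF that] mset_eq_length[OF that]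
    by (auto simp: words_def)
  moreover have "mset w = mset w\<^sub>0" if "w \<in> words K N" "total_phase \<alpha> w = t" for w
    using gen[of w w\<^sub>0] red that w0 by auto
  ultimately show ?thesis by blast
qed

text \<open>
  No denominator vanishes, and multiplication by their product turns the sum into \<open>coupling_numerator\<close>.
\<close>

lemma coupling_sum_nonzero:
  assumes gen: "\<And>w w'. w \<in> words K N \<Longrightarrow> w' \<in> words K N \<Longrightarrow> cancellation_free w \<Longrightarrow> cancellation_free w' \<Longrightarrow>
      mset w \<noteq> mset w' \<Longrightarrow> total_phase \<alpha> w \<noteq> total_phase \<alpha> w'"
    and num: "\<And>w. w \<in> words K N \<Longrightarrow> cancellation_free w \<Longrightarrow> coupling_numerator w \<alpha> \<noteq> 0"
    and nonres: "\<And>m. m < N \<Longrightarrow> t \<notin> sumset m (phase_set K \<alpha>)"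
    and w0: "w\<^sub>0 \<in> words K N" "total_phase \<alpha> w\<^sub>0 = t" and N: "N \<ge> 1"
  shows "coupling_sum K \<alpha> N t \<noteq> 0"
proof -
  note eq = resonant_words_are_rearrangements[OF gen nonres w0, simplified]
  let ?M = "{w. mset w = mset w\<^sub>0}"
  have nz: "word_denom \<alpha> w \<noteq> 0" if "w \<in> ?M" for w
  proof -
    from that eq have w: "w \<in> words K N" "total_phase \<alpha> w = t" by auto
    with N obtain z v where zv: "w = z # v" by (cases w) (auto simp: words_def)
    have "path_denom \<alpha> t (phase \<alpha> z) v \<noteq> 0"
    proof (rule path_denom_nonzero)
      show "phase \<alpha> z \<in> sumset 1 (phase_set K \<alpha>)"
        using total_phase_in_sumset[of "[z]" K \<alpha>] w zv by (auto simp: words_def)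
    qed (use w zv nonres in \<open>auto simp: words_def\<close>)
    then show ?thesis using w zv by (simp add: word_denom_def)
  qed
  have "coupling_sum K \<alpha> N t * (\<Prod>w\<in>?M. word_denom \<alpha> w) = coupling_numerator w\<^sub>0 \<alpha>"
    unfolding coupling_sum_def eq coupling_numerator_def sum_distrib_right
  proof (rule sum.cong)
    fix w assume w: "w \<in> ?M"
    show "1 / word_denom \<alpha> w * (\<Prod>w\<in>?M. word_denom \<alpha> w) = (\<Prod>w'\<in>?M - {w}. word_denom \<alpha> w')"
      using w nz[OF w] by (subst prod.remove[of ?M w]) auto
  qed simp
  moreover have "cancellation_free w\<^sub>0"
    using w0 nonres by (intro cancellation_free_if_total_phase_not_in_sumset[of _ K \<alpha>]) (auto simp: words_def)
  then have "coupling_numerator w\<^sub>0 \<alpha> \<noteq> 0" using num w0 by auto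
  ultimately show ?thesis by auto
qed

section \<open>Coefficients of the formal solution\<close>

lemma sum_letters: "(\<Sum>z\<in>letters K. f z) = (\<Sum>k=1..K. f (int k) + f (- int k))"
proof -
  have split: "letters K = int ` {1..K} \<union> (\<lambda>k. - int k) ` {1..K}"
  proof (intro set_eqI iffI)
    fix z assume z: "z \<in> letters K"
    have "nat \<bar>z\<bar> \<in> {1..K}" "z = int (nat \<bar>z\<bar>) \<or> z = - int (nat \<bar>z\<bar>)"
      using z by (auto simp: letters_def)
    then show "z \<in> int ` {1..K} \<union> (\<lambda>k. - int k) ` {1..K}" by blast
  qed (auto simp: letters_def)
  have "(\<Sum>z\<in>letters K. f z) = (\<Sum>z\<in>int ` {1..K}. f z) + (\<Sum>z\<in>(\<lambda>k. - int k) ` {1..K}. f z)"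
    unfolding split by (rule sum.union_disjoint) auto
  also have "\<dots> = (\<Sum>k=1..K. f (int k)) + (\<Sum>k=1..K. f (- int k))"
    by (subst (1 2) sum.reindex) (auto simp: inj_on_def)
  finally show ?thesis by (simp add: sum.distrib)
qed

lemma phase_uminus [simp]: "phase \<alpha> (- z) = - phase \<alpha> z"
  by (simp add: phase_def sgn_minus)

lemma total_phase_append [simp]: "total_phase \<alpha> (v @ w) = total_phase \<alpha> v + total_phase \<alpha> w"
  by (induction v) auto

lemma total_phase_map_uminus [simp]: "total_phase \<alpha> (map uminus w) = - total_phase \<alpha> w"
  by (induction w) auto

text \<open>
  Translation of a finitely supported coefficient function; the finite sets only have to contain the supports.
\<close>

lemma sum_shift_support:
  fixes r g :: "real \<Rightarrow> real"
  assumes "finite A" "finite B" "\<And>\<omega>. r \<omega> \<noteq> 0 \<Longrightarrow> \<omega> \<in> A \<and> \<omega> + h \<in> B"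
  shows "(\<Sum>\<omega>\<in>A. r \<omega> * g (\<omega> + h)) = (\<Sum>\<omega>\<in>B. r (\<omega> - h) * g \<omega>)"
proof -
  have "(\<Sum>\<omega>\<in>A. r \<omega> * g (\<omega> + h)) = (\<Sum>\<omega>\<in>{\<omega>. r \<omega> \<noteq> 0}. r \<omega> * g (\<omega> + h))"
    by (rule sum.mono_neutral_right) (use assms in auto)
  also have "\<dots> = (\<Sum>\<omega>\<in>{\<omega>. r (\<omega> - h) \<noteq> 0}. r (\<omega> - h) * g \<omega>)"
    by (rule sum.reindex_bij_witness[of _ "\<lambda>\<omega>. \<omega> - h" "\<lambda>\<omega>. \<omega> + h"]) auto
  also have "\<dots> = (\<Sum>\<omega>\<in>B. r (\<omega> - h) * g \<omega>)"
    by (rule sum.mono_neutral_left) (use assms(2,3) in \<open>auto dest: assms(3)\<close>)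
  finally show ?thesis .
qed

text \<open>
  The phases are resonant with \<open>2\<kappa>\<close> at order \<open>N\<close> at the earliest: no word of fewer than \<open>N\<close> letters has
  total \<open>2\<kappa>\<close>.
\<close>

locale resonant_phases =
  fixes K N :: nat and \<alpha> lam :: "nat \<Rightarrow> real" and \<kappa> :: real
  assumes N: "N \<ge> 1" and \<kappa>: "\<kappa> > 0"
    and nonres: "\<And>w. set w \<subseteq> letters K \<Longrightarrow> length w < N \<Longrightarrow> total_phase \<alpha> w \<noteq> 2 * \<kappa>"
begin

definition weight :: "int \<Rightarrow> real" where
  "weight z = lam (nat \<bar>z\<bar>) / 2"

text \<open>
  The coefficient \<open>r\<^sub>m(\<omega>)\<close> of \<open>sin (\<omega> x + \<theta>)\<close> at order \<open>x\<^sup>-\<^sup>m\<^sup>\<gamma>\<close>. The first sum is the action of the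
  oscillating potential, which moves a frequency by one signed phase. The second one is the action of the
  correction, with its constants \<open>c\<^bsub>l+1\<^esub>\<close> written out so that the recursion is self-contained. At the two
  frequencies \<open>\<plusminus>\<kappa>\<close>, where the divisor vanishes, the coefficient is set to \<open>0\<close>.
\<close>

fun coeff :: "nat \<Rightarrow> real \<Rightarrow> real" where
  "coeff 0 \<omega> = (if \<omega> = \<kappa> then 1 else 0)"
| "coeff (Suc m) \<omega> = (if \<omega> = \<kappa> \<or> \<omega> = - \<kappa> then 0 else
     ((\<Sum>z\<in>letters K. weight z * coeff m (\<omega> + phase \<alpha> z))
      - (\<Sum>l=0..m. (\<Sum>z\<in>letters K. weight z * coeff l (\<kappa> + phase \<alpha> z)) * coeff (m - l) \<omega>))
     / (\<kappa>\<^sup>2 - \<omega>\<^sup>2))"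

definition hop :: "nat \<Rightarrow> real \<Rightarrow> real" where
  "hop m \<omega> = (\<Sum>z\<in>letters K. weight z * coeff m (\<omega> + phase \<alpha> z))"

text \<open>
  The constants \<open>c\<^sub>l\<close> of the correction, chosen to cancel the obstruction at \<open>\<omega> = \<kappa>\<close>.
\<close>

definition shift_coeff :: "nat \<Rightarrow> real" where
  "shift_coeff l = - hop (l - 1) \<kappa>"

text \<open>
  The obstruction at \<open>\<omega> = -\<kappa>\<close> at order \<open>N\<close>, which nothing cancels: the strength \<open>\<rho>\<close> of the coupling of
  \<open>exp (i \<kappa> x)\<close> to \<open>exp (-i \<kappa> x)\<close>.
\<close>

definition reflection :: real where
  "reflection = hop (N - 1) (- \<kappa>)"

lemma coeff_Suc:
  "coeff (Suc m) \<omega> = (if \<omega> = \<kappa> \<or> \<omega> = - \<kappa> then 0 else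
     (hop m \<omega> + (\<Sum>l=1..Suc m. shift_coeff l * coeff (Suc m - l) \<omega>)) / (\<kappa>\<^sup>2 - \<omega>\<^sup>2))"
proof -
  have eq: "(\<Sum>l=1..Suc m. shift_coeff l * coeff (Suc m - l) \<omega>) = - (\<Sum>l=0..m. hop l \<kappa> * coeff (m - l) \<omega>)"
    unfolding One_nat_def sum.shift_bounds_cl_Suc_ivl
    by (simp add: shift_coeff_def flip: sum_negf)
  show ?thesis by (simp only: coeff.simps(2) hop_def[symmetric] eq diff_conv_add_uminus)
qed

declare coeff.simps(2) [simp del]

lemma coeff_support:
  "coeff m \<omega> \<noteq> 0 \<Longrightarrow> \<exists>w. set w \<subseteq> letters K \<and> length w \<le> m \<and> \<omega> = \<kappa> + total_phase \<alpha> w"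
proof (induction m arbitrary: \<omega> rule: less_induct)
  case (less m)
  show ?case
  proof (cases m)
    case 0
    then show ?thesis using less.prems by (intro exI[of _ "[]"]) (auto split: if_splits)
  next
    case (Suc n)
    have "hop n \<omega> \<noteq> 0 \<or> (\<Sum>l=1..m. shift_coeff l * coeff (m - l) \<omega>) \<noteq> 0"
      using less.prems unfolding Suc coeff_Suc by (auto simp del: sum.cl_ivl_Suc split: if_splits)
    then show ?thesis
    proof
      assume "hop n \<omega> \<noteq> 0"
      then obtain z where "z \<in> letters K" "weight z * coeff n (\<omega> + phase \<alpha> z) \<noteq> 0"
        unfolding hop_def by (rule sum.not_neutral_contains_not_neutral)
      then have z: "z \<in> letters K" "coeff n (\<omega> + phase \<alpha> z) \<noteq> 0" by simp_all
      have "n < m" using Suc by simp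
      from less.IH[OF this z(2)] obtain w where w: "set w \<subseteq> letters K" "length w \<le> n"
        "\<omega> + phase \<alpha> z = \<kappa> + total_phase \<alpha> w" by blast
      have "- z \<in> letters K" using z(1) by (auto simp: letters_def)
      then show ?thesis using w Suc by (intro exI[of _ "(- z) # w"]) auto
    next
      assume "(\<Sum>l=1..m. shift_coeff l * coeff (m - l) \<omega>) \<noteq> 0"
      then obtain l where "l \<in> {1..m}" "shift_coeff l * coeff (m - l) \<omega> \<noteq> 0"
        by (rule sum.not_neutral_contains_not_neutral)
      then have l: "m - l < m" "coeff (m - l) \<omega> \<noteq> 0" by auto
      from less.IH[OF l] obtain w where w: "set w \<subseteq> letters K" "length w \<le> m - l"
        "\<omega> = \<kappa> + total_phase \<alpha> w" by blast
      then show ?thesis by (intro exI[of _ w]) auto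
    qed
  qed
qed

text \<open>
  If a path \<open>w\<close> of at most \<open>m\<close> steps led from \<open>\<kappa>\<close> to \<open>-\<kappa> + total_phase \<alpha> v\<close>, then \<open>v\<close> followed by the
  opposites of the letters of \<open>w\<close> would be a word of fewer than \<open>N\<close> letters with total \<open>2\<kappa>\<close>.
\<close>

lemma coeff_near_reflection_eq_0:
  assumes "set v \<subseteq> letters K" "length v + m < N"
  shows "coeff m (- \<kappa> + total_phase \<alpha> v) = 0"
proof (rule ccontr)
  assume "coeff m (- \<kappa> + total_phase \<alpha> v) \<noteq> 0"
  then obtain w where w: "set w \<subseteq> letters K" "length w \<le> m"
    "- \<kappa> + total_phase \<alpha> v = \<kappa> + total_phase \<alpha> w" using coeff_support by blast
  have "total_phase \<alpha> (v @ map uminus w) \<noteq> 2 * \<kappa>"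
    by (rule nonres) (use w assms in \<open>auto simp: letters_def subset_eq\<close>)
  with w(3) show False by simp
qed

lemma hop_reflected_eq_0: "Suc m < N \<Longrightarrow> hop m (- \<kappa>) = 0"
  using coeff_near_reflection_eq_0[of "[z]" m for z] unfolding hop_def by (intro sum.neutral) auto

definition word_weight :: "int list \<Rightarrow> real" where
  "word_weight w = prod_list (map weight w)"

definition path_sum :: "nat \<Rightarrow> real \<Rightarrow> real" where
  "path_sum m s = (\<Sum>w\<in>words K m. if s + total_phase \<alpha> w = 2 * \<kappa>
     then word_weight w / path_denom \<alpha> (2 * \<kappa>) s w else 0)"

lemma path_sum_Suc:
  "path_sum (Suc m) s = (\<Sum>z\<in>letters K. weight z * path_sum m (s + phase \<alpha> z)) / (s * (2 * \<kappa> - s))"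
  unfolding path_sum_def sum_words_Suc sum_distrib_left sum_divide_distrib
  by (intro sum.cong refl) (auto simp: word_weight_def add.assoc)

text \<open>
  Close to \<open>-\<kappa>\<close> the correction never contributes: a factor \<open>c\<^sub>l\<close> uses up \<open>l\<close> orders without moving the
  frequency, and then too few steps remain. Hence only the oscillating part of the recursion survives, and it
  unfolds into a sum over words. If a divisor is \<open>0\<close>, both sides vanish because \<open>1 / 0 = 0\<close>.
\<close>

lemma coeff_path_sum:
  assumes "set v \<subseteq> letters K" "length v + m \<le> N"
  shows "coeff m (- \<kappa> + total_phase \<alpha> v) = path_sum m (total_phase \<alpha> v)"
  using assms
proof (induction m arbitrary: v)
  case 0
  then show ?case by (auto simp: path_sum_def word_weight_def)
next
  case (Suc m)
  define s where "s = total_phase \<alpha> v"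
  define d where "d = s * (2 * \<kappa> - s)"
  have IH: "coeff m (- \<kappa> + s + phase \<alpha> z) = path_sum m (s + phase \<alpha> z)" if "z \<in> letters K" for z
  proof -
    have tv: "total_phase \<alpha> (v @ [z]) = s + phase \<alpha> z" by (simp add: s_def)
    show ?thesis using Suc.IH[of "v @ [z]"] Suc.prems that unfolding tv by (simp add: algebra_simps)
  qed
  have "path_sum (Suc m) s = hop m (- \<kappa> + s) / d"
    unfolding path_sum_Suc hop_def d_def using IH by simp
  also have "\<dots> = coeff (Suc m) (- \<kappa> + s)"
  proof (cases "d = 0")
    case True
    then have "- \<kappa> + s = \<kappa> \<or> - \<kappa> + s = - \<kappa>" by (auto simp: d_def)
    then show ?thesis using True by (auto simp: coeff_Suc)
  next
    case False
    then have "- \<kappa> + s \<noteq> \<kappa>" "- \<kappa> + s \<noteq> - \<kappa>" by (auto simp: d_def)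
    moreover have "(\<Sum>l=1..Suc m. shift_coeff l * coeff (Suc m - l) (- \<kappa> + s)) = 0"
    proof (intro sum.neutral ballI)
      fix l assume "l \<in> {1..Suc m}"
      then have "coeff (Suc m - l) (- \<kappa> + s) = 0"
        unfolding s_def using Suc.prems by (intro coeff_near_reflection_eq_0) auto
      then show "shift_coeff l * coeff (Suc m - l) (- \<kappa> + s) = 0" by simp
    qed
    moreover have "\<kappa>\<^sup>2 - (- \<kappa> + s)\<^sup>2 = d" by (simp add: d_def power2_eq_square algebra_simps)
    ultimately show ?thesis by (simp add: coeff_Suc)
  qed
  finally show ?case unfolding s_def by (rule sym)
qed

lemma reflection_eq:
  assumes "\<And>w. w \<in> words K N \<Longrightarrow> total_phase \<alpha> w = 2 * \<kappa> \<Longrightarrow> word_weight w = L"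
  shows "reflection = L * coupling_sum K \<alpha> N (2 * \<kappa>)"
proof -
  obtain n where n: "N = Suc n" using N by (cases N) auto
  have path: "coeff n (- \<kappa> + phase \<alpha> z) = path_sum n (phase \<alpha> z)" if "z \<in> letters K" for z
    using coeff_path_sum[of "[z]" n] n that by simp
  have "N - 1 = n" using n by simp
  then have "reflection = (\<Sum>z\<in>letters K. weight z * path_sum n (phase \<alpha> z))"
    unfolding reflection_def hop_def by (simp only: path cong: sum.cong)
  also have "\<dots> = (\<Sum>w\<in>words K (Suc n). if total_phase \<alpha> w = 2 * \<kappa> then word_weight w / word_denom \<alpha> w else 0)"
    unfolding path_sum_def sum_words_Suc sum_distrib_left
    by (intro sum.cong refl) (auto simp: word_weight_def word_denom_def)
  also have "words K (Suc n) = words K N" by (simp only: n)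
  also have "(\<Sum>w\<in>words K N. if total_phase \<alpha> w = 2 * \<kappa> then word_weight w / word_denom \<alpha> w else 0)
      = (\<Sum>w\<in>words K N. if total_phase \<alpha> w = 2 * \<kappa> then L * (1 / word_denom \<alpha> w) else 0)"
    by (intro sum.cong refl) (auto simp: assms)
  also have "\<dots> = L * coupling_sum K \<alpha> N (2 * \<kappa>)"
    unfolding coupling_sum_def sum_distrib_left
    by (subst sum.inter_filter[symmetric]) auto
  finally show ?thesis .
qed

text \<open>
  One finite set carrying the coefficients of all orders up to \<open>N\<close>, so that every trigonometric sum has the
  same index set; \<open>-\<kappa>\<close> is included because the surviving resonant term has this frequency.
\<close>

definition freqs :: "real set" where
  "freqs = insert (- \<kappa>) ((\<lambda>w. \<kappa> + total_phase \<alpha> w) ` {w. set w \<subseteq> letters K \<and> length w \<le> N})"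

lemma finite_freqs [simp]: "finite freqs"
  unfolding freqs_def using finite_lists_length_le[OF finite_letters, of K N] by simp

lemma freqsI:
  assumes "set w \<subseteq> letters K" "length w \<le> N" "\<omega> = \<kappa> + total_phase \<alpha> w"
  shows "\<omega> \<in> freqs"
  unfolding freqs_def assms(3) by (intro insertI2 imageI CollectI conjI assms)

lemma coeff_in_freqs:
  assumes "coeff m \<omega> \<noteq> 0" "m \<le> N"
  shows "\<omega> \<in> freqs"
proof -
  from coeff_support[OF assms(1)] obtain w where w: "set w \<subseteq> letters K" "length w \<le> m"
    "\<omega> = \<kappa> + total_phase \<alpha> w" by blast
  show ?thesis by (rule freqsI[OF w(1) _ w(3)]) (use w assms in simp)
qed

lemma coeff_shift_in_freqs:
  assumes "coeff m \<omega> \<noteq> 0" "m < N" "z \<in> letters K"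
  shows "\<omega> + phase \<alpha> z \<in> freqs"
proof -
  from coeff_support[OF assms(1)] obtain w where w: "set w \<subseteq> letters K" "length w \<le> m"
    "\<omega> = \<kappa> + total_phase \<alpha> w" by blast
  show ?thesis by (rule freqsI[of "z # w"]) (use w assms in simp_all)
qed

lemma \<kappa>_in_freqs: "\<kappa> \<in> freqs"
  by (rule freqsI[of "[]"]) simp_all

lemma minus_\<kappa>_in_freqs: "- \<kappa> \<in> freqs"
  by (simp add: freqs_def)

definition trig :: "(real \<Rightarrow> real) \<Rightarrow> real \<Rightarrow> real \<Rightarrow> real" where
  "trig r \<theta> x = (\<Sum>\<omega>\<in>freqs. r \<omega> * sin (\<omega> * x + \<theta>))"

definition osc :: "real \<Rightarrow> real" where
  "osc x = (\<Sum>k=1..K. lam k * cos (\<alpha> k * x))"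

lemma osc_times_sin: "osc x * sin y = (\<Sum>z\<in>letters K. weight z * sin (y + phase \<alpha> z * x))"
proof -
  have "(\<Sum>z\<in>letters K. weight z * sin (y + phase \<alpha> z * x))
      = (\<Sum>k=1..K. lam k / 2 * (sin (y + \<alpha> k * x) + sin (y - \<alpha> k * x)))"
    unfolding sum_letters
    by (intro sum.cong refl) (auto simp: weight_def phase_def sgn_if ring_distribs)
  also have "\<dots> = osc x * sin y"
    unfolding osc_def sum_distrib_right
    by (intro sum.cong refl) (simp add: sin_add sin_diff)
  finally show ?thesis ..
qed

lemma osc_times_trig:
  assumes "m < N"
  shows "osc x * trig (coeff m) \<theta> x = trig (hop m) \<theta> x"
proof -
  have "osc x * trig (coeff m) \<theta> x
      = (\<Sum>z\<in>letters K. weight z * (\<Sum>\<omega>\<in>freqs. coeff m \<omega> * sin ((\<omega> + phase \<alpha> z) * x + \<theta>)))"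
  proof -
    have "osc x * trig (coeff m) \<theta> x
        = (\<Sum>\<omega>\<in>freqs. \<Sum>z\<in>letters K. coeff m \<omega> * (weight z * sin (\<omega> * x + \<theta> + phase \<alpha> z * x)))"
    proof -
      have "osc x * (c * sin y) = (\<Sum>z\<in>letters K. c * (weight z * sin (y + phase \<alpha> z * x)))" for c y
        unfolding mult.left_commute[of "osc x" c] osc_times_sin sum_distrib_left ..
      then show ?thesis unfolding trig_def sum_distrib_left by simp
    qed
    also have "\<dots> = (\<Sum>z\<in>letters K. \<Sum>\<omega>\<in>freqs. coeff m \<omega> * (weight z * sin (\<omega> * x + \<theta> + phase \<alpha> z * x)))"
      by (rule sum.swap)
    finally show ?thesis
      by (simp add: sum_distrib_left algebra_simps)
  qed
  also have "\<dots> = (\<Sum>z\<in>letters K. weight z * (\<Sum>\<omega>\<in>freqs. coeff m (\<omega> - phase \<alpha> z) * sin (\<omega> * x + \<theta>)))"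
    by (intro sum.cong refl arg_cong2[where f = "(*)"] sum_shift_support[where g = "\<lambda>\<omega>. sin (\<omega> * x + \<theta>)"])
      (use assms coeff_in_freqs coeff_shift_in_freqs in auto)
  also have "\<dots> = (\<Sum>z\<in>letters K. weight z * (\<Sum>\<omega>\<in>freqs. coeff m (\<omega> + phase \<alpha> z) * sin (\<omega> * x + \<theta>)))"
    unfolding sum_letters by (intro sum.cong refl) (simp add: weight_def)
  also have "\<dots> = trig (hop m) \<theta> x"
    unfolding trig_def hop_def sum_distrib_right sum_distrib_left
    by (subst sum.swap) (simp add: mult_ac)
  finally show ?thesis .
qed

text \<open>
  The equation at order \<open>n\<close>. By construction the bracket multiplying \<open>sin (\<omega> x + \<theta>)\<close> vanishes for every
  \<open>\<omega> \<noteq> -\<kappa>\<close>. At \<open>\<omega> = -\<kappa>\<close> it reduces to the obstruction, which is \<open>0\<close> unless \<open>n = N\<close>.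
\<close>

lemma order_balance:
  assumes n: "1 \<le> n" "n \<le> N"
  shows "trig (\<lambda>\<omega>. (\<omega>\<^sup>2 - \<kappa>\<^sup>2) * coeff n \<omega>) \<theta> x + osc x * trig (coeff (n - 1)) \<theta> x
     + (\<Sum>l=1..n. shift_coeff l * trig (coeff (n - l)) \<theta> x)
    = (if n = N then reflection * sin (\<theta> - \<kappa> * x) else 0)"
proof -
  define b where "b \<omega> = (\<omega>\<^sup>2 - \<kappa>\<^sup>2) * coeff n \<omega> + hop (n - 1) \<omega>
      + (\<Sum>l=1..n. shift_coeff l * coeff (n - l) \<omega>)" for \<omega>
  obtain m where m: "n = Suc m" using n(1) by (cases n) simp_all
  have zero: "coeff (Suc i) \<kappa> = 0" for i
    by (subst coeff_Suc, rule if_P, rule disjI1, rule refl)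
  have zero': "coeff (Suc i) (- \<kappa>) = 0" for i
    by (subst coeff_Suc, rule if_P, rule disjI2, rule refl)
  have zero_refl: "coeff i (- \<kappa>) = 0" for i
  proof (cases i)
    case 0
    then show ?thesis using \<kappa> by simp
  qed (use zero' in simp)
  have b1: "b \<omega> = 0" if "\<omega> \<noteq> - \<kappa>" for \<omega>
  proof (cases "\<omega> = \<kappa>")
    case True
    have "(\<Sum>l=1..n. shift_coeff l * coeff (n - l) \<kappa>) = (\<Sum>l\<in>{n}. shift_coeff l * coeff (n - l) \<kappa>)"
    proof (rule sum.mono_neutral_right)
      show "\<forall>l\<in>{1..n} - {n}. shift_coeff l * coeff (n - l) \<kappa> = 0"
      proof
        fix l assume "l \<in> {1..n} - {n}"
        then obtain i where "n - l = Suc i" by (cases "n - l") auto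
        then show "shift_coeff l * coeff (n - l) \<kappa> = 0" by (simp only: zero mult_zero_right)
      qed
    qed (use n in auto)
    then show ?thesis using True by (simp add: b_def shift_coeff_def)
  next
    case False
    then have "\<kappa>\<^sup>2 - \<omega>\<^sup>2 \<noteq> 0" using that by (simp add: power2_eq_iff)
    then have "(\<kappa>\<^sup>2 - \<omega>\<^sup>2) * coeff n \<omega> = hop m \<omega> + (\<Sum>l=1..n. shift_coeff l * coeff (n - l) \<omega>)"
      unfolding m coeff_Suc using False that by (simp only: if_False de_Morgan_disj simp_thms) simp
    then show ?thesis unfolding b_def m diff_Suc_1 by (simp only: algebra_simps)
  qed
  have b2: "b (- \<kappa>) = (if n = N then reflection else 0)"
    using hop_reflected_eq_0[of m] n m by (auto simp: b_def zero_refl reflection_def)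
  have "trig (\<lambda>\<omega>. (\<omega>\<^sup>2 - \<kappa>\<^sup>2) * coeff n \<omega>) \<theta> x + osc x * trig (coeff (n - 1)) \<theta> x
     + (\<Sum>l=1..n. shift_coeff l * trig (coeff (n - l)) \<theta> x) = trig b \<theta> x"
  proof -
    have "osc x * trig (coeff (n - 1)) \<theta> x = trig (hop (n - 1)) \<theta> x"
      by (rule osc_times_trig) (use n in auto)
    moreover have "(\<Sum>l=1..n. shift_coeff l * trig (coeff (n - l)) \<theta> x)
        = trig (\<lambda>\<omega>. \<Sum>l=1..n. shift_coeff l * coeff (n - l) \<omega>) \<theta> x"
      unfolding trig_def sum_distrib_left sum_distrib_right by (subst sum.swap) (simp add: mult_ac)
    ultimately show ?thesis by (simp add: trig_def b_def ring_distribs sum.distrib)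
  qed
  also have "trig b \<theta> x = (\<Sum>\<omega>\<in>{- \<kappa>}. b \<omega> * sin (\<omega> * x + \<theta>))"
    unfolding trig_def by (rule sum.mono_neutral_right) (use b1 minus_\<kappa>_in_freqs in auto)
  finally show ?thesis by (simp add: b2)
qed

lemma trig_coeff_0: "trig (coeff 0) \<theta> x = sin (\<kappa> * x + \<theta>)"
proof -
  have "trig (coeff 0) \<theta> x = (\<Sum>\<omega>\<in>{\<kappa>}. coeff 0 \<omega> * sin (\<omega> * x + \<theta>))"
    unfolding trig_def by (rule sum.mono_neutral_right) (use \<kappa>_in_freqs in auto)
  then show ?thesis by simp
qed

end

section \<open>Decaying solutions from approximate solutions\<close>

context
  fixes h :: "real \<Rightarrow> real" and X c s :: real
  assumes X: "X > 0" and s: "s > 1" and cont: "continuous_on {X..} h"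
    and bound: "\<And>t. t \<ge> X \<Longrightarrow> \<bar>h t\<bar> \<le> c * t powr (- s)"
begin

lemma tail_integrable:
  assumes "x \<ge> X"
  shows "h integrable_on {x..}"
proof -
  have "(\<lambda>t. t powr (- s)) integrable_on {x..}"
    using has_integral_powr_to_inf[of "- s" x] X s assms by (auto simp: integrable_on_def)
  then have g: "(\<lambda>t. c * t powr (- s)) integrable_on {x..}"
    by (rule integrable_on_mult_right)
  have "h \<in> borel_measurable (lebesgue_on {x..})"
    using assms by (intro continuous_imp_measurable_on_sets_lebesgue continuous_on_subset[OF cont]) auto
  then have "h absolutely_integrable_on {x..}"
    by (rule measurable_bounded_by_integrable_imp_absolutely_integrable[OF _ _ g])
      (use assms bound in auto)
  then show ?thesis by (simp add: absolutely_integrable_on_def)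
qed

lemma tail_integral_bound:
  assumes "x \<ge> X"
  shows "\<bar>integral {x..} h\<bar> \<le> c * (x powr (1 - s) / (s - 1))"
proof -
  have hi: "((\<lambda>t. c * t powr (- s)) has_integral c * (x powr (1 - s) / (s - 1))) {x..}"
  proof -
    have "- (x powr (- s + 1)) / (- s + 1) = x powr (1 - s) / (s - 1)"
      using minus_divide_divide[of "x powr (1 - s)" "s - 1"] by simp
    then show ?thesis
      using has_integral_mult_right[OF has_integral_powr_to_inf[of "- s" x], of c] X s assms by simp
  qed
  have "norm (integral {x..} h) \<le> integral {x..} (\<lambda>t. c * t powr (- s))"
    by (rule integral_norm_bound_integral)
      (use assms tail_integrable hi bound in \<open>auto simp: integrable_on_def\<close>)
  then show ?thesis using integral_unique[OF hi] by simp
qed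

lemma tail_integral_split:
  assumes "X \<le> x" "x \<le> y"
  shows "integral {x..} h = integral {x..y} h + integral {y..} h"
proof -
  have "h integrable_on {x..y}"
    by (intro integrable_continuous_interval continuous_on_subset[OF cont]) (use assms in auto)
  moreover have "h integrable_on {y..}" using tail_integrable assms by auto
  moreover have "{x..} = {x..y} \<union> {y..}" "{x..y} \<inter> {y..} = {y}" using assms by auto
  ultimately show ?thesis by (simp add: integral_Un)
qed

lemma tail_integral_deriv_within:
  assumes "x \<ge> X"
  shows "((\<lambda>x. integral {x..} h) has_real_derivative - h x) (at x within {X..})"
proof -
  have "((\<lambda>y. integral {X..y} h) has_real_derivative h x) (at x within {X..x + 1})"
    unfolding has_real_derivative_iff_has_vector_derivative
    by (rule integral_has_vector_derivative)
      (use assms in \<open>auto intro: continuous_on_subset[OF cont]\<close>)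
  then have "((\<lambda>y. integral {X..} h - integral {X..y} h) has_real_derivative - h x) (at x within {X..x + 1})"
    by (auto intro!: derivative_eq_intros)
  then have "((\<lambda>y. integral {y..} h) has_real_derivative - h x) (at x within {X..x + 1})"
  proof (rule has_field_derivative_transform_within[of _ _ _ _ 1])
    show "integral {X..} h - integral {X..y} h = integral {y..} h" if "y \<in> {X..x + 1}" for y
      using tail_integral_split[of X y] that by auto
  qed (use assms in auto)
  moreover have "at x within {X..x + 1} = at x within {X..}"
    by (rule at_within_nhd[of _ "{..<x + 1}"]) (use assms in auto)
  ultimately show ?thesis by simp
qed

lemma tail_integral_deriv:
  assumes "x > X"
  shows "((\<lambda>x. integral {x..} h) has_real_derivative - h x) (at x)"
proof -
  have "at x within {X..} = at x"
    using assms by (intro at_within_interior) (auto simp: interior_Ici[of _ "X - 1"])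
  then show ?thesis using tail_integral_deriv_within[of x] assms by simp
qed

lemma tail_integral_continuous: "continuous_on {X..} (\<lambda>x. integral {x..} h)"
  using tail_integral_deriv_within
  by (auto simp: continuous_on_eq_continuous_within intro!: DERIV_continuous)

end

lemma bcontfun_clamp_below:
  fixes F :: "real \<Rightarrow> real"
  assumes "continuous_on {X..} F" "\<And>x. x \<ge> X \<Longrightarrow> \<bar>F x\<bar> \<le> b"
  shows "(\<lambda>x. F (max X x)) \<in> bcontfun"
proof (rule bcontfun_normI[of _ b])
  show "continuous_on UNIV (\<lambda>x. F (max X x))"
    by (rule continuous_on_compose2[OF assms(1)]) (auto intro!: continuous_intros)
qed (use assms(2) in auto)

text \<open>
  A version of Levinson's theorem for two approximate solutions of sizes \<open>f\<close> and \<open>1 / f\<close>, with \<open>f\<close> nonincreasing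
  and relative errors that are integrable at infinity. Writing \<open>u = A u1 + B u2\<close> and imposing
  \<open>A' u1 + B' u2 = 0\<close>, the equation becomes a system for \<open>A\<close> and \<open>B\<close> driven by the single function
  \<open>z = A e1 + (B / f\<^sup>2) e2\<close>. Both coefficients are integrated from infinity, \<open>A\<close> with limit \<open>1\<close> and \<open>B / f\<^sup>2\<close>
  with limit \<open>0\<close>. This keeps the growing solution under control, because \<open>f(t)\<^sup>2 / f(x)\<^sup>2 \<le> 1\<close> for \<open>t \<ge> x\<close>. So
  \<open>z = x\<^sup>-\<^sup>s y\<close> with a bounded \<open>y\<close> that is the fixed point of a contraction on some half-line \<open>[X, \<infinity>)\<close>.
\<close>

lemma perturbed_decaying_solution:
  fixes u1 v1 u2 v2 f q e1 e2 :: "real \<Rightarrow> real" and s M w0 X0 :: real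
  assumes X0: "X0 > 0" and s: "s > 1" and w0: "w0 > 0"
    and u1: "\<And>x. x \<ge> X0 \<Longrightarrow> (u1 has_real_derivative v1 x) (at x)"
    and v1: "\<And>x. x \<ge> X0 \<Longrightarrow> (v1 has_real_derivative q x * u1 x + f x * e1 x) (at x)"
    and u2: "\<And>x. x \<ge> X0 \<Longrightarrow> (u2 has_real_derivative v2 x) (at x)"
    and v2: "\<And>x. x \<ge> X0 \<Longrightarrow> (v2 has_real_derivative q x * u2 x + e2 x / f x) (at x)"
    and fpos: "\<And>x. x \<ge> X0 \<Longrightarrow> f x > 0"
    and fmono: "\<And>x y. X0 \<le> x \<Longrightarrow> x \<le> y \<Longrightarrow> f y \<le> f x"
    and fcont: "continuous_on {X0..} f"
    and e1cont: "continuous_on {X0..} e1" and e2cont: "continuous_on {X0..} e2"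
    and u1b: "\<And>x. x \<ge> X0 \<Longrightarrow> \<bar>u1 x\<bar> \<le> M * f x"
    and v1b: "\<And>x. x \<ge> X0 \<Longrightarrow> \<bar>v1 x\<bar> \<le> M * f x"
    and u2b: "\<And>x. x \<ge> X0 \<Longrightarrow> \<bar>u2 x\<bar> \<le> M / f x"
    and v2b: "\<And>x. x \<ge> X0 \<Longrightarrow> \<bar>v2 x\<bar> \<le> M / f x"
    and e1b: "\<And>x. x \<ge> X0 \<Longrightarrow> \<bar>e1 x\<bar> \<le> M * x powr (- s)"
    and e2b: "\<And>x. x \<ge> X0 \<Longrightarrow> \<bar>e2 x\<bar> \<le> M * x powr (- s)"
    and w: "\<And>x. x \<ge> X0 \<Longrightarrow> \<bar>u1 x * v2 x - v1 x * u2 x\<bar> \<ge> w0"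
  shows "\<exists>X u v. X \<ge> X0 \<and>
    (\<forall>x\<ge>X. (u has_real_derivative v x) (at x) \<and> (v has_real_derivative q x * u x) (at x)) \<and>
    ((\<lambda>x. (u x - u1 x) / f x) \<longlongrightarrow> 0) at_top \<and> ((\<lambda>x. (v x - v1 x) / f x) \<longlongrightarrow> 0) at_top"
proof -
  have M: "M \<ge> 0"
    using e1b[of X0] X0 by (smt (verit) mult_neg_pos powr_gt_zero)
  define W where "W x = u1 x * v2 x - v1 x * u2 x" for x
  \<comment> \<open>Variation of constants: \<open>A' = k1 z\<close> and \<open>B' = - f\<^sup>2 k2 z\<close>.\<close>
  define k1 where "k1 x = u2 x * f x / W x" for x
  define k2 where "k2 x = u1 x / (f x * W x)" for x
  define g where "g x = x powr (- s)" for x :: real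
  define c where "c = M / w0"
  have c: "c \<ge> 0" using M w0 by (simp add: c_def)
  have W: "W x \<noteq> 0" "\<bar>W x\<bar> \<ge> w0" if "x \<ge> X0" for x
    using w[OF that] w0 by (auto simp: W_def)
  have gpos: "g x > 0" if "x \<ge> X0" for x using that X0 by (auto simp: g_def)
  have k1b: "\<bar>k1 x\<bar> \<le> c" if x: "x \<ge> X0" for x
  proof -
    have "\<bar>u2 x * f x\<bar> \<le> M" using u2b[OF x] fpos[OF x] by (simp add: abs_mult field_simps)
    then show ?thesis unfolding k1_def c_def abs_divide
      by (intro frac_le) (use W[OF x] w0 M in auto)
  qed
  have k2b: "\<bar>k2 x\<bar> \<le> c" if x: "x \<ge> X0" for x
  proof -
    have "\<bar>u1 x / f x\<bar> \<le> M" using u1b[OF x] fpos[OF x] by (simp add: abs_mult field_simps)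
    then have "\<bar>u1 x / f x / W x\<bar> \<le> c" unfolding c_def abs_divide
      by (intro frac_le) (use W[OF x] w0 M in auto)
    then show ?thesis by (simp add: k2_def)
  qed
  have cont: "continuous_on {X0..} u1" "continuous_on {X0..} u2" "continuous_on {X0..} v1"
    "continuous_on {X0..} v2"
    using u1 u2 v1 v2 by (meson DERIV_isCont atLeast_iff continuous_at_imp_continuous_on)+
  have gcont: "continuous_on {X0..} g"
    unfolding g_def using X0 by (intro continuous_intros) auto
  have Wcont: "continuous_on {X0..} W" unfolding W_def by (intro continuous_intros cont)
  have k1cont: "continuous_on {X0..} k1" unfolding k1_def
    by (intro continuous_intros cont fcont Wcont) (use W in auto)
  have k2cont: "continuous_on {X0..} k2" unfolding k2_def
    by (intro continuous_intros cont fcont Wcont) (use W fpos in \<open>force+\<close>)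
  define r where "r x = x powr (1 - s) / (s - 1)" for x :: real
  have r0: "(r \<longlongrightarrow> 0) at_top"
    unfolding r_def using s by real_asymp
  have rmono: "r y \<le> r x" if "X0 \<le> x" "x \<le> y" for x y
    unfolding r_def using that X0 s by (intro divide_right_mono powr_mono2') auto
  have rnn: "r x \<ge> 0" for x unfolding r_def using s by auto
  have "((\<lambda>x. 2 * M * c * r x) \<longlongrightarrow> 2 * M * c * 0) at_top" by (intro tendsto_intros r0)
  then have "\<forall>\<^sub>F x in at_top. 2 * M * c * r x < 1 / 2"
    by (rule order_tendstoD) auto
  \<comment> \<open>On \<open>[X, \<infinity>)\<close> the map whose fixed point is \<open>y\<close> has the Lipschitz constant \<open>2 M c r(X)\<close>.\<close>
  then obtain X where X: "X \<ge> X0" "2 * M * c * r X < 1 / 2"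
    using eventually_happens'[OF _ eventually_conj[OF _ eventually_ge_at_top[of X0]]] by force
  have X_pos: "X > 0" using X X0 by simp
  define h1 where "h1 y t = k1 t * (g t * y t)" for y :: "real \<Rightarrow> real" and t
  define h2 where "h2 y t = (f t)\<^sup>2 * (k2 t * (g t * y t))" for y :: "real \<Rightarrow> real" and t
  have hcont: "continuous_on {x..} (h1 y)" "continuous_on {x..} (h2 y)"
    if "continuous_on {X..} y" "x \<ge> X" for y x
  proof -
    have sub: "{x..} \<subseteq> {X0..}" "{x..} \<subseteq> {X..}" using X that by auto
    note co = continuous_on_subset[OF k1cont sub(1)] continuous_on_subset[OF k2cont sub(1)]
      continuous_on_subset[OF gcont sub(1)] continuous_on_subset[OF fcont sub(1)]
      continuous_on_subset[OF that(1) sub(2)]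
    show "continuous_on {x..} (h1 y)" "continuous_on {x..} (h2 y)"
      unfolding h1_def h2_def by (intro continuous_intros co)+
  qed
  have h1b: "\<bar>h1 y t\<bar> \<le> (c * b) * t powr (- s)" if "\<And>t. t \<ge> X \<Longrightarrow> \<bar>y t\<bar> \<le> b" "t \<ge> X" for y b t
  proof -
    have "\<bar>h1 y t\<bar> = \<bar>k1 t\<bar> * \<bar>y t\<bar> * g t"
      using gpos[of t] X that by (simp add: h1_def abs_mult)
    also have "\<dots> \<le> c * b * g t"
      using that X k1b[of t] c gpos[of t] by (intro mult_mono mult_nonneg_nonneg) (auto intro: order_trans[OF abs_ge_zero])
    finally show ?thesis by (simp add: g_def)
  qed
  have h2b: "\<bar>h2 y t\<bar> \<le> ((f x)\<^sup>2 * (c * b)) * t powr (- s)"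
    if "\<And>t. t \<ge> X \<Longrightarrow> \<bar>y t\<bar> \<le> b" "x \<ge> X" "t \<ge> x" for y b t x
  proof -
    have "f t \<le> f x" "f t > 0" using fmono[of x t] fpos[of t] that X by auto
    then have "(f t)\<^sup>2 \<le> (f x)\<^sup>2" by (intro power_mono) auto
    have "\<bar>h2 y t\<bar> = (f t)\<^sup>2 * (\<bar>k2 t\<bar> * \<bar>y t\<bar>) * g t"
      using gpos[of t] X that by (simp add: h2_def abs_mult)
    also have "\<dots> \<le> (f x)\<^sup>2 * (c * b) * g t"
      using that X k2b[of t] c gpos[of t] \<open>(f t)\<^sup>2 \<le> (f x)\<^sup>2\<close>
      by (intro mult_mono mult_nonneg_nonneg) (auto intro: order_trans[OF abs_ge_zero])
    finally show ?thesis by (simp add: g_def)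
  qed
  define I1 where "I1 y x = integral {x..} (h1 y)" for y :: "real \<Rightarrow> real" and x
  define I2 where "I2 y x = integral {x..} (h2 y)" for y :: "real \<Rightarrow> real" and x
  have I1b: "\<bar>I1 y x\<bar> \<le> c * b * r x" and I2b: "\<bar>I2 y x / (f x)\<^sup>2\<bar> \<le> c * b * r x"
    if "continuous_on {X..} y" "\<And>t. t \<ge> X \<Longrightarrow> \<bar>y t\<bar> \<le> b" "x \<ge> X" for y b x
  proof -
    have x: "x > 0" using that X_pos by simp
    show "\<bar>I1 y x\<bar> \<le> c * b * r x"
      unfolding I1_def r_def
      by (rule tail_integral_bound[OF x s hcont(1)[OF that(1,3)]]) (use h1b[OF that(2)] that in auto)
    have "\<bar>I2 y x\<bar> \<le> (f x)\<^sup>2 * (c * b) * r x"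
      unfolding I2_def r_def
      by (rule tail_integral_bound[OF x s hcont(2)[OF that(1,3)]]) (use h2b[OF that(2)] that in auto)
    moreover have "f x > 0" using fpos that X by auto
    ultimately show "\<bar>I2 y x / (f x)\<^sup>2\<bar> \<le> c * b * r x" by (simp add: field_simps)
  qed
  have Icont: "continuous_on {X..} (I1 y)" "continuous_on {X..} (I2 y)"
    and Ider: "\<And>x. x > X \<Longrightarrow> (I1 y has_real_derivative - h1 y x) (at x)"
      "\<And>x. x > X \<Longrightarrow> (I2 y has_real_derivative - h2 y x) (at x)"
    and Iint: "\<And>x. x \<ge> X \<Longrightarrow> h1 y integrable_on {x..}" "\<And>x. x \<ge> X \<Longrightarrow> h2 y integrable_on {x..}"
    if "continuous_on {X..} y" "\<And>t. t \<ge> X \<Longrightarrow> \<bar>y t\<bar> \<le> b" for y b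
  proof -
    note 1 = X_pos s hcont(1)[OF that(1) order_refl] h1b[OF that(2)]
    note 2 = X_pos s hcont(2)[OF that(1) order_refl] h2b[OF that(2) order_refl]
    show "continuous_on {X..} (I1 y)" "\<And>x. x > X \<Longrightarrow> (I1 y has_real_derivative - h1 y x) (at x)"
      "\<And>x. x \<ge> X \<Longrightarrow> h1 y integrable_on {x..}"
      unfolding I1_def using tail_integral_continuous[OF 1] tail_integral_deriv[OF 1] tail_integrable[OF 1]
      by auto
    show "continuous_on {X..} (I2 y)" "\<And>x. x > X \<Longrightarrow> (I2 y has_real_derivative - h2 y x) (at x)"
      "\<And>x. x \<ge> X \<Longrightarrow> h2 y integrable_on {x..}"
      unfolding I2_def using tail_integral_continuous[OF 2] tail_integral_deriv[OF 2] tail_integrable[OF 2]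
      by auto
  qed
  define F where "F y x = (e1 x / g x) * (1 - I1 y x) + (e2 x / g x) * (I2 y x / (f x)\<^sup>2)" for y x
  have eb: "\<bar>e1 x / g x\<bar> \<le> M" "\<bar>e2 x / g x\<bar> \<le> M" if "x \<ge> X" for x
    using e1b[of x] e2b[of x] gpos[of x] X that by (auto simp: g_def[symmetric] field_simps)
  have Fcont: "continuous_on {X..} (F y)" if "continuous_on {X..} y" "\<And>t. t \<ge> X \<Longrightarrow> \<bar>y t\<bar> \<le> b" for y b
  proof -
    have sub: "{X..} \<subseteq> {X0..}" using X by auto
    note co = Icont[OF that] continuous_on_subset[OF gcont sub] continuous_on_subset[OF fcont sub]
      continuous_on_subset[OF e1cont sub] continuous_on_subset[OF e2cont sub]
    have nz: "g x \<noteq> 0" "f x \<noteq> 0" if "x \<ge> X" for x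
      using gpos[of x] fpos[of x] X that by auto
    show ?thesis unfolding F_def
      by (intro continuous_intros co) (auto simp: nz)
  qed
  have Fbound: "\<bar>F y x\<bar> \<le> M * (1 + c * b * r X) + M * (c * b * r X)"
    if "continuous_on {X..} y" "\<And>t. t \<ge> X \<Longrightarrow> \<bar>y t\<bar> \<le> b" "x \<ge> X" for y b x
  proof -
    have b: "b \<ge> 0" using that(2)[OF order_refl] by linarith
    have rr: "c * b * r x \<le> c * b * r X"
      using rmono[of X x] X that c b by (intro mult_left_mono) auto
    have "\<bar>F y x\<bar> \<le> \<bar>e1 x / g x\<bar> * \<bar>1 - I1 y x\<bar> + \<bar>e2 x / g x\<bar> * \<bar>I2 y x / (f x)\<^sup>2\<bar>"
      unfolding F_def by (metis abs_mult abs_triangle_ineq)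
    also have "\<dots> \<le> M * (1 + c * b * r X) + M * (c * b * r X)"
      using eb[OF that(3)] I1b[OF that] I2b[OF that] rr M
      by (intro add_mono mult_mono) (auto simp: abs_if split: if_splits)
    finally show ?thesis .
  qed
  define T :: "(real \<Rightarrow>\<^sub>C real) \<Rightarrow> (real \<Rightarrow>\<^sub>C real)" where
    "T y = Bcontfun (\<lambda>x. F (apply_bcontfun y) (max X x))" for y
  have yb: "\<bar>apply_bcontfun y t\<bar> \<le> norm y" for y :: "real \<Rightarrow>\<^sub>C real" and t
    using norm_bounded[of y t] by simp
  have T: "apply_bcontfun (T y) x = F (apply_bcontfun y) (max X x)" for y x
    unfolding T_def
    by (subst Bcontfun_inverse) (auto intro!: bcontfun_clamp_below Fcont yb Fbound)
  have "dist (T y) (T y') \<le> (1 / 2) * dist y y'" for y y' :: "real \<Rightarrow>\<^sub>C real"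
  proof (rule dist_bound)
    fix x
    define x' where "x' = max X x"
    have x': "x' \<ge> X" by (simp add: x'_def)
    define d where "d t = apply_bcontfun y t - apply_bcontfun y' t" for t
    have dc: "continuous_on {X..} d" unfolding d_def by (intro continuous_intros) auto
    have db: "\<bar>d t\<bar> \<le> dist y y'" for t
      using dist_bounded[of y t y'] by (simp add: d_def dist_real_def)
    have I1d: "I1 y x' - I1 y' x' = I1 d x'" unfolding I1_def
      by (subst integral_diff[symmetric])
        (use x' in \<open>auto intro!: Iint[OF _ yb] simp: h1_def d_def algebra_simps intro!: integral_cong\<close>)
    have I2d: "I2 y x' - I2 y' x' = I2 d x'" unfolding I2_def
      by (subst integral_diff[symmetric])
        (use x' in \<open>auto intro!: Iint[OF _ yb] simp: h2_def d_def algebra_simps intro!: integral_cong\<close>)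
    have "F y x' - F y' x' = - (e1 x' / g x') * (I1 y x' - I1 y' x') + (e2 x' / g x') * ((I2 y x' - I2 y' x') / (f x')\<^sup>2)"
      by (simp add: F_def ring_distribs diff_divide_distrib)
    also have "\<bar>\<dots>\<bar> \<le> \<bar>e1 x' / g x'\<bar> * \<bar>I1 d x'\<bar> + \<bar>e2 x' / g x'\<bar> * \<bar>I2 d x' / (f x')\<^sup>2\<bar>"
      unfolding I1d I2d by (metis (no_types, lifting) abs_minus_cancel abs_mult abs_triangle_ineq)
    also have "\<dots> \<le> M * (c * dist y y' * r X) + M * (c * dist y y' * r X)"
    proof -
      have "c * dist y y' * r x' \<le> c * dist y y' * r X"
        using rmono[of X x'] X x' c by (intro mult_left_mono) auto
      then show ?thesis
        using eb[OF x'] I1b[OF dc db x'] I2b[OF dc db x'] M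
        by (intro add_mono mult_mono) auto
    qed
    also have "\<dots> = (2 * M * c * r X) * dist y y'" by simp
    also have "\<dots> \<le> (1 / 2) * dist y y'" using X by (intro mult_right_mono) auto
    finally show "dist (apply_bcontfun (T y) x) (apply_bcontfun (T y') x) \<le> (1 / 2) * dist y y'"
      by (simp add: T x'_def dist_real_def)
  qed
  then have "\<exists>!y. T y = y" by (intro banach_fix_type[of "1/2"]) auto
  then obtain yy where yy: "T yy = yy" by blast
  define y where "y = apply_bcontfun yy"
  define b where "b = norm yy"
  have y: "y x = F y x" if "x \<ge> X" for x
    using arg_cong[OF yy, of "\<lambda>y. apply_bcontfun y x"] that by (simp add: T y_def max_absorb2)
  have yc: "continuous_on {X..} y" by (simp add: y_def)
  have yb': "\<bar>y t\<bar> \<le> b" for t by (simp add: y_def b_def yb)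
  define A where "A x = 1 - I1 y x" for x
  define B where "B x = I2 y x" for x
  define u where "u x = A x * u1 x + B x * u2 x" for x
  define v where "v x = A x * v1 x + B x * v2 x" for x
  have dA: "(A has_real_derivative h1 y x) (at x)" if "x > X" for x
    unfolding A_def using Ider(1)[OF yc yb' that] by (auto intro!: derivative_eq_intros)
  have dB: "(B has_real_derivative - h2 y x) (at x)" if "x > X" for x
    unfolding B_def using Ider(2)[OF yc yb' that] by (auto intro!: derivative_eq_intros)
  have du: "(u has_real_derivative v x) (at x)" and dv: "(v has_real_derivative q x * u x) (at x)"
    if x: "x > X" for x
  proof -
    have x0: "x \<ge> X0" using x X by simp
    have fx: "f x > 0" and gx: "g x > 0" using fpos gpos x0 by auto
    have Wx: "W x \<noteq> 0" using W x0 by auto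
    have "(u has_real_derivative (h1 y x * u1 x + A x * v1 x + (- h2 y x * u2 x + B x * v2 x))) (at x)"
      unfolding u_def using dA[OF x] dB[OF x] u1[OF x0] u2[OF x0]
      by (auto intro!: derivative_eq_intros simp: algebra_simps)
    moreover have "h1 y x * u1 x - h2 y x * u2 x = 0"
      using fx Wx by (simp add: h1_def h2_def k1_def k2_def field_simps power2_eq_square)
    ultimately show "(u has_real_derivative v x) (at x)" by (simp add: v_def algebra_simps)
    have "(v has_real_derivative (h1 y x * v1 x + A x * (q x * u1 x + f x * e1 x)
        + (- h2 y x * v2 x + B x * (q x * u2 x + e2 x / f x)))) (at x)"
      unfolding v_def using dA[OF x] dB[OF x] v1[OF x0] v2[OF x0]
      by (auto intro!: derivative_eq_intros simp: algebra_simps)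
    moreover have "h1 y x * v1 x - h2 y x * v2 x = - f x * (g x * y x)"
    proof -
      have "h1 y x * v1 x - h2 y x * v2 x = f x * (g x * y x) * (u2 x * v1 x - u1 x * v2 x) / W x"
        using fx Wx by (simp add: h1_def h2_def k1_def k2_def field_simps power2_eq_square)
      also have "u2 x * v1 x - u1 x * v2 x = - W x" by (simp add: W_def)
      finally show ?thesis using Wx by simp
    qed
    moreover have "A x * (f x * e1 x) + B x * (e2 x / f x) = f x * (g x * y x)"
    proof -
      have "g x * y x = e1 x * A x + e2 x * (B x / (f x)\<^sup>2)"
        using gx y[of x] x by (simp add: F_def A_def B_def field_simps)
      then show ?thesis using fx by (simp add: field_simps power2_eq_square)
    qed
    moreover have "h1 y x * v1 x + A x * (q x * u1 x + f x * e1 x)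
        + (- h2 y x * v2 x + B x * (q x * u2 x + e2 x / f x))
      = (h1 y x * v1 x - h2 y x * v2 x) + (A x * (f x * e1 x) + B x * (e2 x / f x)) + q x * u x"
      by (simp add: u_def algebra_simps)
    ultimately show "(v has_real_derivative q x * u x) (at x)" by simp
  qed
  have small: "((\<lambda>x. (A x * a1 x + B x * a2 x - a1 x) / f x) \<longlongrightarrow> 0) at_top"
    if a: "\<And>x. x \<ge> X0 \<Longrightarrow> \<bar>a1 x\<bar> \<le> M * f x" "\<And>x. x \<ge> X0 \<Longrightarrow> \<bar>a2 x\<bar> \<le> M / f x"
    for a1 a2 :: "real \<Rightarrow> real"
  proof (rule Lim_null_comparison)
    show "((\<lambda>x. M * (c * b * r x) + M * (c * b * r x)) \<longlongrightarrow> 0) at_top"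
      using tendsto_mult_left[OF r0, of "2 * M * c * b"] by (simp add: algebra_simps)
    show "\<forall>\<^sub>F x in at_top. norm ((A x * a1 x + B x * a2 x - a1 x) / f x)
        \<le> M * (c * b * r x) + M * (c * b * r x)"
      using eventually_ge_at_top[of X]
    proof eventually_elim
      case (elim x)
      have x0: "x \<ge> X0" using elim X by simp
      have fx: "f x > 0" using fpos x0 by auto
      have 1: "\<bar>A x - 1\<bar> \<le> c * b * r x" using I1b[OF yc yb' elim] by (simp add: A_def)
      have 2: "\<bar>B x / (f x)\<^sup>2\<bar> \<le> c * b * r x" using I2b[OF yc yb' elim] by (simp add: B_def)
      have 3: "\<bar>a1 x / f x\<bar> \<le> M" "\<bar>f x * a2 x\<bar> \<le> M"
        using a[OF x0] fx by (simp_all add: abs_mult field_simps)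
      have "(A x * a1 x + B x * a2 x - a1 x) / f x
          = (a1 x / f x) * (A x - 1) + (f x * a2 x) * (B x / (f x)\<^sup>2)"
        using fx by (simp add: field_simps power2_eq_square)
      also have "norm \<dots> \<le> \<bar>a1 x / f x\<bar> * \<bar>A x - 1\<bar> + \<bar>f x * a2 x\<bar> * \<bar>B x / (f x)\<^sup>2\<bar>"
        unfolding real_norm_def by (metis abs_mult abs_triangle_ineq)
      also have "\<dots> \<le> M * (c * b * r x) + M * (c * b * r x)"
        using 1 2 3 M by (intro add_mono mult_mono) auto
      finally show ?case .
    qed
  qed
  show ?thesis
  proof (rule exI[of _ "X + 1"], rule exI[of _ u], rule exI[of _ v], intro conjI)
    show "((\<lambda>x. (u x - u1 x) / f x) \<longlongrightarrow> 0) at_top" unfolding u_def by (rule small[OF u1b u2b])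
    show "((\<lambda>x. (v x - v1 x) / f x) \<longlongrightarrow> 0) at_top" unfolding v_def by (rule small[OF v1b v2b])
  qed (use X du dv in auto)
qed

section \<open>The approximate solutions and their residual\<close>

lemma sum_triangle_reindex:
  fixes f :: "nat \<Rightarrow> nat \<Rightarrow> real"
  shows "(\<Sum>n=1..N. \<Sum>l=1..n. f l (n - l)) = (\<Sum>l=1..N. \<Sum>m\<le>N - l. f l m)"
proof -
  have "(\<Sum>n=1..N. \<Sum>l=1..n. f l (n - l)) = (\<Sum>(n, l)\<in>Sigma {1..N} (\<lambda>n. {1..n}). f l (n - l))"
    by (rule sum.Sigma) auto
  also have "\<dots> = (\<Sum>(l, m)\<in>Sigma {1..N} (\<lambda>l. {..N - l}). f l m)"
    by (rule sum.reindex_bij_witness[of _ "\<lambda>(l, m). (l + m, l)" "\<lambda>(n, l). (l, n - l)"]) auto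
  also have "\<dots> = (\<Sum>l=1..N. \<Sum>m\<le>N - l. f l m)"
    by (rule sum.Sigma[symmetric]) auto
  finally show ?thesis .
qed

lemma bounded_mult_in_bigo:
  fixes f g h :: "real \<Rightarrow> real"
  assumes "f \<in> O[F](\<lambda>_. 1)" "g \<in> O[F](h)"
  shows "(\<lambda>x. f x * g x) \<in> O[F](h)"
  using landau_o.big.mult[OF assms] by simp

lemma bigo_powr_tendsto_0:
  fixes f :: "real \<Rightarrow> real"
  assumes "f \<in> O(\<lambda>x. x powr (- c))" "c > 0"
  shows "(f \<longlongrightarrow> 0) at_top"
proof -
  from assms(1) obtain M where "\<forall>\<^sub>F x in at_top. norm (f x) \<le> M * norm (x powr (- c))"
    by (elim landau_o.bigE)
  moreover have "((\<lambda>x. x powr (- c)) \<longlongrightarrow> 0) at_top"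
    using assms(2) by real_asymp
  then have "((\<lambda>x. M * norm (x powr (- c))) \<longlongrightarrow> 0) at_top"
    by (intro tendsto_mult_right_zero tendsto_norm_zero)
  ultimately show ?thesis by (rule Lim_null_comparison)
qed

text \<open>
  The admissible range of \<open>\<gamma>\<close>: terms of order \<open>x\<^sup>-\<^sup>N\<^sup>\<gamma>\<close> still matter, terms of order \<open>x\<^bsup>-(N+1)\<gamma>\<^esup>\<close> are
  integrable.
\<close>

locale resonant_potential = resonant_phases +
  fixes \<gamma> :: real
  assumes \<gamma>: "\<gamma> > 0" "real N * \<gamma> \<le> 1" "real (Suc N) * \<gamma> > 1"
begin

definition amp :: "nat \<Rightarrow> real \<Rightarrow> real" where
  "amp m x = x powr (- (real m * \<gamma>))"

definition amp' :: "nat \<Rightarrow> real \<Rightarrow> real" where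
  "amp' m x = - (real m * \<gamma>) * x powr (- (real m * \<gamma>) - 1)"

definition amp'' :: "nat \<Rightarrow> real \<Rightarrow> real" where
  "amp'' m x = real m * \<gamma> * (real m * \<gamma> + 1) * x powr (- (real m * \<gamma>) - 2)"

definition correction :: "real \<Rightarrow> real" where
  "correction x = (\<Sum>l=1..N. shift_coeff l * amp l x)"

definition potential :: "real \<Rightarrow> real" where
  "potential x = osc x * amp 1 x + correction x"

definition mode :: "nat \<Rightarrow> real \<Rightarrow> real \<Rightarrow> real" where
  "mode m \<theta> x = trig (coeff m) \<theta> x"

definition mode' :: "nat \<Rightarrow> real \<Rightarrow> real \<Rightarrow> real" where
  "mode' m \<theta> x = (\<Sum>\<omega>\<in>freqs. coeff m \<omega> * (\<omega> * cos (\<omega> * x + \<theta>)))"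

definition mode'' :: "nat \<Rightarrow> real \<Rightarrow> real \<Rightarrow> real" where
  "mode'' m \<theta> x = (\<Sum>\<omega>\<in>freqs. coeff m \<omega> * (- \<omega>\<^sup>2 * sin (\<omega> * x + \<theta>)))"

definition wave :: "real \<Rightarrow> real \<Rightarrow> real" where
  "wave \<theta> x = (\<Sum>m\<le>N. amp m x * mode m \<theta> x)"

definition wave' :: "real \<Rightarrow> real \<Rightarrow> real" where
  "wave' \<theta> x = (\<Sum>m\<le>N. amp m x * mode' m \<theta> x + amp' m x * mode m \<theta> x)"

definition wave'' :: "real \<Rightarrow> real \<Rightarrow> real" where
  "wave'' \<theta> x = (\<Sum>m\<le>N. amp m x * mode'' m \<theta> x + 2 * amp' m x * mode' m \<theta> x + amp'' m x * mode m \<theta> x)"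

text \<open>
  If \<open>h' = amp N\<close>, then \<open>u = exp (g h) wave\<close> satisfies \<open>u'' - (potential - \<kappa>\<^sup>2) u = exp (g h) residual\<close>.
\<close>

definition residual :: "real \<Rightarrow> real \<Rightarrow> real \<Rightarrow> real" where
  "residual \<theta> g x = wave'' \<theta> x + 2 * g * amp N x * wave' \<theta> x
     + (g\<^sup>2 * (amp N x)\<^sup>2 + g * amp' N x) * wave \<theta> x - (potential x - \<kappa>\<^sup>2) * wave \<theta> x"

lemma amp_mult: "amp l x * amp m x = amp (l + m) x"
  by (simp add: amp_def powr_add[symmetric] algebra_simps)

lemma amp_deriv: "x > 0 \<Longrightarrow> (amp m has_real_derivative amp' m x) (at x)"
  unfolding amp_def[abs_def] amp'_def by (auto intro!: derivative_eq_intros)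

lemma amp'_deriv: "x > 0 \<Longrightarrow> (amp' m has_real_derivative amp'' m x) (at x)"
  unfolding amp'_def[abs_def] amp''_def by (auto intro!: derivative_eq_intros simp: algebra_simps)

lemma mode_deriv: "(mode m \<theta> has_real_derivative mode' m \<theta> x) (at x)"
  unfolding mode_def[abs_def] mode'_def trig_def by (auto intro!: derivative_eq_intros sum.cong)

lemma mode'_deriv: "(mode' m \<theta> has_real_derivative mode'' m \<theta> x) (at x)"
  unfolding mode'_def[abs_def] mode''_def
  by (auto intro!: derivative_eq_intros sum.cong simp: power2_eq_square)

lemma wave_deriv: "x > 0 \<Longrightarrow> (wave \<theta> has_real_derivative wave' \<theta> x) (at x)"
  unfolding wave_def[abs_def] wave'_def
  by (auto intro!: derivative_eq_intros amp_deriv mode_deriv sum.cong)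

lemma wave'_deriv: "x > 0 \<Longrightarrow> (wave' \<theta> has_real_derivative wave'' \<theta> x) (at x)"
  unfolding wave'_def[abs_def] wave''_def
  by (auto intro!: derivative_eq_intros amp_deriv amp'_deriv mode_deriv mode'_deriv sum.cong)

lemma mode_0: "mode 0 \<theta> x = sin (\<kappa> * x + \<theta>)"
  by (simp add: mode_def trig_coeff_0)

lemma mode'_0: "mode' 0 \<theta> x = \<kappa> * cos (\<kappa> * x + \<theta>)"
proof -
  have "mode' 0 \<theta> x = (\<Sum>\<omega>\<in>{\<kappa>}. coeff 0 \<omega> * (\<omega> * cos (\<omega> * x + \<theta>)))"
    unfolding mode'_def by (rule sum.mono_neutral_right) (use \<kappa>_in_freqs in auto)
  then show ?thesis by simp
qed

lemma mode''_0: "mode'' 0 \<theta> x = - \<kappa>\<^sup>2 * mode 0 \<theta> x"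
proof -
  have "mode'' 0 \<theta> x = (\<Sum>\<omega>\<in>{\<kappa>}. coeff 0 \<omega> * (- \<omega>\<^sup>2 * sin (\<omega> * x + \<theta>)))"
    unfolding mode''_def by (rule sum.mono_neutral_right) (use \<kappa>_in_freqs in auto)
  then show ?thesis by (simp add: mode_0)
qed

lemma mode_balance:
  assumes "n \<in> {1..N}"
  shows "mode'' n \<theta> x + \<kappa>\<^sup>2 * mode n \<theta> x
    = osc x * mode (n - 1) \<theta> x + (\<Sum>l=1..n. shift_coeff l * mode (n - l) \<theta> x)
      - (if n = N then reflection * sin (\<theta> - \<kappa> * x) else 0)"
proof -
  have "trig (\<lambda>\<omega>. (\<omega>\<^sup>2 - \<kappa>\<^sup>2) * coeff n \<omega>) \<theta> x = - mode'' n \<theta> x - \<kappa>\<^sup>2 * mode n \<theta> x"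
    unfolding trig_def mode''_def mode_def sum_distrib_left sum_negf[symmetric] sum_subtractf[symmetric]
    by (rule sum.cong) (auto simp: algebra_simps)
  then show ?thesis using order_balance[of n \<theta> x] assms by (simp add: mode_def)
qed

text \<open>
  The terms of order higher than \<open>N\<close> in the product of \<open>potential\<close> and \<open>wave\<close>.
\<close>

definition overshoot :: "real \<Rightarrow> real \<Rightarrow> real" where
  "overshoot \<theta> x = osc x * mode N \<theta> x * amp (Suc N) x
     + (\<Sum>l=1..N. \<Sum>m\<in>{N - l<..N}. shift_coeff l * mode m \<theta> x * amp (l + m) x)"

lemma amp_Suc: "amp (Suc m) x = amp 1 x * amp m x"
  using amp_mult[of 1 x m] by simp

lemma potential_times_wave:
  "potential x * wave \<theta> x = (\<Sum>n=1..N. amp n x *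
      (osc x * mode (n - 1) \<theta> x + (\<Sum>l=1..n. shift_coeff l * mode (n - l) \<theta> x))) + overshoot \<theta> x"
proof -
  have "osc x * amp 1 x * wave \<theta> x = (\<Sum>m\<le>N. osc x * mode m \<theta> x * amp (Suc m) x)"
    unfolding wave_def sum_distrib_left
    by (intro sum.cong refl) (simp only: amp_Suc mult_ac)
  also have "\<dots> = (\<Sum>m<N. osc x * mode m \<theta> x * amp (Suc m) x) + osc x * mode N \<theta> x * amp (Suc N) x"
    by (simp add: lessThan_Suc_atMost[symmetric])
  also have "(\<Sum>m<N. osc x * mode m \<theta> x * amp (Suc m) x) = (\<Sum>n=1..N. osc x * mode (n - 1) \<theta> x * amp n x)"
    by (rule sum.reindex_bij_witness[of _ "\<lambda>n. n - 1" Suc]) auto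
  finally have 1: "osc x * amp 1 x * wave \<theta> x = \<dots> + osc x * mode N \<theta> x * amp (Suc N) x" .
  have "correction x * wave \<theta> x = (\<Sum>l=1..N. \<Sum>m\<le>N. shift_coeff l * mode m \<theta> x * amp (l + m) x)"
    unfolding correction_def wave_def sum_product
    by (intro sum.cong refl) (simp only: amp_mult[symmetric] mult_ac)
  also have "\<dots> = (\<Sum>l=1..N. (\<Sum>m\<le>N - l. shift_coeff l * mode m \<theta> x * amp (l + m) x)
      + (\<Sum>m\<in>{N - l<..N}. shift_coeff l * mode m \<theta> x * amp (l + m) x))"
  proof (rule sum.cong[OF refl])
    fix l assume "l \<in> {1..N}"
    have "{..N} = {..N - l} \<union> {N - l<..N}" by auto
    then show "(\<Sum>m\<le>N. shift_coeff l * mode m \<theta> x * amp (l + m) x)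
      = (\<Sum>m\<le>N - l. shift_coeff l * mode m \<theta> x * amp (l + m) x)
      + (\<Sum>m\<in>{N - l<..N}. shift_coeff l * mode m \<theta> x * amp (l + m) x)"
      by (simp only:) (rule sum.union_disjoint; auto)
  qed
  also have "\<dots> = (\<Sum>n=1..N. \<Sum>l=1..n. shift_coeff l * mode (n - l) \<theta> x * amp (l + (n - l)) x)
      + (\<Sum>l=1..N. \<Sum>m\<in>{N - l<..N}. shift_coeff l * mode m \<theta> x * amp (l + m) x)"
    unfolding sum_triangle_reindex[where f = "\<lambda>l m. shift_coeff l * mode m \<theta> x * amp (l + m) x"]
    by (rule sum.distrib)
  also have "(\<Sum>n=1..N. \<Sum>l=1..n. shift_coeff l * mode (n - l) \<theta> x * amp (l + (n - l)) x)
      = (\<Sum>n=1..N. amp n x * (\<Sum>l=1..n. shift_coeff l * mode (n - l) \<theta> x))"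
    unfolding sum_distrib_left by (intro sum.cong refl) simp
  finally have 2: "correction x * wave \<theta> x = \<dots> +
      (\<Sum>l=1..N. \<Sum>m\<in>{N - l<..N}. shift_coeff l * mode m \<theta> x * amp (l + m) x)" .
  show ?thesis
    unfolding potential_def overshoot_def ring_distribs 1 2
    by (simp add: sum.distrib mult_ac)
qed

text \<open>
  The hypothesis makes the surviving resonant term equal to the leading part of \<open>2 g h' wave'\<close>. After this
  cancellation every remaining term contains an amplitude of order beyond \<open>N\<close> or a derivative of an amplitude.
\<close>

lemma residual_eq:
  assumes "reflection * sin (\<theta> - \<kappa> * x) = 2 * g * \<kappa> * cos (\<kappa> * x + \<theta>)"
  shows "residual \<theta> g x = (\<Sum>m\<le>N. 2 * (mode' m \<theta> x * amp' m x) + mode m \<theta> x * amp'' m x)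
     - overshoot \<theta> x
     + 2 * g * ((\<Sum>m=1..N. mode' m \<theta> x * amp (N + m) x) + (\<Sum>m\<le>N. amp N x * (mode m \<theta> x * amp' m x)))
     + (g\<^sup>2 * (wave \<theta> x * amp (N + N) x) + g * (wave \<theta> x * amp' N x))"
proof -
  have split: "{..N} = insert 0 {1..N}" by auto
  have "(\<Sum>m\<le>N. amp m x * (mode'' m \<theta> x + \<kappa>\<^sup>2 * mode m \<theta> x))
      = (\<Sum>m=1..N. amp m x * (mode'' m \<theta> x + \<kappa>\<^sup>2 * mode m \<theta> x))"
    unfolding split by (subst sum.insert) (auto simp: mode''_0)
  also have "\<dots> = (\<Sum>n=1..N. amp n x * (osc x * mode (n - 1) \<theta> x + (\<Sum>l=1..n. shift_coeff l * mode (n - l) \<theta> x))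
      - (if n = N then amp N x * (reflection * sin (\<theta> - \<kappa> * x)) else 0))"
    by (intro sum.cong refl) (simp add: mode_balance right_diff_distrib)
  also have "\<dots> = potential x * wave \<theta> x - overshoot \<theta> x - amp N x * (2 * g * \<kappa> * cos (\<kappa> * x + \<theta>))"
    unfolding sum_subtractf potential_times_wave assms using N by simp
  finally have 1: "(\<Sum>m\<le>N. amp m x * (mode'' m \<theta> x + \<kappa>\<^sup>2 * mode m \<theta> x)) = \<dots>" .
  have 2: "wave'' \<theta> x + \<kappa>\<^sup>2 * wave \<theta> x = (\<Sum>m\<le>N. amp m x * (mode'' m \<theta> x + \<kappa>\<^sup>2 * mode m \<theta> x))
      + (\<Sum>m\<le>N. 2 * (mode' m \<theta> x * amp' m x) + mode m \<theta> x * amp'' m x)"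
    unfolding wave''_def wave_def sum_distrib_left sum.distrib[symmetric]
    by (intro sum.cong refl) (simp add: algebra_simps)
  have "(\<Sum>m\<le>N. amp m x * mode' m \<theta> x) = \<kappa> * cos (\<kappa> * x + \<theta>) * amp 0 x + (\<Sum>m=1..N. amp m x * mode' m \<theta> x)"
    unfolding split by (subst sum.insert) (auto simp: mode'_0)
  then have "amp N x * wave' \<theta> x = amp N x * amp 0 x * \<kappa> * cos (\<kappa> * x + \<theta>)
      + (\<Sum>m=1..N. mode' m \<theta> x * amp (N + m) x) + (\<Sum>m\<le>N. amp N x * (mode m \<theta> x * amp' m x))"
    unfolding wave'_def sum.distrib amp_mult[symmetric]
    by (simp add: sum_distrib_left distrib_left mult_ac)
  then have 3: "amp N x * wave' \<theta> x = amp N x * \<kappa> * cos (\<kappa> * x + \<theta>)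
      + (\<Sum>m=1..N. mode' m \<theta> x * amp (N + m) x) + (\<Sum>m\<le>N. amp N x * (mode m \<theta> x * amp' m x))"
    by (simp add: amp_mult)
  have 4: "(amp N x)\<^sup>2 = amp (N + N) x" by (simp add: amp_mult power2_eq_square)
  have "residual \<theta> g x = (wave'' \<theta> x + \<kappa>\<^sup>2 * wave \<theta> x) - potential x * wave \<theta> x + 2 * g * (amp N x * wave' \<theta> x)
      + (g\<^sup>2 * (wave \<theta> x * (amp N x)\<^sup>2) + g * (wave \<theta> x * amp' N x))"
    by (simp add: residual_def algebra_simps)
  then show ?thesis unfolding 4 3 2 1 by (simp add: algebra_simps)
qed

end

context resonant_potential
begin

abbreviation cutoff :: real where
  "cutoff \<equiv> real (Suc N) * \<gamma>"

lemma amp_bigo: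
  assumes "c \<le> real m * \<gamma>"
  shows "amp m \<in> O(\<lambda>x. x powr (- c))"
proof (rule landau_o.bigI[of 1])
  show "\<forall>\<^sub>F x in at_top. norm (amp m x) \<le> 1 * norm (x powr (- c))"
    using eventually_ge_at_top[of 1]
    by eventually_elim (use assms in \<open>auto simp: amp_def intro!: powr_mono\<close>)
qed simp

lemma amp_bigo_1: "amp m \<in> O(\<lambda>_. 1)"
proof (rule landau_o.bigI[of 1])
  show "\<forall>\<^sub>F x in at_top. norm (amp m x) \<le> 1 * norm (1 :: real)"
    using eventually_ge_at_top[of 1]
  proof eventually_elim
    case (elim x)
    then have "x powr (- (real m * \<gamma>)) \<le> x powr 0" using \<gamma> by (intro powr_mono) auto
    then show ?case using elim by (simp add: amp_def)
  qed
qed simp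

text \<open>
  For \<open>m \<ge> 1\<close> the derivative gains a full power of \<open>x\<close>, which is worth \<open>N\<close> orders since \<open>N \<gamma> \<le> 1\<close>.
\<close>

lemma amp'_bigo: "amp' m \<in> O(\<lambda>x. x powr (- cutoff))"
proof (cases "m = 0")
  case True
  then show ?thesis by (simp add: amp'_def[abs_def])
next
  case False
  then have mg: "real m * \<gamma> \<ge> 1 * \<gamma>" using \<gamma> by (intro mult_right_mono) auto
  have e: "- (real m * \<gamma>) - 1 \<le> - (real (Suc N) * \<gamma>)"
    unfolding of_nat_Suc distrib_right using mg \<gamma>(2) by linarith
  show ?thesis
  proof (rule landau_o.bigI[of "real m * \<gamma>"])
    show "\<forall>\<^sub>F x in at_top. norm (amp' m x) \<le> real m * \<gamma> * norm (x powr (- cutoff))"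
      using eventually_ge_at_top[of 1]
    proof eventually_elim
      case (elim x)
      then have "x powr (- (real m * \<gamma>) - 1) \<le> x powr (- cutoff)" using e by (intro powr_mono) auto
      then show ?case using \<gamma> by (simp add: amp'_def abs_mult mult_left_mono)
    qed
  qed (use False \<gamma> in auto)
qed

lemma amp''_bigo: "amp'' m \<in> O(\<lambda>x. x powr (- cutoff))"
proof (cases "m = 0")
  case True
  then show ?thesis by (simp add: amp''_def[abs_def])
next
  case False
  then have mg: "real m * \<gamma> \<ge> 1 * \<gamma>" using \<gamma> by (intro mult_right_mono) auto
  have e: "- (real m * \<gamma>) - 2 \<le> - (real (Suc N) * \<gamma>)"
    unfolding of_nat_Suc distrib_right using mg \<gamma>(2) by linarith
  have pos: "real m * \<gamma> * (real m * \<gamma> + 1) > 0" using False \<gamma> by (intro mult_pos_pos) (auto intro: add_pos_pos)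
  show ?thesis
  proof (rule landau_o.bigI[OF pos])
    show "\<forall>\<^sub>F x in at_top. norm (amp'' m x) \<le> real m * \<gamma> * (real m * \<gamma> + 1) * norm (x powr (- cutoff))"
      using eventually_ge_at_top[of 1]
    proof eventually_elim
      case (elim x)
      then have "x powr (- (real m * \<gamma>) - 2) \<le> x powr (- cutoff)" using e by (intro powr_mono) auto
      then have "amp'' m x \<le> real m * \<gamma> * (real m * \<gamma> + 1) * x powr (- cutoff)"
        unfolding amp''_def using pos by (intro mult_left_mono) auto
      moreover have "amp'' m x \<ge> 0" unfolding amp''_def using less_imp_le[OF pos] by (rule mult_nonneg_nonneg) simp
      ultimately show ?case by simp
    qed
  qed
qed

lemma sin_cos_bigo_1: "(\<lambda>x. sin (a * x + b)) \<in> O(\<lambda>_. 1 :: real)" "(\<lambda>x. cos (a * x + b)) \<in> O(\<lambda>_. 1 :: real)"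
  by (auto intro!: landau_o.bigI[of 1])

lemma mode_bigo_1: "mode m \<theta> \<in> O(\<lambda>_. 1)"
  unfolding mode_def[abs_def] trig_def
  by (intro big_sum_in_bigo bounded_mult_in_bigo sin_cos_bigo_1) simp

lemma mode'_bigo_1: "mode' m \<theta> \<in> O(\<lambda>_. 1)"
  unfolding mode'_def[abs_def]
  by (intro big_sum_in_bigo bounded_mult_in_bigo sin_cos_bigo_1) simp_all

lemma osc_bigo_1: "osc \<in> O(\<lambda>_. 1)"
  unfolding osc_def[abs_def]
  by (intro big_sum_in_bigo bounded_mult_in_bigo sin_cos_bigo_1(2)[of _ 0, simplified]) simp_all

lemma wave_bigo_1: "wave \<theta> \<in> O(\<lambda>_. 1)"
  unfolding wave_def[abs_def]
  by (intro big_sum_in_bigo bounded_mult_in_bigo amp_bigo_1 mode_bigo_1)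

lemma overshoot_bigo: "overshoot \<theta> \<in> O(\<lambda>x. x powr (- cutoff))"
proof -
  have amp: "amp n \<in> O(\<lambda>x. x powr (- cutoff))" if "n \<ge> Suc N" for n
    by (rule amp_bigo) (use that \<gamma> in \<open>intro mult_right_mono; simp\<close>)
  show ?thesis
    unfolding overshoot_def[abs_def]
    by (intro sum_in_bigo big_sum_in_bigo bounded_mult_in_bigo osc_bigo_1 mode_bigo_1 amp) auto
qed

lemma residual_bigo:
  assumes "\<And>x. reflection * sin (\<theta> - \<kappa> * x) = 2 * g * \<kappa> * cos (\<kappa> * x + \<theta>)"
  shows "residual \<theta> g \<in> O(\<lambda>x. x powr (- cutoff))"
proof -
  have amp: "amp n \<in> O(\<lambda>x. x powr (- cutoff))" if "n \<ge> Suc N" for n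
    by (rule amp_bigo) (use that \<gamma> in \<open>intro mult_right_mono; simp\<close>)
  have const: "(\<lambda>_. c) \<in> O(\<lambda>_. 1 :: real)" for c :: real by simp
  show ?thesis
    unfolding residual_eq[OF assms, abs_def]
    using N
    by (intro sum_in_bigo big_sum_in_bigo bounded_mult_in_bigo[OF const] bounded_mult_in_bigo[OF mode_bigo_1]
        bounded_mult_in_bigo[OF mode'_bigo_1] bounded_mult_in_bigo[OF amp_bigo_1]
        bounded_mult_in_bigo[OF wave_bigo_1] amp amp'_bigo amp''_bigo overshoot_bigo) auto
qed

lemma amp_tendsto_0: "m \<ge> 1 \<Longrightarrow> (amp m \<longlongrightarrow> 0) at_top"
  using \<gamma> by (intro bigo_powr_tendsto_0[of _ "real m * \<gamma>"] amp_bigo) auto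

lemma bounded_times_null:
  fixes f g :: "real \<Rightarrow> real"
  assumes "f \<in> O(\<lambda>_. 1)" "(g \<longlongrightarrow> 0) at_top"
  shows "((\<lambda>x. f x * g x) \<longlongrightarrow> 0) at_top"
proof -
  have "g \<in> o(\<lambda>_. 1)" using assms(2) by (intro smalloI_tendsto) auto
  with assms(1) have "(\<lambda>x. f x * g x) \<in> o(\<lambda>_. 1 * 1)" by (rule landau_o.big_small_mult)
  then show ?thesis by (auto dest: smalloD_tendsto)
qed

lemma amp'_tendsto_0: "(amp' m \<longlongrightarrow> 0) at_top"
  by (rule bigo_powr_tendsto_0[OF amp'_bigo]) (use \<gamma> in auto)

lemma wave_asymp: "((\<lambda>x. wave \<theta> x - sin (\<kappa> * x + \<theta>)) \<longlongrightarrow> 0) at_top"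
proof -
  have "((\<lambda>x. \<Sum>m=1..N. mode m \<theta> x * amp m x) \<longlongrightarrow> 0) at_top"
    by (intro tendsto_null_sum bounded_times_null mode_bigo_1 amp_tendsto_0) auto
  moreover have "\<forall>\<^sub>F x in at_top. (\<Sum>m=1..N. mode m \<theta> x * amp m x) = wave \<theta> x - sin (\<kappa> * x + \<theta>)"
    using eventually_gt_at_top[of 0]
  proof eventually_elim
    case (elim x)
    have "{..N} = insert 0 {1..N}" by auto
    then show ?case unfolding wave_def using elim
      by (simp add: mode_0 mult.commute) (simp add: amp_def)
  qed
  ultimately show ?thesis by (rule Lim_transform_eventually)
qed

lemma wave'_asymp:
  "((\<lambda>x. wave' \<theta> x + g * amp N x * wave \<theta> x - \<kappa> * cos (\<kappa> * x + \<theta>)) \<longlongrightarrow> 0) at_top"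
proof -
  have "((\<lambda>x. g * (wave \<theta> x * amp N x)) \<longlongrightarrow> 0) at_top"
    using N by (intro tendsto_mult_right_zero bounded_times_null wave_bigo_1 amp_tendsto_0)
  moreover have "((\<lambda>x. \<Sum>m\<le>N. mode m \<theta> x * amp' m x) \<longlongrightarrow> 0) at_top"
    by (intro tendsto_null_sum bounded_times_null mode_bigo_1 amp'_tendsto_0)
  moreover have "((\<lambda>x. \<Sum>m=1..N. mode' m \<theta> x * amp m x) \<longlongrightarrow> 0) at_top"
    by (intro tendsto_null_sum bounded_times_null mode'_bigo_1 amp_tendsto_0) auto
  ultimately have "((\<lambda>x. (\<Sum>m=1..N. mode' m \<theta> x * amp m x) + (\<Sum>m\<le>N. mode m \<theta> x * amp' m x)
      + g * (wave \<theta> x * amp N x)) \<longlongrightarrow> 0) at_top"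
    by (intro tendsto_add_zero)
  moreover have "\<forall>\<^sub>F x in at_top. (\<Sum>m=1..N. mode' m \<theta> x * amp m x) + (\<Sum>m\<le>N. mode m \<theta> x * amp' m x)
      + g * (wave \<theta> x * amp N x) = wave' \<theta> x + g * amp N x * wave \<theta> x - \<kappa> * cos (\<kappa> * x + \<theta>)"
    using eventually_gt_at_top[of 0]
  proof eventually_elim
    case (elim x)
    have "{..N} = insert 0 {1..N}" by auto
    then have "(\<Sum>m\<le>N. amp m x * mode' m \<theta> x) = \<kappa> * cos (\<kappa> * x + \<theta>) + (\<Sum>m=1..N. mode' m \<theta> x * amp m x)"
      using elim by (simp add: mode'_0 mult.commute) (simp add: amp_def)
    then show ?case unfolding wave'_def sum.distrib by (simp add: mult_ac)
  qed
  ultimately show ?thesis by (rule Lim_transform_eventually)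
qed

lemma amp_continuous: "continuous_on {0<..} (amp m)" "continuous_on {0<..} (amp' m)" "continuous_on {0<..} (amp'' m)"
  unfolding amp_def[abs_def] amp'_def[abs_def] amp''_def[abs_def] by (intro continuous_intros; auto)+

lemma mode_continuous: "continuous_on A (mode m \<theta>)" "continuous_on A (mode' m \<theta>)" "continuous_on A (mode'' m \<theta>)"
  unfolding mode_def[abs_def] mode'_def[abs_def] mode''_def[abs_def] trig_def by (intro continuous_intros)+

lemma potential_continuous: "continuous_on {0<..} potential"
  unfolding potential_def[abs_def] correction_def osc_def
  by (intro continuous_intros amp_continuous)

lemma residual_continuous: "continuous_on {0<..} (residual \<theta> g)"
  unfolding residual_def[abs_def] wave_def wave'_def wave''_def
  by (intro continuous_intros amp_continuous mode_continuous potential_continuous)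

text \<open>
  A primitive of \<open>amp N\<close>; the two cases are those of \<open>decay_profile\<close>.
\<close>

definition exponent :: "real \<Rightarrow> real" where
  "exponent x = (if real N * \<gamma> = 1 then ln x else x powr (1 - real N * \<gamma>) / (1 - real N * \<gamma>))"

lemma exponent_deriv:
  assumes "x > 0"
  shows "(exponent has_real_derivative amp N x) (at x)"
proof (cases "real N * \<gamma> = 1")
  case True
  have "(ln has_real_derivative inverse x) (at x)" using assms by (rule DERIV_ln)
  moreover have "amp N x = inverse x" using assms unfolding amp_def True by (simp add: powr_minus)
  ultimately show ?thesis unfolding exponent_def[abs_def] using True by simp
next
  case False
  then have "((\<lambda>x. x powr (1 - real N * \<gamma>) / (1 - real N * \<gamma>)) has_real_derivative amp N x) (at x)"
    using assms unfolding amp_def by (auto intro!: derivative_eq_intros)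
  then show ?thesis unfolding exponent_def[abs_def] using False by simp
qed

lemma exponent_mono:
  assumes "0 < x" "x \<le> y"
  shows "exponent x \<le> exponent y"
proof (rule DERIV_nonneg_imp_nondecreasing[OF assms(2)])
  fix t assume "x \<le> t" "t \<le> y"
  then have "(exponent has_real_derivative amp N t) (at t)" using assms by (intro exponent_deriv) auto
  moreover have "amp N t \<ge> 0" by (simp add: amp_def)
  ultimately show "\<exists>d. (exponent has_real_derivative d) (at t) \<and> 0 \<le> d" by blast
qed

text \<open>
  For \<open>\<theta> = \<tau> \<pi> / 4\<close> with \<open>\<tau> = \<plusminus>1\<close> one has \<open>sin (\<theta> - \<kappa> x) = \<tau> cos (\<kappa> x + \<theta>)\<close>, so the resonant term is balanced
  by \<open>g = \<tau> \<rho> / (2\<kappa>)\<close>. The sign \<open>\<tau> = - sgn \<rho>\<close> gives the decaying approximate solution and the opposite sign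
  the growing one. Their leading parts differ in phase by \<open>\<pi> / 2\<close>, so the modulus of their Wronskian tends
  to \<open>\<kappa>\<close>.
\<close>

lemma decaying_resonant_solution:
  assumes "reflection \<noteq> 0"
  defines "\<theta> \<equiv> - sgn reflection * (pi / 4)" and "f \<equiv> \<lambda>x. exp (- (\<bar>reflection\<bar> / (2 * \<kappa>)) * exponent x)"
  shows "\<exists>X u v. X > 0 \<and>
    (\<forall>x\<ge>X. (u has_real_derivative v x) (at x) \<and> (v has_real_derivative (potential x - \<kappa>\<^sup>2) * u x) (at x)) \<and>
    ((\<lambda>x. u x / f x - sin (\<kappa> * x + \<theta>)) \<longlongrightarrow> 0) at_top \<and>
    ((\<lambda>x. v x / f x - \<kappa> * cos (\<kappa> * x + \<theta>)) \<longlongrightarrow> 0) at_top"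
proof -
  define b where "b = \<bar>reflection\<bar> / (2 * \<kappa>)"
  define s where "s = real (Suc N) * \<gamma>"
  define U where "U \<theta> g x = exp (g * exponent x) * wave \<theta> x" for \<theta> g x
  define slope where "slope \<theta> g x = wave' \<theta> x + g * amp N x * wave \<theta> x" for \<theta> g x
  define W where "W \<theta> g x = exp (g * exponent x) * slope \<theta> g x" for \<theta> g x
  have f: "f x = exp (- b * exponent x)" "1 / f x = exp (b * exponent x)" for x
    unfolding f_def b_def by (simp_all add: exp_minus field_simps)
  have fpos: "f x > 0" for x by (simp add: f_def)
  have dU: "(U \<theta> g has_real_derivative W \<theta> g x) (at x)" if "x > 0" for \<theta> g x
    unfolding U_def[abs_def] W_def slope_def
    by (auto intro!: derivative_eq_intros exponent_deriv wave_deriv that simp: algebra_simps)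
  have dW: "(W \<theta> g has_real_derivative (potential x - \<kappa>\<^sup>2) * U \<theta> g x + exp (g * exponent x) * residual \<theta> g x) (at x)"
    if "x > 0" for \<theta> g x
    unfolding U_def W_def[abs_def] slope_def residual_def
    by (auto intro!: derivative_eq_intros exponent_deriv wave_deriv wave'_deriv amp_deriv that
        simp: algebra_simps power2_eq_square)
  have balance: "reflection * sin (\<theta> - \<kappa> * x) = 2 * (- b) * \<kappa> * cos (\<kappa> * x + \<theta>)"
    "reflection * sin (- \<theta> - \<kappa> * x) = 2 * b * \<kappa> * cos (\<kappa> * x + - \<theta>)" for x
    using assms(1) \<kappa> unfolding \<theta>_def b_def
    by (auto simp: sgn_if sin_diff sin_add cos_add cos_diff sin_45 cos_45 algebra_simps)
  note res = residual_bigo[OF balance(1), folded s_def] residual_bigo[OF balance(2), folded s_def]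
  from res(1) obtain M1 where M1: "M1 > 0" "\<forall>\<^sub>F x in at_top. norm (residual \<theta> (- b) x) \<le> M1 * norm (x powr - s)"
    by (elim landau_o.bigE)
  from res(2) obtain M2 where M2: "M2 > 0" "\<forall>\<^sub>F x in at_top. norm (residual (- \<theta>) b x) \<le> M2 * norm (x powr - s)"
    by (elim landau_o.bigE)
  have wave_ev: "\<forall>\<^sub>F x in at_top. \<bar>wave \<theta> x\<bar> \<le> 2" for \<theta>
  proof -
    have "\<forall>\<^sub>F x in at_top. dist (wave \<theta> x - sin (\<kappa> * x + \<theta>)) 0 < 1"
      using wave_asymp by (rule tendstoD) simp
    then show ?thesis
    proof eventually_elim
      case (elim x)
      then show ?case using abs_sin_le_one[of "\<kappa> * x + \<theta>"] unfolding dist_real_def by linarith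
    qed
  qed
  have slope_ev: "\<forall>\<^sub>F x in at_top. \<bar>slope \<theta> g x\<bar> \<le> \<kappa> + 1" for \<theta> g
  proof -
    have "\<forall>\<^sub>F x in at_top. dist (slope \<theta> g x - \<kappa> * cos (\<kappa> * x + \<theta>)) 0 < 1"
      unfolding slope_def using wave'_asymp by (rule tendstoD) simp
    then show ?thesis
    proof eventually_elim
      case (elim x)
      have "\<bar>\<kappa> * cos (\<kappa> * x + \<theta>)\<bar> \<le> \<kappa> * 1"
        unfolding abs_mult using \<kappa> by (intro mult_mono) auto
      then show ?case using elim unfolding dist_real_def by linarith
    qed
  qed
  define wronskian where "wronskian x = wave \<theta> x * slope (- \<theta>) b x - slope \<theta> (- b) x * wave (- \<theta>) x" for x
  have wronskian_ev: "\<forall>\<^sub>F x in at_top. \<bar>wronskian x\<bar> \<ge> \<kappa> / 2"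
  proof -
    define free where "free x = sin (\<kappa> * x + \<theta>) * (\<kappa> * cos (\<kappa> * x + - \<theta>))
        - \<kappa> * cos (\<kappa> * x + \<theta>) * sin (\<kappa> * x + - \<theta>)" for x
    have "((\<lambda>x. wronskian x - free x) \<longlongrightarrow> 0) at_top"
    proof -
      have bd: "slope \<theta> g \<in> O(\<lambda>_. 1)" for \<theta> g
        using slope_ev[of \<theta> g] \<kappa> by (intro landau_o.bigI[of "\<kappa> + 1"]) auto
      have "((\<lambda>x. slope (- \<theta>) b x * (wave \<theta> x - sin (\<kappa> * x + \<theta>))
          + sin (\<kappa> * x + \<theta>) * (slope (- \<theta>) b x - \<kappa> * cos (\<kappa> * x + - \<theta>))
          - (slope \<theta> (- b) x * (wave (- \<theta>) x - sin (\<kappa> * x + - \<theta>))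
          + sin (\<kappa> * x + - \<theta>) * (slope \<theta> (- b) x - \<kappa> * cos (\<kappa> * x + \<theta>)))) \<longlongrightarrow> 0 + 0 - (0 + 0)) at_top"
        by (intro tendsto_add tendsto_diff bounded_times_null bd sin_cos_bigo_1 wave_asymp
            wave'_asymp[of _ b, folded slope_def] wave'_asymp[of _ "- b", folded slope_def])
      then show ?thesis by (simp add: wronskian_def free_def algebra_simps)
    qed
    then have "\<forall>\<^sub>F x in at_top. dist (wronskian x - free x) 0 < \<kappa> / 2"
      by (rule tendstoD) (use \<kappa> in simp)
    then show ?thesis
    proof eventually_elim
      case (elim x)
      have "free x = \<kappa> * sin ((\<kappa> * x + \<theta>) - (\<kappa> * x + - \<theta>))"
        unfolding free_def sin_diff by (simp add: algebra_simps)
      also have "(\<kappa> * x + \<theta>) - (\<kappa> * x + - \<theta>) = - sgn reflection * (pi / 2)" by (simp add: \<theta>_def)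
      also have "\<bar>\<kappa> * sin (- sgn reflection * (pi / 2))\<bar> = \<kappa>"
        using assms(1) \<kappa> by (auto simp: sgn_if)
      finally have "\<bar>free x\<bar> = \<kappa>" .
      then show ?case using elim unfolding dist_real_def by linarith
    qed
  qed
  define M where "M = Max {M1, M2, 2, \<kappa> + 1}"
  have M: "M1 \<le> M" "M2 \<le> M" "2 \<le> M" "\<kappa> + 1 \<le> M" unfolding M_def by auto
  have "\<forall>\<^sub>F x in at_top. x > 0 \<and> \<bar>residual \<theta> (- b) x\<bar> \<le> M1 * x powr - s
      \<and> \<bar>residual (- \<theta>) b x\<bar> \<le> M2 * x powr - s \<and> \<bar>wave \<theta> x\<bar> \<le> 2 \<and> \<bar>wave (- \<theta>) x\<bar> \<le> 2
      \<and> \<bar>slope \<theta> (- b) x\<bar> \<le> \<kappa> + 1 \<and> \<bar>slope (- \<theta>) b x\<bar> \<le> \<kappa> + 1 \<and> \<bar>wronskian x\<bar> \<ge> \<kappa> / 2"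
    (is "\<forall>\<^sub>F x in at_top. ?good x")
    using eventually_gt_at_top[of 0] M1(2) M2(2) wave_ev[of \<theta>] wave_ev[of "- \<theta>"] slope_ev[of \<theta> "- b"]
      slope_ev[of "- \<theta>" b] wronskian_ev
    by eventually_elim auto
  then obtain X0 where X0: "\<And>x. x \<ge> X0 \<Longrightarrow> ?good x"
    unfolding eventually_at_top_linorder by blast
  have X0pos: "X0 > 0" using X0[of X0] by simp
  have sub: "{X0..} \<subseteq> {0<..}" using X0pos by auto
  have bpos: "b > 0" using assms(1) \<kappa> by (simp add: b_def)
  have "\<exists>X u v. X \<ge> X0 \<and>
    (\<forall>x\<ge>X. (u has_real_derivative v x) (at x) \<and> (v has_real_derivative (potential x - \<kappa>\<^sup>2) * u x) (at x)) \<and>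
    ((\<lambda>x. (u x - U \<theta> (- b) x) / f x) \<longlongrightarrow> 0) at_top \<and> ((\<lambda>x. (v x - W \<theta> (- b) x) / f x) \<longlongrightarrow> 0) at_top"
  proof (rule perturbed_decaying_solution[where s = s and M = M and ?w0.0 = "\<kappa> / 2"
        and ?u2.0 = "U (- \<theta>) b" and ?v2.0 = "W (- \<theta>) b" and ?e1.0 = "residual \<theta> (- b)" and ?e2.0 = "residual (- \<theta>) b"])
    show "X0 > 0" by (rule X0pos)
    show "s > 1" using \<gamma> by (simp add: s_def)
    show "\<kappa> / 2 > 0" using \<kappa> by simp
    show "continuous_on {X0..} f"
      unfolding f_def using X0pos
      by (intro continuous_intros continuous_at_imp_continuous_on ballI DERIV_isCont[OF exponent_deriv]) auto
    show "continuous_on {X0..} (residual \<theta> (- b))" "continuous_on {X0..} (residual (- \<theta>) b)"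
      by (rule continuous_on_subset[OF residual_continuous sub])+
    show "f y \<le> f x" if "X0 \<le> x" "x \<le> y" for x y
      using exponent_mono[of x y] X0pos that bpos by (simp add: f)
    fix x assume x: "x \<ge> X0"
    note * = X0[OF x]
    show "f x > 0" by (rule fpos)
    show "(U \<theta> (- b) has_real_derivative W \<theta> (- b) x) (at x)" "(U (- \<theta>) b has_real_derivative W (- \<theta>) b x) (at x)"
      using dU * by auto
    have e: "exp (- b * exponent x) = f x" "exp (b * exponent x) = 1 / f x" using f[of x] by simp_all
    show "(W \<theta> (- b) has_real_derivative (potential x - \<kappa>\<^sup>2) * U \<theta> (- b) x + f x * residual \<theta> (- b) x) (at x)"
      using dW[of x \<theta> "- b"] * by (simp add: f)
    show "(W (- \<theta>) b has_real_derivative (potential x - \<kappa>\<^sup>2) * U (- \<theta>) b x + residual (- \<theta>) b x / f x) (at x)"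
      using dW[of x "- \<theta>" b] * unfolding e by simp
    show "\<bar>U \<theta> (- b) x\<bar> \<le> M * f x" "\<bar>W \<theta> (- b) x\<bar> \<le> M * f x"
    proof -
      have "\<bar>f x * a\<bar> \<le> M * f x" if "\<bar>a\<bar> \<le> M" for a
        using mult_right_mono[OF that less_imp_le[OF fpos[of x]]] fpos[of x]
        by (simp only: abs_mult abs_of_pos mult.commute[of "f x"])
      then show "\<bar>U \<theta> (- b) x\<bar> \<le> M * f x" "\<bar>W \<theta> (- b) x\<bar> \<le> M * f x"
        unfolding U_def W_def e using * M by (meson order_trans)+
    qed
    show "\<bar>U (- \<theta>) b x\<bar> \<le> M / f x" "\<bar>W (- \<theta>) b x\<bar> \<le> M / f x"
    proof -
      have "\<bar>1 / f x * a\<bar> \<le> M / f x" if "\<bar>a\<bar> \<le> M" for a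
        using divide_right_mono[OF that less_imp_le[OF fpos[of x]]] fpos[of x] by (simp add: abs_mult)
      then show "\<bar>U (- \<theta>) b x\<bar> \<le> M / f x" "\<bar>W (- \<theta>) b x\<bar> \<le> M / f x"
        unfolding U_def W_def e using * M by (meson order_trans)+
    qed
    have "M1 * x powr - s \<le> M * x powr - s" "M2 * x powr - s \<le> M * x powr - s"
      by (intro mult_right_mono M; simp)+
    then show "\<bar>residual \<theta> (- b) x\<bar> \<le> M * x powr - s" "\<bar>residual (- \<theta>) b x\<bar> \<le> M * x powr - s"
      using * by linarith+
    have "U \<theta> (- b) x * W (- \<theta>) b x - W \<theta> (- b) x * U (- \<theta>) b x = wronskian x"
    proof -
      have "(a * p) * (c * q) - (a * r) * (c * t) = (a * c) * (p * q - r * t)" for a c p q r t :: real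
        by (simp add: algebra_simps)
      moreover have "f x * (1 / f x) = 1" using fpos[of x] by simp
      ultimately show ?thesis unfolding U_def W_def e wronskian_def by (simp only: mult_1)
    qed
    then show "\<kappa> / 2 \<le> \<bar>U \<theta> (- b) x * W (- \<theta>) b x - W \<theta> (- b) x * U (- \<theta>) b x\<bar>" using * by simp
  qed
  then obtain X u v where uv: "X \<ge> X0"
    "\<forall>x\<ge>X. (u has_real_derivative v x) (at x) \<and> (v has_real_derivative (potential x - \<kappa>\<^sup>2) * u x) (at x)"
    "((\<lambda>x. (u x - U \<theta> (- b) x) / f x) \<longlongrightarrow> 0) at_top" "((\<lambda>x. (v x - W \<theta> (- b) x) / f x) \<longlongrightarrow> 0) at_top"
    by blast
  have "((\<lambda>x. (u x - U \<theta> (- b) x) / f x + (wave \<theta> x - sin (\<kappa> * x + \<theta>))) \<longlongrightarrow> 0) at_top"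
    by (intro tendsto_add_zero uv wave_asymp)
  moreover have "(u x - U \<theta> (- b) x) / f x + (wave \<theta> x - sin (\<kappa> * x + \<theta>)) = u x / f x - sin (\<kappa> * x + \<theta>)" for x
    using fpos[of x] f(1)[of x] by (simp add: U_def diff_divide_distrib)
  ultimately have 1: "((\<lambda>x. u x / f x - sin (\<kappa> * x + \<theta>)) \<longlongrightarrow> 0) at_top" by simp
  have "((\<lambda>x. (v x - W \<theta> (- b) x) / f x + (slope \<theta> (- b) x - \<kappa> * cos (\<kappa> * x + \<theta>))) \<longlongrightarrow> 0) at_top"
    by (intro tendsto_add_zero uv wave'_asymp[of _ "- b", folded slope_def])
  moreover have "(v x - W \<theta> (- b) x) / f x + (slope \<theta> (- b) x - \<kappa> * cos (\<kappa> * x + \<theta>)) = v x / f x - \<kappa> * cos (\<kappa> * x + \<theta>)" for x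
    using fpos[of x] f(1)[of x] by (simp add: W_def diff_divide_distrib)
  ultimately have 2: "((\<lambda>x. v x / f x - \<kappa> * cos (\<kappa> * x + \<theta>)) \<longlongrightarrow> 0) at_top" by simp
  have "X > 0" using uv(1) X0pos by simp
  with uv(2) 1 2 show ?thesis by blast
qed

end

section \<open>Absolute continuity of indefinite integrals\<close>

text \<open>
  Lebesgue's differentiation theorem in dimension one. The averages over \<open>[x, x + h]\<close> give the right
  derivative; the left one is obtained from the reflected function.
\<close>

lemma indefinite_integral_has_real_derivative_AE:
  fixes F :: "real \<Rightarrow> real"
  assumes F: "\<And>b. F absolutely_integrable_on {0..b}"
  shows "AE x\<in>{0<..} in lebesgue. ((\<lambda>x. integral {0..x} F) has_real_derivative F x) (at x)"
proof -
  define f where "f x = (if x \<ge> 0 then F x else 0)" for x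
  define f' where "f' x = f (- x)" for x
  have fint: "f integrable_on {a..b}" for a b
  proof -
    have "F integrable_on {0..b}" using F by (simp add: absolutely_integrable_on_def)
    then have "(\<lambda>x. if x \<in> {0..b} then F x else 0) integrable_on UNIV"
      by (simp only: integrable_restrict_UNIV)
    then have "(\<lambda>x. if x \<in> {0..b} then F x else 0) integrable_on {a..b}"
      by (rule integrable_on_subinterval) auto
    then show ?thesis by (rule integrable_eq) (auto simp: f_def)
  qed
  have f'int: "f' integrable_on {a..b}" for a b
    using fint[of "- b" "- a"] Henstock_Kurzweil_Integration.integrable_reflect_real[where f = f and a = "- b" and b = "- a"]
    unfolding f'_def[abs_def] by (simp only: minus_minus)
  obtain N where N: "negligible N" "\<And>x e. x \<notin> N \<Longrightarrow> 0 < e \<Longrightarrow>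
      \<exists>d>0. \<forall>h. 0 < h \<and> h < d \<longrightarrow> norm (integral (cbox x (x + h *\<^sub>R One)) f /\<^sub>R h ^ DIM(real) - f x) < e"
    by (rule integrable_ccontinuous_explicit[of f]) (use fint in auto)
  obtain N' where N': "negligible N'" "\<And>x e. x \<notin> N' \<Longrightarrow> 0 < e \<Longrightarrow>
      \<exists>d>0. \<forall>h. 0 < h \<and> h < d \<longrightarrow> norm (integral (cbox x (x + h *\<^sub>R One)) f' /\<^sub>R h ^ DIM(real) - f' x) < e"
    by (rule integrable_ccontinuous_explicit[of f']) (use f'int in auto)
  have main: "((\<lambda>x. integral {0..x} F) has_real_derivative F x) (at x)"
    if x: "x > 0" "x \<notin> N" "- x \<notin> N'" for x
  proof -
    let ?I = "\<lambda>x. integral {0..x} F"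
    have If: "?I y = integral {0..y} f" for y by (rule integral_cong) (auto simp: f_def)
    have "((\<lambda>y. (?I y - ?I x) / (y - x)) \<longlongrightarrow> F x) (at x)"
      unfolding LIM_def
    proof (intro allI impI)
      fix e :: real assume e: "e > 0"
      from N(2)[OF x(2) e] obtain d where d: "d > 0"
        "\<And>h. 0 < h \<Longrightarrow> h < d \<Longrightarrow> \<bar>integral {x..x + h} f / h - f x\<bar> < e"
        by (auto simp: divide_inverse mult.commute)
      from N'(2)[OF x(3) e] obtain d' where d': "d' > 0"
        "\<And>h. 0 < h \<Longrightarrow> h < d' \<Longrightarrow> \<bar>integral {- x..- x + h} f' / h - f' (- x)\<bar> < e"
        by (auto simp: divide_inverse mult.commute)
      have "dist ((?I y - ?I x) / (y - x)) (F x) < e"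
        if y: "y \<noteq> x" "dist y x < min (min d d') x" for y
      proof (cases "y > x")
        case True
        have "?I y - ?I x = integral {x..y} f"
          using Henstock_Kurzweil_Integration.integral_combine[of 0 x y f] fint True x by (simp add: If)
        moreover have "\<bar>integral {x..x + (y - x)} f / (y - x) - f x\<bar> < e"
          using d(2)[of "y - x"] True y by (auto simp: dist_real_def)
        ultimately show ?thesis using x by (simp add: dist_real_def f_def)
      next
        case False
        then have yx: "y < x" "y > 0" using y by (auto simp: dist_real_def)
        have "?I x - ?I y = integral {y..x} f"
          using Henstock_Kurzweil_Integration.integral_combine[of 0 y x f] fint yx by (simp add: If)
        also have "\<dots> = integral {- x..- y} f'"
          using Henstock_Kurzweil_Integration.integral_reflect_real[where f = f and a = y and b = x] by (simp only: f'_def[abs_def])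
        finally have "?I x - ?I y = integral {- x..- y} f'" .
        moreover have "\<bar>integral {- x..- x + (x - y)} f' / (x - y) - f' (- x)\<bar> < e"
          using d'(2)[of "x - y"] yx y by (auto simp: dist_real_def)
        moreover have "(?I y - ?I x) / (y - x) = (?I x - ?I y) / (x - y)"
          using minus_divide_divide[of "?I x - ?I y" "x - y"] by simp
        ultimately show ?thesis using x by (simp add: dist_real_def f_def f'_def)
      qed
      then show "\<exists>s>0. \<forall>y. y \<noteq> x \<and> dist y x < s \<longrightarrow> dist ((?I y - ?I x) / (y - x)) (F x) < e"
        using d(1) d'(1) x(1)
        by (intro exI[of _ "min (min d d') x"]) auto
    qed
    then show ?thesis by (simp add: has_field_derivative_iff)
  qed
  have "negligible (N \<union> uminus ` N')"
    using N(1) negligible_differentiable_image_negligible[OF _ N'(1), of uminus]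
    by (auto intro!: negligible_Un differentiable_on_minus)
  then have "N \<union> uminus ` N' \<in> null_sets lebesgue" by (simp add: negligible_iff_null_sets)
  from AE_not_in[OF this] show ?thesis
  proof eventually_elim
    case (elim x)
    then have "x \<notin> N" "- x \<notin> N'" by (auto simp: image_iff)
    with main show ?case by simp
  qed
qed

text \<open>
  Truncate \<open>|F|\<close> at a height \<open>n\<close> where the excess has integral less than \<open>e / 2\<close>; the truncated part is at most
  \<open>n\<close> times the total length.
\<close>

lemma absolute_continuity_of_integral:
  fixes F :: "real \<Rightarrow> real"
  assumes F: "F absolutely_integrable_on {0..b}" and e: "e > 0"
  shows "\<exists>d>0. \<forall>D T. D division_of T \<and> T \<subseteq> {0..b} \<and> (\<Sum>I\<in>D. Sup I - Inf I) < d \<longrightarrow>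
    (\<Sum>I\<in>D. integral I (\<lambda>x. \<bar>F x\<bar>)) < e"
proof -
  have aF: "(\<lambda>x. \<bar>F x\<bar>) absolutely_integrable_on {0..b}"
    using absolutely_integrable_norm[OF F] by (simp add: o_def)
  then have aFi: "(\<lambda>x. \<bar>F x\<bar>) integrable_on {0..b}" by (simp add: absolutely_integrable_on_def)
  define m where "m n x = min \<bar>F x\<bar> (real n)" for n :: nat and x
  have mi: "m n integrable_on {0..b}" for n
  proof -
    have "(\<lambda>x. min \<bar>F x\<bar> (real n)) absolutely_integrable_on {0..b}"
      using absolutely_integrable_min[OF aF, of "\<lambda>_. real n"]
      by (simp add: absolutely_integrable_continuous_real)
    then show ?thesis by (simp add: absolutely_integrable_on_def m_def[abs_def])
  qed
  have "(\<lambda>n. integral {0..b} (m n)) \<longlonglongrightarrow> integral {0..b} (\<lambda>x. \<bar>F x\<bar>)"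
  proof (rule dominated_convergence(2)[OF mi aFi])
    show "norm (m k x) \<le> \<bar>F x\<bar>" for k x by (auto simp: m_def)
    show "(\<lambda>k. m k x) \<longlonglongrightarrow> \<bar>F x\<bar>" for x
    proof (rule tendsto_eventually)
      obtain n0 :: nat where "\<bar>F x\<bar> \<le> real n0" using real_arch_simple by blast
      then show "\<forall>\<^sub>F k in sequentially. m k x = \<bar>F x\<bar>"
        by (intro eventually_sequentiallyI[of n0]) (auto simp: m_def)
    qed
  qed
  then have "\<forall>\<^sub>F n in sequentially. integral {0..b} (m n) > integral {0..b} (\<lambda>x. \<bar>F x\<bar>) - e / 2"
    by (rule order_tendstoD) (use e in auto)
  then obtain n where n: "integral {0..b} (m n) > integral {0..b} (\<lambda>x. \<bar>F x\<bar>) - e / 2"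
    by (auto simp: eventually_sequentially)
  define r where "r x = \<bar>F x\<bar> - m n x" for x
  have ri: "r integrable_on {0..b}" unfolding r_def by (intro integrable_diff aFi mi)
  have rnn: "r x \<ge> 0" for x by (simp add: r_def m_def)
  have rI: "integral {0..b} r < e / 2"
    unfolding r_def using n by (subst integral_diff[OF aFi mi]) auto
  show ?thesis
  proof (intro exI[of _ "e / (2 * (real n + 1))"] conjI allI impI)
    show "e / (2 * (real n + 1)) > 0" using e by auto
    fix D T assume *: "D division_of T \<and> T \<subseteq> {0..b} \<and> (\<Sum>I\<in>D. Sup I - Inf I) < e / (2 * (real n + 1))"
    then have D: "D division_of T" and T: "T \<subseteq> {0..b}" by auto
    have I: "integral I (\<lambda>x. \<bar>F x\<bar>) \<le> integral I r + real n * (Sup I - Inf I)" if "I \<in> D" for I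
    proof -
      from division_ofD(4)[OF D that] division_ofD(3)[OF D that] obtain a c where
        ac: "I = {a..c}" "a \<le> c" by fastforce
      have "I \<subseteq> {0..b}" using division_ofD(2)[OF D that] T by auto
      then have int: "r integrable_on I" "(\<lambda>x. \<bar>F x\<bar>) integrable_on I"
        using ri aFi ac integrable_on_subinterval by blast+
      have "integral I (\<lambda>x. \<bar>F x\<bar>) \<le> integral I (\<lambda>x. r x + real n)"
      proof (rule integral_le[OF int(2)])
        show "(\<lambda>x. r x + real n) integrable_on I"
          by (intro integrable_add int) (auto simp: ac)
      qed (auto simp: r_def m_def)
      also have "\<dots> = integral I r + real n * (Sup I - Inf I)"
        by (subst integral_add) (use int ac in auto)
      finally show ?thesis .
    qed
    have Dr: "(r has_integral (\<Sum>I\<in>D. integral I r)) T"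
      by (rule has_integral_combine_division_topdown[OF ri D T])
    have "(\<Sum>I\<in>D. integral I r) \<le> integral {0..b} r"
      using integral_subset_le[OF T has_integral_integrable[OF Dr] ri] rnn
      unfolding integral_unique[OF Dr] by blast
    moreover have "(\<Sum>I\<in>D. integral I (\<lambda>x. \<bar>F x\<bar>)) \<le> (\<Sum>I\<in>D. integral I r + real n * (Sup I - Inf I))"
      by (rule sum_mono) (rule I)
    moreover have "\<dots> = (\<Sum>I\<in>D. integral I r) + real n * (\<Sum>I\<in>D. Sup I - Inf I)"
      by (simp add: sum.distrib sum_distrib_left)
    moreover have "real n * (\<Sum>I\<in>D. Sup I - Inf I) \<le> real n * (e / (2 * (real n + 1)))"
      using * by (intro mult_left_mono) auto
    moreover have "real n * (e / (2 * (real n + 1))) \<le> e / 2" using e by (simp add: field_simps)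
    ultimately show "(\<Sum>I\<in>D. integral I (\<lambda>x. \<bar>F x\<bar>)) < e" using rI by linarith
  qed
qed

text \<open>
  The function \<open>g\<close> is allowed to be vector valued: on the half-line it will be \<open>f\<close> followed by the
  isometric embedding of the reals.
\<close>

lemma AC_loc_indefinite_integral:
  fixes f F :: "real \<Rightarrow> real"
  assumes F: "\<And>b. F absolutely_integrable_on {0..b}"
    and f: "\<And>x. x \<ge> 0 \<Longrightarrow> f x = c + integral {0..x} F"
    and g: "\<And>x y. x \<ge> 0 \<Longrightarrow> y \<ge> 0 \<Longrightarrow> norm (g y - g x) = \<bar>f y - f x\<bar>"
  shows "AC_loc g"
  unfolding AC_loc_def abs_continuous_on_interval_def
proof (intro allI impI)
  fix b e :: real assume "b \<ge> 0" "e > 0"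
  obtain d where d: "d > 0" "\<And>D T. D division_of T \<and> T \<subseteq> {0..b} \<and> (\<Sum>I\<in>D. Sup I - Inf I) < d \<Longrightarrow>
    (\<Sum>I\<in>D. integral I (\<lambda>x. \<bar>F x\<bar>)) < e"
    using absolute_continuity_of_integral[OF F \<open>e > 0\<close>, of b] by blast
  have "(\<Sum>I\<in>D. norm (g (Sup I) - g (Inf I))) < e"
    if *: "D division_of T \<and> T \<subseteq> {0..b} \<and> (\<Sum>I\<in>D. Sup I - Inf I) < d" for D T
  proof -
    have "norm (g (Sup I) - g (Inf I)) \<le> integral I (\<lambda>x. \<bar>F x\<bar>)" if "I \<in> D" for I
    proof -
      from division_ofD(4)[of D T I] division_ofD(3)[of D T I] that * obtain a c where
        ac: "I = {a..c}" "a \<le> c" by fastforce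
      have "I \<subseteq> {0..b}" using division_ofD(2)[of D T I] that * by auto
      then have ac0: "0 \<le> a" "c \<le> b" using ac by auto
      have int: "F integrable_on {0..c}" "F absolutely_integrable_on {a..c}"
        using F absolutely_integrable_on_subinterval[OF F[of c], of a c] ac0
        by (auto simp: absolutely_integrable_on_def)
      have "f c - f a = integral {a..c} F"
        using Henstock_Kurzweil_Integration.integral_combine[OF ac0(1) ac(2) int(1)] f ac ac0 by simp
      also have "\<bar>\<dots>\<bar> \<le> integral {a..c} (\<lambda>x. \<bar>F x\<bar>)"
        using int(2) integral_norm_bound_integral[of F "{a..c}" "\<lambda>x. \<bar>F x\<bar>"]
        by (auto simp: absolutely_integrable_on_def)
      finally show ?thesis using g[of a c] ac ac0 by simp
    qed
    then have "(\<Sum>I\<in>D. norm (g (Sup I) - g (Inf I))) \<le> (\<Sum>I\<in>D. integral I (\<lambda>x. \<bar>F x\<bar>))"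
      by (rule sum_mono)
    also have "\<dots> < e" using d(2) * by blast
    finally show ?thesis .
  qed
  then show "\<exists>d>0. \<forall>D T. D division_of T \<and> T \<subseteq> {0..b} \<and> (\<Sum>I\<in>D. Sup I - Inf I) < d \<longrightarrow>
        (\<Sum>I\<in>D. norm (g (Sup I) - g (Inf I))) < e"
    by (intro exI[of _ d] conjI d(1) allI impI)
qed

lemma at_within_half_line_not_bot:
  assumes "x \<ge> (0::real)"
  shows "at x within {0..} \<noteq> bot"
proof (cases "x = 0")
  case True
  then show ?thesis by (simp add: at_within_Ici_at_right)
next
  case False
  then have "at x within {0..} = at x"
    using assms by (intro at_within_interior) (auto simp: interior_Ici[of _ "-1"])
  then show ?thesis by simp
qed

section \<open>Continuation to the regular endpoint\<close>

lemma absolutely_integrable_continuous_mult: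
  fixes f g :: "real \<Rightarrow> real"
  assumes "continuous_on {a..b} f" "g absolutely_integrable_on {a..b}"
  shows "(\<lambda>x. f x * g x) absolutely_integrable_on {a..b}"
proof (rule absolutely_integrable_bounded_measurable_product_real)
  show "f \<in> borel_measurable (lebesgue_on {a..b})"
    by (intro continuous_imp_measurable_on_sets_lebesgue assms) auto
  show "bounded (f ` {a..b})"
    by (intro compact_imp_bounded compact_continuous_image assms) auto
qed (use assms in auto)

text \<open>
  Stated for functions of the form \<open>of_real (U x)\<close> in order to serve both for the real solution and for the
  complex eigenfunction.
\<close>

lemma integral_representation_solves_equation:
  fixes V U v :: "real \<Rightarrow> real" and E :: real
  assumes V: "\<And>b. V absolutely_integrable_on {0..b}"
    and Uc: "continuous_on {0..} U" and vc: "continuous_on {0..} v"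
    and U: "\<And>x. x \<ge> 0 \<Longrightarrow> U x = U 0 + integral {0..x} v"
    and v: "\<And>x. x \<ge> 0 \<Longrightarrow> v x = v 0 + integral {0..x} (\<lambda>t. U t * (V t - E))"
  defines "u \<equiv> \<lambda>x. of_real (U x) :: 'a :: real_normed_algebra_1"
  shows "AC1_loc u" and "\<And>x. x \<ge> 0 \<Longrightarrow> hderiv u x = of_real (v x)"
    and "AE x\<in>{0<..} in lebesgue. schroedinger_expr V u x = of_real E * u x"
proof -
  have vi: "v absolutely_integrable_on {0..b}" for b
    by (intro absolutely_integrable_continuous_real continuous_on_subset[OF vc]) auto
  have VEi: "(\<lambda>t. U t * (V t - E)) absolutely_integrable_on {0..b}" for b
    by (intro absolutely_integrable_continuous_mult continuous_on_subset[OF Uc] set_integral_diff V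
       absolutely_integrable_continuous_real) auto
  have dU: "(U has_vector_derivative v x) (at x within {0..})" if x: "x \<ge> 0" for x
  proof -
    have "continuous_on {0..x + 1} v" by (rule continuous_on_subset[OF vc]) auto
    then have "((\<lambda>y. integral {0..y} v) has_vector_derivative v x) (at x within {0..x + 1})"
      by (rule integral_has_vector_derivative) (use x in auto)
    from has_vector_derivative_add[OF has_vector_derivative_const this, of "U 0"]
    have "((\<lambda>y. U 0 + integral {0..y} v) has_vector_derivative v x) (at x within {0..x + 1})" by simp
    then have "(U has_vector_derivative v x) (at x within {0..x + 1})"
    proof (rule has_vector_derivative_transform_within[of _ _ _ _ 1])
      show "U 0 + integral {0..y} v = U y" if "y \<in> {0..x + 1}" for y using U[of y] that by simp
    qed (use x in auto)
    moreover have "at x within {0..x + 1} = at x within {0..}"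
      by (rule at_within_nhd[of _ "{..<x + 1}"]) (use x in auto)
    ultimately show ?thesis by simp
  qed
  have du: "(u has_vector_derivative of_real (v x)) (at x within {0..})" if x: "x \<ge> 0" for x
    using bounded_linear.has_vector_derivative[OF bounded_linear_of_real dU[OF x]]
    by (simp add: u_def)
  show hu: "hderiv u x = of_real (v x)" if "x \<ge> 0" for x
    unfolding hderiv_def by (rule vector_derivative_within[OF at_within_half_line_not_bot[OF that] du[OF that]])
  have "AC_loc u"
    by (rule AC_loc_indefinite_integral[OF vi U]) (auto simp: u_def simp flip: of_real_diff)
  moreover have "AC_loc (hderiv u)"
    by (rule AC_loc_indefinite_integral[OF VEi v]) (auto simp: hu simp flip: of_real_diff)
  moreover have "u differentiable (at x within {0..})" if "x \<ge> 0" for x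
    using du[OF that] by (rule differentiableI_vector)
  ultimately show "AC1_loc u" by (simp add: AC1_loc_def)
  show "AE x\<in>{0<..} in lebesgue. schroedinger_expr V u x = of_real E * u x"
    using indefinite_integral_has_real_derivative_AE[OF VEi]
  proof (rule AE_mp, intro AE_I2 impI)
    fix x :: real
    assume D: "x \<in> {0<..} \<longrightarrow> ((\<lambda>x. integral {0..x} (\<lambda>t. U t * (V t - E))) has_real_derivative U x * (V x - E)) (at x)"
      and "x \<in> {0<..}"
    then have x: "x > 0" by simp
    have at: "at x within {0..} = at x"
      using x by (intro at_within_interior) (auto simp: interior_Ici[of _ "-1"])
    have "((\<lambda>x. v 0 + integral {0..x} (\<lambda>t. U t * (V t - E))) has_real_derivative U x * (V x - E)) (at x)"
      using D x by (auto intro!: derivative_eq_intros)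
    then have "(v has_real_derivative U x * (V x - E)) (at x)"
    proof (rule has_field_derivative_transform_within_open[of _ _ _ "{0<..}"])
      show "v 0 + integral {0..y} (\<lambda>t. U t * (V t - E)) = v y" if "y \<in> {0<..}" for y
        using v[of y] that by simp
    qed (use x in auto)
    then have "((\<lambda>x. of_real (v x) :: 'a) has_vector_derivative of_real (U x * (V x - E))) (at x)"
      by (intro bounded_linear.has_vector_derivative[OF bounded_linear_of_real])
        (simp add: has_real_derivative_iff_has_vector_derivative)
    then have "(hderiv u has_vector_derivative of_real (U x * (V x - E))) (at x)"
      by (rule has_vector_derivative_transform_within_open[of _ _ _ "{0<..}"]) (use x hu in auto)
    then have "hderiv (hderiv u) x = of_real (U x * (V x - E))"
      unfolding hderiv_def[of "hderiv u"] at by (rule vector_derivative_at)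
    then show "schroedinger_expr V u x = of_real E * u x"
      unfolding schroedinger_expr_def u_def scaleR_conv_of_real
      by (simp add: algebra_simps flip: of_real_mult of_real_minus of_real_add)
  qed
qed

lemma integral_exp_decreasing_le:
  fixes c :: real
  assumes "c > 0" "t \<le> X"
  shows "(\<lambda>s. exp (c * (X - s))) integrable_on {t..X}"
    and "integral {t..X} (\<lambda>s. exp (c * (X - s))) \<le> exp (c * (X - t)) / c"
proof -
  have "((\<lambda>s. exp (c * (X - s))) has_integral (- exp (c * (X - X)) / c) - (- exp (c * (X - t)) / c)) {t..X}"
    by (rule fundamental_theorem_of_calculus[OF assms(2)])
      (use assms in \<open>auto intro!: derivative_eq_intros simp flip: has_real_derivative_iff_has_vector_derivative\<close>)
  then have I: "((\<lambda>s. exp (c * (X - s))) has_integral exp (c * (X - t)) / c - 1 / c) {t..X}" by simp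
  from I show "(\<lambda>s. exp (c * (X - s))) integrable_on {t..X}" by (auto simp: integrable_on_def)
  show "integral {t..X} (\<lambda>s. exp (c * (X - s))) \<le> exp (c * (X - t)) / c"
    unfolding integral_unique[OF I] using assms by simp
qed

text \<open>
  The system \<open>u' = v\<close>, \<open>v' = G u\<close> with \<open>G\<close> merely integrable. Eliminating \<open>u\<close> leaves a Volterra equation for
  \<open>v\<close>. In the weighted norm with weight \<open>w(x) = exp (c (X - x))\<close> the inner integration gains a factor
  \<open>1 / c\<close>, so the map is a contraction once \<open>c\<close> exceeds twice the integral of \<open>|G|\<close>.
\<close>

lemma backward_cauchy_problem:
  fixes G :: "real \<Rightarrow> real"
  assumes G: "G absolutely_integrable_on {0..X}" and X: "X \<ge> 0"
  shows "\<exists>u v. continuous_on {0..X} u \<and> continuous_on {0..X} v \<and>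
    (\<forall>x\<in>{0..X}. u x = a - integral {x..X} v \<and> v x = b - integral {x..X} (\<lambda>t. u t * G t))"
proof -
  define J where "J = integral {0..X} (\<lambda>x. \<bar>G x\<bar>)"
  have aG: "(\<lambda>x. \<bar>G x\<bar>) absolutely_integrable_on {0..X}"
    using absolutely_integrable_norm[OF G] by (simp add: o_def)
  then have aGi: "(\<lambda>x. \<bar>G x\<bar>) integrable_on {0..X}" by (simp add: absolutely_integrable_on_def)
  have "J \<ge> 0" unfolding J_def by (rule integral_nonneg[OF aGi]) auto
  define c where "c = 2 * J + 1"
  have c: "c > 0" "J / c \<le> 1 / 2" using \<open>J \<ge> 0\<close> by (auto simp: c_def field_simps)
  \<comment> \<open>The fixed point is \<open>z = v / w\<close>, and \<open>Y z\<close> is the corresponding \<open>u\<close>.\<close>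
  define w where "w x = exp (c * (X - x))" for x
  have wpos: "w x > 0" for x by (simp add: w_def)
  have wcont: "continuous_on A w" for A unfolding w_def by (intro continuous_intros)
  define Y where "Y z t = a - integral {t..X} (\<lambda>s. w s * z s)" for z :: "real \<Rightarrow> real" and t
  define F where "F z x = (b - integral {x..X} (\<lambda>t. Y z t * G t)) / w x" for z :: "real \<Rightarrow> real" and x
  have wz: "(\<lambda>s. w s * z s) integrable_on {t..X}" if "continuous_on UNIV z" for z t
    by (intro integrable_continuous_interval continuous_on_mult wcont continuous_on_subset[OF that]) auto
  have Ycont: "continuous_on {0..X} (Y z)" if "continuous_on UNIV z" for z
    unfolding Y_def by (intro continuous_intros indefinite_integral_continuous_1' wz that)
  have YG: "(\<lambda>t. Y z t * G t) absolutely_integrable_on {x..X}" if "continuous_on UNIV z" "x \<in> {0..X}" for z x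
    using absolutely_integrable_continuous_mult[OF Ycont[OF that(1)] G]
    by (rule absolutely_integrable_on_subinterval) (use that in auto)
  have YGi: "(\<lambda>t. Y z t * G t) integrable_on {x..X}" if "continuous_on UNIV z" "x \<in> {0..X}" for z x
    using YG[OF that] by (simp add: absolutely_integrable_on_def)
  have Fcont: "continuous_on {0..X} (F z)" if "continuous_on UNIV z" for z
    unfolding F_def
    by (intro continuous_intros indefinite_integral_continuous_1' YGi wcont that)
      (use wpos X in \<open>auto simp: less_imp_neq[THEN not_sym]\<close>)
  define T :: "(real \<Rightarrow>\<^sub>C real) \<Rightarrow> (real \<Rightarrow>\<^sub>C real)" where
    "T z = (SOME h. \<forall>x. apply_bcontfun h x = F (apply_bcontfun z) (clamp 0 X x))" for z
  have T: "apply_bcontfun (T z) x = F (apply_bcontfun z) (clamp 0 X x)" for z x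
  proof -
    have "continuous_on (cbox 0 X) (F (apply_bcontfun z))" using Fcont[of "apply_bcontfun z"] by simp
    from continuous_on_cbox_bcontfunE[OF this] obtain h :: "real \<Rightarrow>\<^sub>C real" where
      "\<forall>x. apply_bcontfun h x = F (apply_bcontfun z) (clamp 0 X x)" by metis
    then show ?thesis unfolding T_def by (rule someI2) auto
  qed
  have "dist (T z) (T z') \<le> (1 / 2) * dist z z'" for z z' :: "real \<Rightarrow>\<^sub>C real"
  proof (rule dist_bound)
    fix x
    define y where "y = clamp 0 X x"
    have "y \<in> cbox 0 X" unfolding y_def by (rule clamp_in_interval) (use X in auto)
    then have y: "y \<in> {0..X}" by simp
    have Yd: "\<bar>Y z t - Y z' t\<bar> \<le> dist z z' * (w y / c)" if t: "t \<in> {y..X}" for t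
    proof -
      have "Y z t - Y z' t = integral {t..X} (\<lambda>s. w s * z' s - w s * z s)"
        unfolding Y_def by (subst integral_diff) (auto intro!: wz)
      also have "norm \<dots> \<le> integral {t..X} (\<lambda>s. dist z z' * w s)"
      proof (rule integral_norm_bound_integral)
        show "(\<lambda>s. w s * z' s - w s * z s) integrable_on {t..X}" by (intro integrable_diff wz) auto
        show "(\<lambda>s. dist z z' * w s) integrable_on {t..X}"
          unfolding w_def by (intro integrable_on_mult_right integral_exp_decreasing_le) (use c t in auto)
        show "norm (w s * z' s - w s * z s) \<le> dist z z' * w s" for s
          using dist_bounded[of z s z'] wpos[of s]
          by (simp add: dist_real_def abs_mult abs_minus_commute mult.commute flip: right_diff_distrib)
      qed
      also have "\<dots> = dist z z' * integral {t..X} w" by simp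
      also have "\<dots> \<le> dist z z' * (exp (c * (X - t)) / c)"
        unfolding w_def by (intro mult_left_mono integral_exp_decreasing_le) (use c t in auto)
      also have "\<dots> \<le> dist z z' * (w y / c)"
        unfolding w_def using t c by (intro mult_left_mono divide_right_mono) auto
      finally show ?thesis by simp
    qed
    define D where "D t = Y z' t * G t - Y z t * G t" for t
    have "F z y - F z' y = integral {y..X} D / w y"
    proof -
      have "integral {y..X} D
          = integral {y..X} (\<lambda>t. Y z' t * G t) - integral {y..X} (\<lambda>t. Y z t * G t)"
        unfolding D_def by (rule integral_diff) (use y in \<open>auto intro!: YGi simp del: mult.commute\<close>)
      then show ?thesis by (simp add: F_def diff_divide_distrib)
    qed
    then have F_eq: "\<bar>F z y - F z' y\<bar> = norm (integral {y..X} D) / w y"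
      using wpos[of y] by simp
    have "norm (integral {y..X} D)
        \<le> integral {y..X} (\<lambda>t. (dist z z' * (w y / c)) * \<bar>G t\<bar>)"
    proof (rule integral_norm_bound_integral)
      show "D integrable_on {y..X}"
        unfolding D_def by (intro integrable_diff YGi) (use y in auto)
      show "(\<lambda>t. (dist z z' * (w y / c)) * \<bar>G t\<bar>) integrable_on {y..X}"
        by (intro integrable_on_mult_right integrable_on_subinterval[OF aGi]) (use y in auto)
      show "norm (D t) \<le> (dist z z' * (w y / c)) * \<bar>G t\<bar>" if "t \<in> {y..X}" for t
        unfolding D_def using mult_right_mono[OF Yd[OF that], of "\<bar>G t\<bar>"]
        by (simp add: abs_mult abs_minus_commute flip: left_diff_distrib)
    qed
    also have "\<dots> = (dist z z' * (w y / c)) * integral {y..X} (\<lambda>t. \<bar>G t\<bar>)" by simp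
    also have "\<dots> \<le> (dist z z' * (w y / c)) * J"
      unfolding J_def by (intro mult_left_mono integral_subset_le integrable_on_subinterval[OF aGi] aGi)
        (use y c wpos[of y] in auto)
    finally have "\<bar>F z y - F z' y\<bar> \<le> (dist z z' * (w y / c)) * J / w y"
      unfolding F_eq by (rule divide_right_mono) (use wpos[of y] in auto)
    also have "\<dots> = (J / c) * dist z z'" using wpos[of y] by simp
    also have "\<dots> \<le> (1 / 2) * dist z z'" using c by (intro mult_right_mono) auto
    finally show "dist (apply_bcontfun (T z) x) (apply_bcontfun (T z') x) \<le> (1 / 2) * dist z z'"
      by (simp add: T y_def dist_real_def)
  qed
  then have "\<exists>!z. T z = z" by (intro banach_fix_type[of "1/2"]) auto
  then obtain z where z: "T z = z" by blast
  define v where "v x = w x * apply_bcontfun z x" for x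
  define u where "u x = Y (apply_bcontfun z) x" for x
  have "u x = a - integral {x..X} v" for x by (simp add: u_def Y_def v_def[abs_def])
  moreover have "v x = b - integral {x..X} (\<lambda>t. u t * G t)" if "x \<in> {0..X}" for x
  proof -
    have "clamp 0 X x = x" using that clamp_cancel_cbox[of x 0 X] by simp
    then have "apply_bcontfun z x = F (apply_bcontfun z) x"
      using T[of z x] z by simp
    then show ?thesis using wpos[of x] by (simp add: v_def F_def u_def)
  qed
  moreover have "continuous_on {0..X} u" unfolding u_def by (rule Ycont) simp
  moreover have "continuous_on {0..X} v" unfolding v_def by (intro continuous_on_mult wcont) simp
  ultimately show ?thesis by blast
qed

lemma solution_extends_to_half_line:
  fixes V u v :: "real \<Rightarrow> real" and E X :: real
  assumes V: "\<And>b. V absolutely_integrable_on {0..b}" and X: "X \<ge> 0"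
    and u: "\<And>x. x \<ge> X \<Longrightarrow> (u has_real_derivative v x) (at x)"
    and v: "\<And>x. x \<ge> X \<Longrightarrow> (v has_real_derivative (V x - E) * u x) (at x)"
  shows "\<exists>U W. continuous_on {0..} U \<and> continuous_on {0..} W \<and>
    (\<forall>x\<ge>0. U x = U 0 + integral {0..x} W) \<and>
    (\<forall>x\<ge>0. W x = W 0 + integral {0..x} (\<lambda>t. U t * (V t - E))) \<and>
    (\<forall>x\<ge>X. U x = u x \<and> W x = v x)"
proof -
  have G: "(\<lambda>t. V t - E) absolutely_integrable_on {0..b}" for b
    by (intro set_integral_diff V absolutely_integrable_continuous_real) auto
  obtain u0 v0 where uv0: "continuous_on {0..X} u0" "continuous_on {0..X} v0"
    "\<And>x. x \<in> {0..X} \<Longrightarrow> u0 x = u X - integral {x..X} v0"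
    "\<And>x. x \<in> {0..X} \<Longrightarrow> v0 x = v X - integral {x..X} (\<lambda>t. u0 t * (V t - E))"
    using backward_cauchy_problem[OF G X, of "u X" "v X"] by blast
  define U where "U x = (if x \<in> {0..X} then u0 x else u x)" for x
  define W where "W x = (if x \<in> {0..X} then v0 x else v x)" for x
  have X0: "u0 X = u X" "v0 X = v X" using uv0(3,4)[of X] X by auto
  have cont: "continuous_on {X..} u" "continuous_on {X..} v"
    using u v by (meson DERIV_isCont atLeast_iff continuous_at_imp_continuous_on)+
  have un: "{0..} = {0..X} \<union> {X..}" using X by auto
  have Uc: "continuous_on {0..} U" unfolding U_def un
    by (intro continuous_on_If) (use uv0 cont X0 in \<open>auto simp: antisym\<close>)
  have Wc: "continuous_on {0..} W" unfolding W_def un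
    by (intro continuous_on_If) (use uv0 cont X0 in \<open>auto simp: antisym\<close>)
  have Ux: "U x = u x" and Wx: "W x = v x" if "x \<ge> X" for x
    using that X0 X by (auto simp: U_def W_def)
  have Wi: "W integrable_on {p..q}" if "p \<ge> 0" for p q
    by (intro integrable_continuous_interval continuous_on_subset[OF Wc]) (use that in auto)
  have UG: "(\<lambda>t. U t * (V t - E)) integrable_on {p..q}" if "p \<ge> 0" for p q
  proof -
    have "(\<lambda>t. U t * (V t - E)) absolutely_integrable_on {0..q}"
      by (intro absolutely_integrable_continuous_mult continuous_on_subset[OF Uc] G) auto
    then have "(\<lambda>t. U t * (V t - E)) integrable_on {0..q}" by (simp add: absolutely_integrable_on_def)
    then show ?thesis by (rule integrable_on_subinterval) (use that in auto)
  qed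
  have core: "h x = h 0 + integral {0..x} k"
    if x: "x \<ge> 0" and ki: "\<And>p q. p \<ge> 0 \<Longrightarrow> k integrable_on {p..q}"
      and left: "\<And>x. x \<in> {0..X} \<Longrightarrow> h x = h X - integral {x..X} k"
      and right: "\<And>x. x \<ge> X \<Longrightarrow> (h0 has_real_derivative k x) (at x)" "\<And>x. x \<ge> X \<Longrightarrow> h x = h0 x"
    for h k h0 :: "real \<Rightarrow> real" and x
  proof (cases "x \<le> X")
    case True
    then have "integral {0..x} k + integral {x..X} k = integral {0..X} k"
      using x ki by (intro Henstock_Kurzweil_Integration.integral_combine) auto
    then show ?thesis using left[of x] left[of 0] True x by auto
  next
    case False
    then have sum: "integral {0..X} k + integral {X..x} k = integral {0..x} k"
      using X ki by (intro Henstock_Kurzweil_Integration.integral_combine) auto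
    have "(k has_integral h0 x - h0 X) {X..x}"
    proof (rule fundamental_theorem_of_calculus)
      show "(h0 has_vector_derivative k y) (at y within {X..x})" if "y \<in> {X..x}" for y
        unfolding has_real_derivative_iff_has_vector_derivative[symmetric]
        by (rule has_field_derivative_at_within, rule right(1)) (use that in auto)
    qed (use False in auto)
    from integral_unique[OF this] have "integral {X..x} k = h x - h X"
      using right(2)[of x] right(2)[of X] False by simp
    with sum show ?thesis using left[of 0] X by auto
  qed
  have "U x = U 0 + integral {0..x} W" if "x \<ge> 0" for x
  proof (rule core[OF that Wi])
    show "U x = U X - integral {x..X} W" if "x \<in> {0..X}" for x
    proof -
      have "integral {x..X} W = integral {x..X} v0"
        by (rule integral_cong) (use that in \<open>auto simp: W_def\<close>)
      then show ?thesis using uv0(3)[OF that] that X X0 by (auto simp: U_def)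
    qed
    show "(u has_real_derivative W x) (at x)" if "x \<ge> X" for x using u[OF that] Wx[OF that] by simp
  qed (auto simp: Ux)
  moreover have "W x = W 0 + integral {0..x} (\<lambda>t. U t * (V t - E))" if "x \<ge> 0" for x
  proof (rule core[OF that UG])
    show "W x = W X - integral {x..X} (\<lambda>t. U t * (V t - E))" if "x \<in> {0..X}" for x
    proof -
      have "integral {x..X} (\<lambda>t. U t * (V t - E)) = integral {x..X} (\<lambda>t. u0 t * (V t - E))"
        by (rule integral_cong) (use that in \<open>auto simp: U_def\<close>)
      then show ?thesis using uv0(4)[OF that] that X X0 by (auto simp: W_def)
    qed
    show "(v has_real_derivative U x * (V x - E)) (at x)" if "x \<ge> X" for x
      using v[OF that] Ux[OF that] by (simp add: mult.commute)
  qed (auto simp: Wx)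
  ultimately show ?thesis using Uc Wc Ux Wx by blast
qed

section \<open>Eigenvalues from square integrable solutions\<close>

lemma exists_boundary_angle:
  fixes a b :: real
  shows "\<exists>\<theta>\<in>{0..<pi}. b * sin \<theta> = a * cos \<theta>"
proof (cases "b = 0")
  case True
  then show ?thesis by (intro bexI[of _ "pi / 2"]) auto
next
  case False
  define t where "t = arctan (a / b)"
  have t: "- (pi / 2) < t" "t < pi / 2" using arctan_bounded[of "a / b"] by (auto simp: t_def)
  have "cos t \<noteq> 0" by (simp add: t_def)
  moreover have "sin t / cos t = a / b" using tan_arctan[of "a / b"] by (simp add: t_def tan_def)
  ultimately have eq: "b * sin t = a * cos t" using False by (simp add: field_simps)
  show ?thesis
  proof (cases "t \<ge> 0")
    case True
    then show ?thesis using t eq pi_gt_zero by (intro bexI[of _ t]) auto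
  next
    case False
    then show ?thesis using t eq by (intro bexI[of _ "t + pi"]) auto
  qed
qed

lemma square_integrable_solution_gives_eigenvalue:
  fixes V U v g :: "real \<Rightarrow> real" and E X :: real
  assumes V: "\<And>b. V absolutely_integrable_on {0..b}"
    and Uc: "continuous_on {0..} U" and vc: "continuous_on {0..} v"
    and U: "\<And>x. x \<ge> 0 \<Longrightarrow> U x = U 0 + integral {0..x} v"
    and v: "\<And>x. x \<ge> 0 \<Longrightarrow> v x = v 0 + integral {0..x} (\<lambda>t. U t * (V t - E))"
    and nonzero: "x\<^sub>1 > 0" "U x\<^sub>1 \<noteq> 0"
    and X: "X \<ge> 0" and g: "g integrable_on {X..}" "\<And>x. x \<ge> X \<Longrightarrow> (U x)\<^sup>2 \<le> g x"
  shows "\<exists>\<theta>\<in>{0..<pi}. H_eigenvalue V \<theta> E"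
proof -
  define u where "u = (\<lambda>x. complex_of_real (U x))"
  note * = integral_representation_solves_equation[where 'a = complex, OF V Uc vc U v, folded u_def]
  have sol_AC: "AC1_loc u" by (rule *(1))
  have sol_deriv: "hderiv u x = complex_of_real (v x)" if "x \<ge> 0" for x
    by (rule *(2)) (use that in auto)
  have sol_eq: "AE x\<in>{0<..} in lebesgue. schroedinger_expr V u x = complex_of_real E * u x"
    using *(3) by (simp add: u_def)
  have Uc': "continuous_on {0<..} U" by (rule continuous_on_subset[OF Uc]) auto
  have "(\<lambda>x. indicator {0<..} x *\<^sub>R u x) \<in> borel_measurable borel"
    unfolding u_def by (intro borel_measurable_continuous_on_indicator continuous_intros Uc') auto
  then have "(\<lambda>x. indicator {0<..} x *\<^sub>R u x) \<in> borel_measurable lborel" by simp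
  then have um: "(\<lambda>x. indicator {0<..} x *\<^sub>R u x) \<in> borel_measurable lebesgue"
    by (rule measurable_completion)
  have "(\<lambda>x. (U x)\<^sup>2) absolutely_integrable_on {0..X}"
    by (intro absolutely_integrable_continuous_real continuous_intros continuous_on_subset[OF Uc]) auto
  moreover have "(\<lambda>x. (U x)\<^sup>2) absolutely_integrable_on {X..}"
  proof (rule measurable_bounded_by_integrable_imp_absolutely_integrable[OF _ _ g(1)])
    show "(\<lambda>x. (U x)\<^sup>2) \<in> borel_measurable (lebesgue_on {X..})"
      by (intro continuous_imp_measurable_on_sets_lebesgue continuous_intros continuous_on_subset[OF Uc])
        (use X in auto)
  qed (use g(2) in auto)
  ultimately have "(\<lambda>x. (U x)\<^sup>2) absolutely_integrable_on ({0..X} \<union> {X..})"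
    by (intro set_integrable_Un) auto
  then have "(\<lambda>x. (U x)\<^sup>2) absolutely_integrable_on {0<..}"
    by (rule set_integrable_subset) (use X in auto)
  then have ui: "set_integrable lebesgue {0<..} (\<lambda>x. (norm (u x))\<^sup>2)" by (simp add: u_def)
  have uL2: "u \<in> L2_half_line"
    using um ui by (simp add: L2_half_line_def set_borel_measurable_def)
  define s where "s = schroedinger_expr V u"
  have ae: "AE x in lebesgue. indicator {0<..} x *\<^sub>R (complex_of_real E * u x) = indicator {0<..} x *\<^sub>R s x"
    using sol_eq by eventually_elim (auto simp: s_def indicator_def)
  have "(\<lambda>x. complex_of_real E * (indicator {0<..} x *\<^sub>R u x)) \<in> borel_measurable lebesgue"
    using um by (intro borel_measurable_times) auto
  then have "(\<lambda>x. indicator {0<..} x *\<^sub>R (complex_of_real E * u x)) \<in> borel_measurable lebesgue"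
    by (simp add: mult_ac)
  then have sm: "(\<lambda>x. indicator {0<..} x *\<^sub>R s x) \<in> borel_measurable lebesgue"
    using ae by (rule borel_measurable_AE)
  have "set_integrable lebesgue {0<..} (\<lambda>x. E\<^sup>2 * (norm (u x))\<^sup>2)"
    using ui by (rule set_integrable_mult_right)
  then have "integrable lebesgue (\<lambda>x. indicator {0<..} x *\<^sub>R (E\<^sup>2 * (norm (u x))\<^sup>2))"
    by (simp add: set_integrable_def)
  then have "integrable lebesgue (\<lambda>x. indicator {0<..} x *\<^sub>R (norm (s x))\<^sup>2)"
  proof (rule integrable_cong_AE_imp)
    have "(\<lambda>x. (norm (indicator {0<..} x *\<^sub>R s x))\<^sup>2) \<in> borel_measurable lebesgue"
      by (intro borel_measurable_power measurable_compose[OF sm borel_measurable_norm]) 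
    then show "(\<lambda>x. indicator {0<..} x *\<^sub>R (norm (s x))\<^sup>2) \<in> borel_measurable lebesgue"
      by (rule measurable_cong[THEN iffD1, rotated]) (auto simp: indicator_def)
    show "AE x in lebesgue. indicator {0<..} x *\<^sub>R (E\<^sup>2 * (norm (u x))\<^sup>2) = indicator {0<..} x *\<^sub>R (norm (s x))\<^sup>2"
      using sol_eq by eventually_elim (auto simp: s_def indicator_def norm_mult power_mult_distrib)
  qed
  then have sL2: "s \<in> L2_half_line"
    using sm by (simp add: L2_half_line_def set_borel_measurable_def set_integrable_def)
  obtain \<theta> where \<theta>: "\<theta> \<in> {0..<pi}" "v 0 * sin \<theta> = U 0 * cos \<theta>"
    using exists_boundary_angle by blast
  have "hderiv u 0 * complex_of_real (sin \<theta>) = u 0 * complex_of_real (cos \<theta>)"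
    unfolding sol_deriv[OF order_refl] using \<theta>(2) by (simp add: u_def flip: of_real_mult)
  then have dom: "u \<in> H_domain V \<theta>"
    using uL2 sL2 sol_AC by (simp add: H_domain_def s_def)
  have "\<not> (AE x\<in>{0<..} in lebesgue. u x = 0)"
  proof
    assume "AE x\<in>{0<..} in lebesgue. u x = 0"
    then have "AE x in lebesgue. x \<notin> {0<..} \<inter> U -` (- {0})"
      by eventually_elim (auto simp: u_def)
    moreover have op: "open ({0<..} \<inter> U -` (- {0}))"
      by (intro continuous_open_preimage Uc') auto
    ultimately have "negligible ({0<..} \<inter> U -` (- {0}))"
      by (simp add: negligible_iff_null_sets AE_iff_null_sets)
    moreover have "x\<^sub>1 \<in> {0<..} \<inter> U -` (- {0})" using nonzero by auto
    ultimately show False using op open_not_negligible by blast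
  qed
  then show ?thesis using dom sol_eq \<theta>(1) unfolding H_eigenvalue_def by blast
qed

section \<open>The half-line problem\<close>

definition has_solution_with_profile :: "(real \<Rightarrow> real) \<Rightarrow> real \<Rightarrow> (real \<Rightarrow> real) \<Rightarrow> bool" where
  "has_solution_with_profile V E F \<longleftrightarrow> (\<exists>u :: real \<Rightarrow> real. schroedinger_solution V E u \<and>
     (\<exists>a>0. \<exists>\<phi> :: real. \<exists>r :: real \<Rightarrow> complex. r \<in> o(\<lambda>_. 1) \<and>
       (\<forall>\<^sub>F x in at_top. complex_of_real (1 / sqrt E * hderiv u x) + \<i> * complex_of_real (u x) =
          complex_of_real (a * F x) * exp (\<i> * complex_of_real (sqrt E * x + \<phi>)) * (1 + r x))))"

context resonant_potential
begin

lemma correction_deriv: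
  assumes "x > 0"
  shows "(correction has_real_derivative (\<Sum>l=1..N. shift_coeff l * amp' l x)) (at x)"
  unfolding correction_def[abs_def]
  by (auto intro!: derivative_eq_intros amp_deriv assms sum.cong)

lemma correction_C1: "correction C1_differentiable_on {0<..}"
  unfolding C1_differentiable_on_def
proof (intro exI conjI ballI)
  show "continuous_on {0<..} (\<lambda>x. \<Sum>l=1..N. shift_coeff l * amp' l x)"
    by (intro continuous_intros amp_continuous)
qed (use correction_deriv in \<open>auto simp flip: has_real_derivative_iff_has_vector_derivative\<close>)

lemma correction_deriv_bigo: "deriv correction \<in> O(\<lambda>x. x powr (- (real (Suc N) * \<gamma>)))"
proof -
  have "(\<lambda>x. \<Sum>l=1..N. shift_coeff l * amp' l x) \<in> O(\<lambda>x. x powr (- (real (Suc N) * \<gamma>)))"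
    by (intro big_sum_in_bigo bounded_mult_in_bigo amp'_bigo) simp
  moreover have "\<forall>\<^sub>F x in at_top. deriv correction x = (\<Sum>l=1..N. shift_coeff l * amp' l x)"
    using eventually_gt_at_top[of 0] by eventually_elim (rule DERIV_imp_deriv, rule correction_deriv)
  ultimately show ?thesis by (subst landau_o.big.in_cong)
qed

lemma correction_bigo: "correction \<in> O(\<lambda>x. x powr (- \<gamma>))"
  unfolding correction_def[abs_def]
proof (intro big_sum_in_bigo bounded_mult_in_bigo amp_bigo)
  fix l assume "l \<in> {1..N}"
  then show "\<gamma> \<le> real l * \<gamma>" using mult_right_mono[of 1 "real l" \<gamma>] \<gamma> by simp
qed simp

lemma potential_eq:
  "potential x = (\<Sum>k=1..K. lam k * (1 / x powr \<gamma>) * cos (\<alpha> k * x)) + correction x"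
  unfolding potential_def osc_def sum_distrib_right amp_def
  by (simp add: powr_minus divide_inverse mult_ac)

lemma exp_exponent_eq_decay_profile:
  assumes "x > 0" "b = C * L"
  shows "exp (- b * exponent x) = decay_profile (Suc N) \<gamma> C L x"
proof -
  have N0: "real N > 0" using N by simp
  have rp: "real (Suc N) - 1 = real N" by simp
  show ?thesis
  proof (cases "real N * \<gamma> = 1")
    case True
    then have "exponent x = ln x" by (simp add: exponent_def)
    moreover have "\<gamma> = 1 / (real (Suc N) - 1)" using N0 True rp by (simp add: field_simps)
    then have "decay_profile (Suc N) \<gamma> C L x = x powr (- (C * L))" by (simp add: decay_profile_def)
    ultimately show ?thesis using assms by (simp add: powr_def)
  next
    case False
    then have "\<gamma> \<noteq> 1 / real N" using N0 by (auto simp: field_simps)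
    then show ?thesis using False assms(2) rp by (simp add: decay_profile_def exponent_def mult_ac)
  qed
qed

text \<open>
  For \<open>N \<gamma> = 1\<close> the amplitude is \<open>x\<^sup>-\<^sup>b\<close>, with square integrable tail since \<open>b \<ge> 1\<close>; for \<open>N \<gamma> < 1\<close> it decays faster than
  every power.
\<close>

lemma decay_square_integrable:
  assumes "b > 0" "real N * \<gamma> = 1 \<longrightarrow> b \<ge> 1"
  shows "\<exists>s>1. \<forall>\<^sub>F x in at_top. (exp (- b * exponent x))\<^sup>2 \<le> x powr (- s)"
proof (cases "real N * \<gamma> = 1")
  case True
  have "\<forall>\<^sub>F x in at_top. (exp (- b * exponent x))\<^sup>2 \<le> x powr (- (2 * b))"
    using eventually_gt_at_top[of 0]
    by eventually_elim (use True in \<open>simp add: exponent_def powr_def flip: exp_double\<close>)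
  then show ?thesis using assms True by (intro exI[of _ "2 * b"]) auto
next
  case False
  define d where "d = 1 - real N * \<gamma>"
  have d: "d > 0" using False \<gamma> by (simp add: d_def)
  define c where "c = 2 * b / d"
  have c: "c > 0" using assms d by (simp add: c_def)
  have "filterlim (\<lambda>x. c * x powr d - 2 * ln x) at_top at_top"
    using c d by real_asymp
  then have "\<forall>\<^sub>F x in at_top. c * x powr d - 2 * ln x \<ge> 0"
    unfolding filterlim_at_top by blast
  then have "\<forall>\<^sub>F x in at_top. (exp (- b * exponent x))\<^sup>2 \<le> x powr (- 2)"
    using eventually_gt_at_top[of 0]
  proof eventually_elim
    case (elim x)
    have "exponent x = x powr d / d" using False by (simp add: exponent_def d_def)
    then have "(exp (- b * exponent x))\<^sup>2 = exp (- (c * x powr d))"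
      by (simp add: c_def flip: exp_double)
    also have "\<dots> \<le> exp (- 2 * ln x)" using elim by simp
    also have "\<dots> = x powr (- 2)" using elim by (simp add: powr_def)
    finally show ?case .
  qed
  then show ?thesis by (intro exI[of _ 2]) simp
qed

text \<open>
  The decaying solution is known for large \<open>x\<close>; it is continued to \<open>0\<close> and its asymptotics are put into the
  complex form \<open>u' / \<kappa> + i u\<close>. It does not vanish identically because its leading part is \<open>f\<close> times a sine.
\<close>

lemma half_line_solution:
  fixes V :: "real \<Rightarrow> real" and x\<^sub>0 :: real
  assumes refl: "reflection \<noteq> 0" and x0: "x\<^sub>0 > 0"
    and V: "V absolutely_integrable_on {0<..<x\<^sub>0}" "\<And>x. x \<ge> x\<^sub>0 \<Longrightarrow> V x = potential x"
    and CL: "\<bar>reflection\<bar> / (2 * \<kappa>) = C * L"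
  shows "has_solution_with_profile V (\<kappa>\<^sup>2) (decay_profile (Suc N) \<gamma> C L)"
    and "(real N * \<gamma> = 1 \<longrightarrow> C * L \<ge> 1) \<Longrightarrow> \<exists>\<theta>\<in>{0..<pi}. H_eigenvalue V \<theta> (\<kappa>\<^sup>2)"
proof -
  define b where "b = C * L"
  define \<phi> where "\<phi> = - sgn reflection * (pi / 4)"
  define f where "f x = exp (- b * exponent x)" for x
  have fpos: "f x > 0" for x by (simp add: f_def)
  have b: "b > 0" using refl \<kappa> by (simp add: b_def flip: CL)
  obtain X\<^sub>1 u v where uv: "X\<^sub>1 > 0"
    "\<And>x. x \<ge> X\<^sub>1 \<Longrightarrow> (u has_real_derivative v x) (at x)"
    "\<And>x. x \<ge> X\<^sub>1 \<Longrightarrow> (v has_real_derivative (potential x - \<kappa>\<^sup>2) * u x) (at x)"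
    "((\<lambda>x. u x / f x - sin (\<kappa> * x + \<phi>)) \<longlongrightarrow> 0) at_top"
    "((\<lambda>x. v x / f x - \<kappa> * cos (\<kappa> * x + \<phi>)) \<longlongrightarrow> 0) at_top"
    using decaying_resonant_solution[OF refl] unfolding f_def b_def \<phi>_def CL by blast
  define X where "X = max X\<^sub>1 x\<^sub>0"
  have X: "X \<ge> X\<^sub>1" "X \<ge> x\<^sub>0" "X > 0" using x0 by (auto simp: X_def)
  have Vint: "V absolutely_integrable_on {0..c}" for c
  proof -
    have "V absolutely_integrable_on {0..x\<^sub>0}"
      using V(1) absolutely_integrable_on_open_interval[where f = V and a = 0 and b = x\<^sub>0] by simp
    moreover have "V absolutely_integrable_on {x\<^sub>0..max c x\<^sub>0}"
    proof (rule absolutely_integrable_continuous_real)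
      have "continuous_on {x\<^sub>0..max c x\<^sub>0} potential"
        by (rule continuous_on_subset[OF potential_continuous]) (use x0 in auto)
      then show "continuous_on {x\<^sub>0..max c x\<^sub>0} V"
        by (rule continuous_on_eq) (use V(2) in auto)
    qed
    ultimately have "V absolutely_integrable_on ({0..x\<^sub>0} \<union> {x\<^sub>0..max c x\<^sub>0})"
      by (intro set_integrable_Un) auto
    then show ?thesis by (rule absolutely_integrable_on_subinterval) auto
  qed
  have "\<exists>U W. continuous_on {0..} U \<and> continuous_on {0..} W \<and>
    (\<forall>x\<ge>0. U x = U 0 + integral {0..x} W) \<and>
    (\<forall>x\<ge>0. W x = W 0 + integral {0..x} (\<lambda>t. U t * (V t - \<kappa>\<^sup>2))) \<and>
    (\<forall>x\<ge>X. U x = u x \<and> W x = v x)"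
  proof (rule solution_extends_to_half_line[OF Vint])
    fix x assume x: "x \<ge> X"
    show "(u has_real_derivative v x) (at x)" using uv(2) x X by auto
    show "(v has_real_derivative (V x - \<kappa>\<^sup>2) * u x) (at x)" using uv(3)[of x] V(2)[of x] x X by auto
  qed (use X in auto)
  then obtain U W where UW: "continuous_on {0..} U" "continuous_on {0..} W"
    "\<And>x. x \<ge> 0 \<Longrightarrow> U x = U 0 + integral {0..x} W"
    "\<And>x. x \<ge> 0 \<Longrightarrow> W x = W 0 + integral {0..x} (\<lambda>t. U t * (V t - \<kappa>\<^sup>2))"
    "\<And>x. x \<ge> X \<Longrightarrow> U x = u x" "\<And>x. x \<ge> X \<Longrightarrow> W x = v x"
    by blast
  note sol = integral_representation_solves_equation[where 'a = real, OF Vint UW(1-4), simplified]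
  have "schroedinger_solution V (\<kappa>\<^sup>2) U"
    using sol(1,3) unfolding schroedinger_solution_def by simp
  moreover have "\<exists>\<phi> r. r \<in> o(\<lambda>_. 1) \<and> (\<forall>\<^sub>F x in at_top.
        complex_of_real (1 / sqrt (\<kappa>\<^sup>2) * hderiv U x) + \<i> * complex_of_real (U x) =
        complex_of_real (1 * decay_profile (Suc N) \<gamma> C L x) * exp (\<i> * complex_of_real (sqrt (\<kappa>\<^sup>2) * x + \<phi>)) * (1 + r x))"
  proof -
    define e where "e x = exp (\<i> * complex_of_real (\<kappa> * x + \<phi>))" for x
    have norm_e: "norm (e x) = 1" for x by (simp add: e_def)
    then have e0: "e x \<noteq> 0" for x by (metis norm_zero zero_neq_one)
    have e_eq: "e x = complex_of_real (cos (\<kappa> * x + \<phi>)) + \<i> * complex_of_real (sin (\<kappa> * x + \<phi>))" for x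
      unfolding e_def exp_Euler cos_of_real sin_of_real ..
    define d where "d x = complex_of_real (1 / \<kappa> * (v x / f x - \<kappa> * cos (\<kappa> * x + \<phi>)))
        + \<i> * complex_of_real (u x / f x - sin (\<kappa> * x + \<phi>))" for x
    define r where "r x = d x / e x" for x
    have "(d \<longlongrightarrow> complex_of_real (1 / \<kappa> * 0) + \<i> * complex_of_real 0) at_top"
      unfolding d_def[abs_def] by (intro tendsto_intros uv(4,5))
    then have "((\<lambda>x. norm (d x)) \<longlongrightarrow> 0) at_top" by (intro tendsto_norm_zero) simp
    then have "((\<lambda>x. norm (r x)) \<longlongrightarrow> 0) at_top" by (simp add: r_def norm_divide norm_e)
    then have "r \<in> o(\<lambda>_. 1)" by (intro smalloI_tendsto) (auto simp: tendsto_norm_zero_iff)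
    moreover have "\<forall>\<^sub>F x in at_top. complex_of_real (1 / sqrt (\<kappa>\<^sup>2) * hderiv U x) + \<i> * complex_of_real (U x) =
        complex_of_real (1 * decay_profile (Suc N) \<gamma> C L x) * e x * (1 + r x)"
      using eventually_ge_at_top[of X]
    proof eventually_elim
      case (elim x)
      have fx: "complex_of_real (f x) \<noteq> 0" using fpos[of x] by simp
      have "hderiv U x = v x" "U x = u x" using sol(2)[of x] UW(5,6)[of x] elim X by auto
      moreover have "complex_of_real (f x) * e x * (1 + r x) = complex_of_real (f x) * (e x + d x)"
        using e0[of x] by (simp add: r_def distrib_left)
      moreover have "e x + d x = complex_of_real (1 / \<kappa> * (v x / f x)) + \<i> * complex_of_real (u x / f x)"
        unfolding e_eq d_def using \<kappa> by (simp add: algebra_simps)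
      moreover have "complex_of_real (f x) * (complex_of_real (1 / \<kappa> * (v x / f x)) + \<i> * complex_of_real (u x / f x))
          = complex_of_real (1 / \<kappa> * v x) + \<i> * complex_of_real (u x)"
        using fx by (simp add: field_simps)
      moreover have "f x = decay_profile (Suc N) \<gamma> C L x" "sqrt (\<kappa>\<^sup>2) = \<kappa>"
        using exp_exponent_eq_decay_profile[of x b] elim X \<kappa> by (auto simp: f_def b_def)
      ultimately show ?case by (simp only: mult_1)
    qed
    moreover have "sqrt (\<kappa>\<^sup>2) = \<kappa>" using \<kappa> by simp
    ultimately show ?thesis unfolding e_def by (simp only:) blast
  qed
  ultimately show "has_solution_with_profile V (\<kappa>\<^sup>2) (decay_profile (Suc N) \<gamma> C L)"
    unfolding has_solution_with_profile_def using zero_less_one by blast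
  assume b1: "real N * \<gamma> = 1 \<longrightarrow> C * L \<ge> 1"
  obtain s where s: "s > 1" "\<forall>\<^sub>F x in at_top. (f x)\<^sup>2 \<le> x powr (- s)"
    using decay_square_integrable[OF b b1[folded b_def]] unfolding f_def by blast
  have "\<forall>\<^sub>F x in at_top. dist (u x / f x - sin (\<kappa> * x + \<phi>)) 0 < 1"
    using uv(4) by (rule tendstoD) simp
  with s(2) have "\<forall>\<^sub>F x in at_top. (f x)\<^sup>2 \<le> x powr (- s) \<and> \<bar>u x / f x - sin (\<kappa> * x + \<phi>)\<bar> < 1"
    by eventually_elim (auto simp: dist_real_def)
  then obtain Y0 where Y0: "\<And>x. x \<ge> Y0 \<Longrightarrow> (f x)\<^sup>2 \<le> x powr (- s) \<and> \<bar>u x / f x - sin (\<kappa> * x + \<phi>)\<bar> < 1"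
    unfolding eventually_at_top_linorder by blast
  define Y where "Y = max Y0 X"
  have Y: "Y \<ge> Y0" "Y \<ge> X" "Y > 0" using X by (auto simp: Y_def)
  obtain n :: nat where n: "(\<kappa> * Y - pi / 2 + \<phi>) / (2 * pi) \<le> real n" using real_arch_simple by blast
  \<comment> \<open>A point far out at which the leading sine equals \<open>1\<close>.\<close>
  define x\<^sub>1 where "x\<^sub>1 = (pi / 2 - \<phi> + real n * (2 * pi)) / \<kappa>"
  have "\<kappa> * x\<^sub>1 = pi / 2 - \<phi> + real n * (2 * pi)" using \<kappa> by (simp add: x\<^sub>1_def)
  then have arg: "\<kappa> * x\<^sub>1 + \<phi> = pi / 2 + 2 * real n * pi" by simp
  have "\<kappa> * Y \<le> \<kappa> * x\<^sub>1" using n arg by (simp add: field_simps)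
  then have x1: "x\<^sub>1 \<ge> Y" using \<kappa> by simp
  have "sin (\<kappa> * x\<^sub>1 + \<phi>) = 1" unfolding arg unfolding sin_add cos_2npi sin_pi_half cos_pi_half by simp
  then have "u x\<^sub>1 \<noteq> 0" using Y0[of x\<^sub>1] x1 Y by auto
  then have "U x\<^sub>1 \<noteq> 0" using UW(5)[of x\<^sub>1] x1 Y by simp
  show "\<exists>\<theta>\<in>{0..<pi}. H_eigenvalue V \<theta> (\<kappa>\<^sup>2)"
  proof (rule square_integrable_solution_gives_eigenvalue[OF Vint UW(1-4) _ \<open>U x\<^sub>1 \<noteq> 0\<close>])
    show "(\<lambda>x. 4 * x powr (- s)) integrable_on {Y..}"
      using has_integral_powr_to_inf[of "- s" Y] s Y
      by (intro integrable_on_mult_right) (auto simp: integrable_on_def)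
    show "(U x)\<^sup>2 \<le> 4 * x powr (- s)" if "x \<ge> Y" for x
    proof -
      have *: "(f x)\<^sup>2 \<le> x powr (- s)" "\<bar>u x / f x - sin (\<kappa> * x + \<phi>)\<bar> < 1" using Y0[of x] that Y by auto
      have "\<bar>u x / f x\<bar> \<le> 2" using *(2) abs_sin_le_one[of "\<kappa> * x + \<phi>"] by linarith
      then have "(u x / f x)\<^sup>2 \<le> 2\<^sup>2" by (subst abs_le_square_iff[symmetric]) simp
      then have "(u x / f x)\<^sup>2 * (f x)\<^sup>2 \<le> 4 * x powr (- s)" using *(1) by (intro mult_mono) auto
      moreover have "(u x / f x)\<^sup>2 * (f x)\<^sup>2 = (u x)\<^sup>2" using fpos[of x] by (simp add: power_divide)
      ultimately show ?thesis using UW(5)[of x] that Y by simp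
    qed
  qed (use x1 Y in auto)
qed

end

section \<open>Resonances and embedded eigenvalues\<close>

text \<open>
  The constant is \<open>C = |W| / (2\<^sup>N 2\<kappa>)\<close>, where \<open>W\<close> is the sum of the reciprocal products of small divisors over
  all words of \<open>N\<close> letters with total \<open>2\<kappa>\<close>; it refers to the phases and \<open>E\<close> only. The conventional value \<open>C = 1\<close>
  for \<open>W = 0\<close> concerns energies without any representation \<open>2\<kappa> = \<epsilon>\<^sub>1 \<alpha>\<^bsub>j\<^sub>1\<^esub> + \<dots> + \<epsilon>\<^sub>N \<alpha>\<^bsub>j\<^sub>N\<^esub>\<close>, since for
  generic phases a representation forces \<open>W \<noteq> 0\<close>. With \<open>\<Lambda> = 1 / C\<close> the profile at \<open>\<gamma> = 1 / N\<close> is at most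
  \<open>x\<^sup>-\<^sup>1\<close> for \<open>x \<ge> 1\<close> as soon as the product of the couplings reaches \<open>\<Lambda>\<close>.
\<close>

theorem theorem1p2:
  fixes p K :: nat
  assumes "p \<ge> 2" and "K \<ge> 1"
  shows "\<exists>P :: real_mpoly. P \<noteq> 0 \<and> mpoly_vars P \<subseteq> {1..K} \<and>
    (\<forall>\<alpha> :: nat \<Rightarrow> real. mpoly_eval P \<alpha> \<noteq> 0 \<longrightarrow>
      (\<forall>E \<in> resonance_set p (phase_set K \<alpha>) - resonance_set (p - 1) (phase_set K \<alpha>). E > 0 \<longrightarrow>
        (\<exists>C>0. \<exists>\<Lambda> :: real.
          \<forall>(j :: nat \<Rightarrow> nat) (\<epsilon> :: nat \<Rightarrow> real).
            (\<forall>i\<in>{1..p - 1}. j i \<in> {1..K} \<and> \<epsilon> i \<in> {1, -1}) \<and>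
            2 * sqrt E = (\<Sum>i=1..p - 1. \<epsilon> i * \<alpha> (j i)) \<longrightarrow>
          (\<forall>\<gamma> \<in> {1 / real p <.. 1 / (real p - 1)}. \<forall>lam :: nat \<Rightarrow> real.
            (\<forall>k\<in>{1..K}. lam k > 0) \<longrightarrow>
            (\<exists>(\<beta>\<^sub>0 :: real \<Rightarrow> real) (\<xi> :: nat \<Rightarrow> real \<Rightarrow> real).
              \<beta>\<^sub>0 C1_differentiable_on {0<..} \<and>
              deriv \<beta>\<^sub>0 \<in> O(\<lambda>x. x powr (- (real p * \<gamma>))) \<and>
              \<beta>\<^sub>0 \<in> O(\<lambda>x. x powr (- \<gamma>)) \<and>
              (\<forall>k\<in>{1..K}. \<xi> k C1_differentiable_on {0<..} \<and>
                 deriv (\<xi> k) \<in> O(\<lambda>x. x powr (- (real p * \<gamma>)))) \<and>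
              (\<forall>(x\<^sub>0 :: real) (V :: real \<Rightarrow> real).
                x\<^sub>0 > 0 \<and> V absolutely_integrable_on {0<..<x\<^sub>0} \<and>
                (\<forall>x\<ge>x\<^sub>0. V x =
                   (\<Sum>k=1..K. lam k * (1 / x powr \<gamma>) * cos (\<alpha> k * x + \<xi> k x)) + \<beta>\<^sub>0 x) \<longrightarrow>
                (\<exists>u :: real \<Rightarrow> real. schroedinger_solution V E u \<and>
                  (\<exists>a>0. \<exists>\<phi> :: real. \<exists>r :: real \<Rightarrow> complex. r \<in> o(\<lambda>_. 1) \<and>
                    (\<forall>\<^sub>F x in at_top.
                      complex_of_real (1 / sqrt E * hderiv u x) + \<i> * complex_of_real (u x) =
                      complex_of_real (a * decay_profile p \<gamma> C (\<Prod>i=1..p - 1. lam (j i)) x) *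
                      exp (\<i> * complex_of_real (sqrt E * x + \<phi>)) * (1 + r x)))) \<and>
                (\<gamma> < 1 / (real p - 1) \<or>
                 \<gamma> = 1 / (real p - 1) \<and> (\<Prod>i=1..p - 1. lam (j i)) \<ge> \<Lambda> \<longrightarrow>
                 (\<exists>\<theta>\<in>{0..<pi}. H_eigenvalue V \<theta> E))))))))"
proof -
  define N where "N = p - 1"
  have N: "N \<ge> 1" and pN: "p = Suc N" and rN: "real p - 1 = real N" using assms by (auto simp: N_def)
  obtain P where P: "P \<noteq> 0" "mpoly_vars P \<subseteq> {1..K}"
    "\<And>\<alpha>. mpoly_eval P \<alpha> \<noteq> 0 \<Longrightarrow> \<forall>w\<in>words K N. cancellation_free w \<longrightarrow> coupling_numerator w \<alpha> \<noteq> 0 \<and>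
      (\<forall>w'\<in>words K N. cancellation_free w' \<and> mset w \<noteq> mset w' \<longrightarrow> total_phase \<alpha> w \<noteq> total_phase \<alpha> w')"
    using generic_phases[OF N, of K] by blast
  let "\<exists>P. P \<noteq> 0 \<and> mpoly_vars P \<subseteq> {1..K} \<and> (\<forall>\<alpha>. mpoly_eval P \<alpha> \<noteq> 0 \<longrightarrow>
      (\<forall>E\<in>?S \<alpha>. E > 0 \<longrightarrow> (\<exists>C>0. \<exists>\<Lambda>. ?Q \<alpha> E C \<Lambda>)))" = ?thesis
  show ?thesis
  proof (rule exI[of _ P], intro conjI P(1,2) allI impI ballI)
    fix \<alpha> E
    assume P\<alpha>: "mpoly_eval P \<alpha> \<noteq> 0" and E: "E > 0"
      and res: "E \<in> resonance_set p (phase_set K \<alpha>) - resonance_set (p - 1) (phase_set K \<alpha>)"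
    define \<kappa> where "\<kappa> = sqrt E"
    have \<kappa>: "\<kappa> > 0" "\<kappa>\<^sup>2 = E" using E by (auto simp: \<kappa>_def)
    define W where "W = coupling_sum K \<alpha> N (2 * \<kappa>)"
    define C where "C = (if W = 0 then 1 else \<bar>W\<bar> / (2 ^ N * (2 * \<kappa>)))"
    have C: "C > 0" using \<kappa> by (simp add: C_def)
    have nonres: "2 * \<kappa> \<notin> sumset m (phase_set K \<alpha>)" if "m < N" for m
    proof
      assume m: "2 * \<kappa> \<in> sumset m (phase_set K \<alpha>)"
      then have "m \<noteq> 0" using \<kappa>(1) by (intro notI) (simp add: sumset_def)
      then have "m \<in> {1..p - 1 - 1}" using that by (auto simp: N_def)
      moreover have "E = (2 * \<kappa>)\<^sup>2 / 4" using \<kappa>(2) by (simp add: power_mult_distrib)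
      ultimately have "E \<in> resonance_set (p - 1) (phase_set K \<alpha>)"
        unfolding resonance_set_def using m by blast
      with res show False by simp
    qed
    show "\<exists>C>0. \<exists>\<Lambda>. ?Q \<alpha> E C \<Lambda>"
    proof (rule exI[of _ C], intro conjI C, rule exI[of _ "1 / C"], intro allI impI ballI, elim conjE)
      fix j :: "nat \<Rightarrow> nat" and \<epsilon> :: "nat \<Rightarrow> real" and \<gamma> :: real and lam :: "nat \<Rightarrow> real"
      assume j\<epsilon>: "\<forall>i\<in>{1..p - 1}. j i \<in> {1..K} \<and> \<epsilon> i \<in> {1, -1}"
        and sum: "2 * sqrt E = (\<Sum>i=1..p - 1. \<epsilon> i * \<alpha> (j i))"
        and \<gamma>: "\<gamma> \<in> {1 / real p <.. 1 / (real p - 1)}" and lam: "\<forall>k\<in>{1..K}. lam k > 0"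
      have \<gamma>pos: "\<gamma> > 0" using \<gamma> pN by (auto intro: less_trans[of 0 "1 / real p"])
      have \<gamma>_range: "real N * \<gamma> \<le> 1" "real (Suc N) * \<gamma> > 1"
        using \<gamma> N unfolding rN pN by (auto simp: field_simps)
      interpret R: resonant_potential K N \<alpha> lam \<kappa> \<gamma>
      proof
        fix w assume "set w \<subseteq> letters K" "length w < N"
        then show "total_phase \<alpha> w \<noteq> 2 * \<kappa>"
          using total_phase_in_sumset[of w K \<alpha>] nonres[of "length w"] by metis
      qed (use N \<kappa> \<gamma>pos \<gamma>_range in auto)
      define L where "L = (\<Prod>i=1..p - 1. lam (j i))"
      have "L > 0" unfolding L_def using lam j\<epsilon> by (intro prod_pos) auto
      define letter where "letter i = (if \<epsilon> i = 1 then int (j i) else - int (j i))" for i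
      define w\<^sub>0 where "w\<^sub>0 = map letter [1..<Suc N]"
      have letter: "letter i \<in> letters K" "phase \<alpha> (letter i) = \<epsilon> i * \<alpha> (j i)" "R.weight (letter i) = lam (j i) / 2"
        if "i \<in> {1..N}" for i
      proof -
        have "j i \<ge> 1" "j i \<le> K" "\<epsilon> i = 1 \<or> \<epsilon> i = -1" using j\<epsilon> that by (auto simp: N_def)
        then show "letter i \<in> letters K" "phase \<alpha> (letter i) = \<epsilon> i * \<alpha> (j i)" "R.weight (letter i) = lam (j i) / 2"
          by (auto simp: letter_def letters_def phase_def R.weight_def)
      qed
      have w0: "w\<^sub>0 \<in> words K N" using letter(1) by (auto simp: w\<^sub>0_def words_def)
      have interval: "set [1..<Suc N] = {1..N}" by auto
      have "total_phase \<alpha> w\<^sub>0 = (\<Sum>i=1..N. phase \<alpha> (letter i))"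
        unfolding total_phase_def w\<^sub>0_def map_map o_def
        by (subst sum_list_distinct_conv_sum_set) (simp_all only: interval distinct_upt)
      also have "\<dots> = 2 * \<kappa>" using sum letter(2) by (simp add: N_def \<kappa>_def)
      finally have tot0: "total_phase \<alpha> w\<^sub>0 = 2 * \<kappa>" .
      have "R.word_weight w\<^sub>0 = (\<Prod>i=1..N. R.weight (letter i))"
        unfolding R.word_weight_def w\<^sub>0_def map_map o_def
        by (subst prod.distinct_set_conv_list[symmetric]) (simp_all only: interval distinct_upt)
      also have "\<dots> = (\<Prod>i=1..N. lam (j i) / 2)" by (intro prod.cong refl letter(3))
      also have "\<dots> = L / 2 ^ N" by (simp add: L_def N_def prod_dividef)
      finally have weight0: "R.word_weight w\<^sub>0 = L / 2 ^ N" .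
      have separated: "total_phase \<alpha> w \<noteq> total_phase \<alpha> w'" if "w \<in> words K N" "w' \<in> words K N" "cancellation_free w"
        "cancellation_free w'" "mset w \<noteq> mset w'" for w w'
        using P(3)[OF P\<alpha>] that by blast
      have "W \<noteq> 0" unfolding W_def
        by (rule coupling_sum_nonzero[OF separated _ nonres w0 tot0 N]) (use P(3)[OF P\<alpha>] in auto)
      have "R.reflection = L / 2 ^ N * W" unfolding W_def
      proof (rule R.reflection_eq)
        fix w assume "w \<in> words K N" "total_phase \<alpha> w = 2 * \<kappa>"
        then have "mset w = mset w\<^sub>0"
          using resonant_words_are_rearrangements[OF separated nonres w0 tot0] by blast
        then have "mset (map R.weight w) = mset (map R.weight w\<^sub>0)" by simp
        then have "R.word_weight w = R.word_weight w\<^sub>0"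
          unfolding R.word_weight_def by (metis prod_mset_prod_list)
        then show "R.word_weight w = L / 2 ^ N" using weight0 by simp
      qed
      then have reflection: "R.reflection \<noteq> 0" "\<bar>R.reflection\<bar> / (2 * \<kappa>) = C * L"
        using \<open>W \<noteq> 0\<close> \<open>L > 0\<close> by (auto simp: C_def abs_mult)
      \<comment> \<open>The summand \<open>0\<close> in the cosine is the value of \<open>\<xi>\<^sub>k\<close>.\<close>
      have tail:
        "has_solution_with_profile V E (decay_profile p \<gamma> C L)"
        "\<gamma> < 1 / (real p - 1) \<or> \<gamma> = 1 / (real p - 1) \<and> L \<ge> 1 / C \<Longrightarrow> \<exists>\<theta>\<in>{0..<pi}. H_eigenvalue V \<theta> E"
        if V: "x\<^sub>0 > 0 \<and> V absolutely_integrable_on {0<..<x\<^sub>0} \<and>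
          (\<forall>x\<ge>x\<^sub>0. V x = (\<Sum>k=1..K. lam k * (1 / x powr \<gamma>) * cos (\<alpha> k * x + 0)) + R.correction x)"
        for x\<^sub>0 V
      proof -
        from V have V': "x\<^sub>0 > 0" "V absolutely_integrable_on {0<..<x\<^sub>0}"
          "\<And>x. x \<ge> x\<^sub>0 \<Longrightarrow> V x = R.potential x" by (auto simp: R.potential_eq)
        note solution = R.half_line_solution[OF reflection(1) V' reflection(2)]
        show "has_solution_with_profile V E (decay_profile p \<gamma> C L)"
          using solution(1) unfolding \<kappa>(2) pN .
        assume *: "\<gamma> < 1 / (real p - 1) \<or> \<gamma> = 1 / (real p - 1) \<and> L \<ge> 1 / C"
        have "C * L \<ge> 1" if "real N * \<gamma> = 1"
        proof -
          have "\<gamma> = 1 / (real p - 1)" using that N unfolding rN by (simp add: field_simps)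
          then have "L \<ge> 1 / C" using * by auto
          then show ?thesis using C by (simp add: field_simps)
        qed
        then show "\<exists>\<theta>\<in>{0..<pi}. H_eigenvalue V \<theta> E"
          using solution(2) unfolding \<kappa>(2) by blast
      qed
      let "\<forall>j \<epsilon>. ?rep j \<epsilon> \<longrightarrow> (\<forall>\<gamma>\<in>?I. \<forall>lam. ?pos lam \<longrightarrow> ?B j \<gamma> lam)" = "?Q \<alpha> E C (1 / C)"
      show "?B j \<gamma> lam"
      proof (rule exI[of _ R.correction], rule exI[of _ "\<lambda>_ _. 0"], intro conjI allI ballI impI)
        show "R.correction C1_differentiable_on {0<..}" by (rule R.correction_C1)
        show "deriv R.correction \<in> O(\<lambda>x. x powr (- (real p * \<gamma>)))"
          using R.correction_deriv_bigo unfolding pN .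
        show "R.correction \<in> O(\<lambda>x. x powr (- \<gamma>))" by (rule R.correction_bigo)
        show "(\<lambda>_ :: real. 0 :: real) C1_differentiable_on {0<..}" by simp
        show "deriv (\<lambda>_ :: real. 0 :: real) \<in> O(\<lambda>x. x powr (- (real p * \<gamma>)))" by simp
      qed (erule tail(1)[unfolded has_solution_with_profile_def L_def],
          erule tail(2)[unfolded L_def], assumption)
    qed
  qed
qed

end
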